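(* Let $d\ge 1$ be a constant integer. Let $q$ be an unknown distribution over the $d$-dimensional hypercube $[0,1]^d$. There is an algorithm which, given $\tilde O\left(\varepsilon^{-\max\{d/2,\,2\}}\right)$ samples from $q$, - accepts with probability at least $2/3$ if $q$ is the uniform distribution on $[0,1]^d$; - rejects with probability at least $2/3$ if $q$ is $\varepsilon$-far from the uniform distribution on $[0,1]^d$ in Euclidean Wasserstein distance. On the other hand, any algorithm for this task requires $\Omega\left(\varepsilon^{-\max\{2,\,d/2\}}\right)$ many samples. Moreover, replacing $[0,1]^d$ with the unit ball $B_d(0,1)$ of $\mathbb{R}^d$ (and the uniform distribution on $[0,1]^d$ with the uniform distribution on $B_d(0,1)$), the sample complexity is still $\tilde O\left(\varepsilon^{-\max\{d/2,\,2\}}\right)$.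
   Context: For distributions $p,q$ on a subset $X$ of $\mathbb{R}^d$, the Euclidean Wasserstein distance is $W(p,q)=\inf_{M\in\mathrm{coup}(p,q)}\int\|x-y\|_2\,dM(x,y)$, where $\mathrm{coup}(p,q)$ is the set of distributions on $X\times X$ with marginals $p$ and $q$. A distribution $q$ is $\varepsilon$-far from $p$ if $W(p,q)\ge\varepsilon$. The (possibly randomized) algorithm receives i.i.d. samples from $q$ and knows $\varepsilon$; its sample complexity is the number of samples it uses. Asymptotic notation is as $\varepsilon\to 0$; constants in $O$, $\Omega$ may depend on $d$ only, and $\tilde O$ additionally hides factors polylogarithmic in $1/\varepsilon$. *)

theory Defs
  imports "HOL-Probability.Probability" "HOL-Library.Landau_Symbols"
begin

text \<open>Distributions on \<open>X\<close> are Borel probability measures on the ambient space that give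
  \<open>X\<close> full mass. If \<open>X\<close> is not a Borel set, there are none.\<close>

definition distributions_on :: "'a::topological_space set \<Rightarrow> 'a measure set" where
  "distributions_on X = {p. prob_space p \<and> sets p = sets borel \<and> emeasure p X = 1}"

definition coup ::
  "'a::topological_space set \<Rightarrow> 'a measure \<Rightarrow> 'a measure \<Rightarrow> ('a \<times> 'a) measure set" where
  "coup X p q =
     {M \<in> distributions_on (X \<times> X). distr M borel fst = p \<and> distr M borel snd = q}"

definition wasserstein ::
  "(real ^ 'd) set \<Rightarrow> (real ^ 'd) measure \<Rightarrow> (real ^ 'd) measure \<Rightarrow> ennreal" where
  "wasserstein X p q = (INF M \<in> coup X p q. \<integral>\<^sup>+ (x, y). ennreal (norm (x - y)) \<partial>M)"

definition far_from ::
  "(real ^ 'd) set \<Rightarrow> real \<Rightarrow> (real ^ 'd) measure \<Rightarrow> (real ^ 'd) measure \<Rightarrow> bool" where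
  "far_from X \<epsilon> p q \<longleftrightarrow> ennreal \<epsilon> \<le> wasserstein X p q"

abbreviation uniform_on :: "(real ^ 'd) set \<Rightarrow> (real ^ 'd) measure" where
  "uniform_on X \<equiv> uniform_measure lborel X"

abbreviation unit_cube :: "(real ^ 'd) set" where
  "unit_cube \<equiv> {x. \<forall>i. 0 \<le> x $ i \<and> x $ i \<le> 1}"

abbreviation unit_ball :: "(real ^ 'd) set" where
  "unit_ball \<equiv> cball 0 1"

text \<open>A randomized algorithm using \<open>n\<close> samples is a Markov kernel from sample vectors to
  verdicts, with \<open>True\<close> for accept and \<open>False\<close> for reject.\<close>

definition randomized_algorithms :: "nat \<Rightarrow> ((nat \<Rightarrow> real ^ 'd) \<Rightarrow> bool measure) set" where
  "randomized_algorithms n =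
     (\<Pi>\<^sub>M i\<in>{..<n}. borel) \<rightarrow>\<^sub>M prob_algebra (count_space UNIV)"

definition verdict ::
  "nat \<Rightarrow> ((nat \<Rightarrow> real ^ 'd) \<Rightarrow> bool measure) \<Rightarrow> (real ^ 'd) measure \<Rightarrow> bool measure" where
  "verdict n A q = (\<Pi>\<^sub>M i\<in>{..<n}. q) \<bind> A"

definition uniformity_tester ::
  "(real ^ 'd) set \<Rightarrow> real \<Rightarrow> nat \<Rightarrow> ((nat \<Rightarrow> real ^ 'd) \<Rightarrow> bool measure) \<Rightarrow> bool" where
  "uniformity_tester X \<epsilon> n A \<longleftrightarrow>
     A \<in> randomized_algorithms n \<and>
     measure (verdict n A (uniform_on X)) {True} \<ge> 2 / 3 \<and>
     (\<forall>q \<in> distributions_on X. far_from X \<epsilon> (uniform_on X) q \<longrightarrow>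
        measure (verdict n A q) {False} \<ge> 2 / 3)"

definition soft_bigo :: "(real \<Rightarrow> real) \<Rightarrow> (real \<Rightarrow> real) set" where
  "soft_bigo f = (\<Union>k::nat. O[at_right 0](\<lambda>\<epsilon>. f \<epsilon> * ln (1 / \<epsilon>) ^ k))"

end

theory Submission
  imports Defs
begin

text \<open>
  Upper bound: greedy matching in the tree of dyadic cells couples \<open>q\<close> with the uniform distribution
  at cost \<open>O(2\<^sup>-\<^sup>L + (\<Sum>k<L. 2\<^sup>-\<^sup>k * TV\<^sub>k\<^sub>+\<^sub>1))\<close>, where \<open>TV\<^sub>k\<close> is the \<open>L\<^sub>1\<close> distance of the masses of the cells
  of side \<open>2\<^sup>-\<^sup>k\<close>. Hence, with \<open>L \<approx> log (1 / \<epsilon>)\<close>, an \<open>\<epsilon>\<close>-far distribution has \<open>TV\<^sub>k \<ge> c * \<epsilon> * 2\<^sup>k / L\<close>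
  at some level \<open>k\<close>. Each level is tested by a chi-square type statistic that correlates the cell
  counts of two independent batches; the second moment method shows that \<open>L * 2\<^sup>k\<^sup>d\<^sup>/\<^sup>2 / TV\<^sub>k\<^sup>2\<close> samples suffice,
  and the worst level is the finest for \<open>d > 4\<close> and the coarsest for \<open>d < 4\<close>. The argument only uses
  that the domain is bounded, so it covers the ball as well.

  Lower bound: perturb the uniform density by \<open>\<plusminus>\<delta>\<close> on pairs of cells of a grid with \<open>M\<^sup>d\<close> cells, with random
  signs. By a Lipschitz test function every perturbation is at distance at least \<open>c * \<delta> / M\<close>, and
  the second moment of the likelihood ratio of the mixture is at most \<open>exp (n\<^sup>2 * \<delta>\<^sup>4 / M\<^sup>d)\<close>. The choice
  \<open>M = 2\<close>, \<open>\<delta> \<approx> \<epsilon>\<close> gives \<open>n \<ge> c * \<epsilon>\<^sup>-\<^sup>2\<close>, and \<open>\<delta> = 1\<close>, \<open>M \<approx> 1 / \<epsilon>\<close> gives \<open>n \<ge> c * \<epsilon>\<^sup>-\<^sup>d\<^sup>/\<^sup>2\<close>.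
\<close>

section \<open>Moments of the two-batch statistic\<close>

text \<open>Dividing by the mass plus the reciprocal of the number of cells bounds the weights from
  below while their sum stays at most 2; this lets one test serve cube and ball alike. Multiplying
  the counts of two disjoint batches removes the bias of a squared count and keeps the sample size
  deterministic. All levels read the same samples: under the uniform distribution a union bound is
  paid for by one logarithmic factor, whereas a far distribution has to be caught at a single level
  only. For the lower bound the random signs must be visible to transport. The test function is the
  sign of the cell times the distance to the cell walls, which is 1-Lipschitz although the sign
  jumps. Pairing the cells makes every perturbation exactly a probability density while the signs of
  different pairs stay independent, so that the bound on the second moment factors over the
  pairs.\<close>

lemma (in prob_space) integrable_bounded:
  fixes f :: "'a \<Rightarrow> real"
  assumes "f \<in> borel_measurable M" "\<And>x. \<bar>f x\<bar> \<le> B"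
  shows "integrable M f"
  using assms by (intro integrable_const_bound[of _ B]) auto

text \<open>Collect in \<open>h t\<close> all factors that read coordinate \<open>t\<close>: the
  integrand becomes a product over the index set and its integral splits. Coincidences
  \<open>i = k\<close> or \<open>j = l\<close> produce second moments; a coincidence across the two
  pairs is excluded, since these will come from different batches.\<close>

lemma expectation_product4:
  fixes q :: "'a measure" and f f' g g' :: "'a \<Rightarrow> real"
  assumes q: "prob_space q"
    and [measurable]: "f \<in> borel_measurable q" "f' \<in> borel_measurable q"
      "g \<in> borel_measurable q" "g' \<in> borel_measurable q"
    and bd: "\<And>x. \<bar>f x\<bar> \<le> 1" "\<And>x. \<bar>f' x\<bar> \<le> 1" "\<And>x. \<bar>g x\<bar> \<le> 1" "\<And>x. \<bar>g' x\<bar> \<le> 1"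
    and idx: "finite I" "i \<in> I" "k \<in> I" "j \<in> I" "l \<in> I" "{i, k} \<inter> {j, l} = {}"
  shows "(\<integral>x. f (x i) * f' (x k) * (g (x j) * g' (x l)) \<partial>(\<Pi>\<^sub>M i\<in>I. q)) =
    (if i = k then (\<integral>y. f y * f' y \<partial>q) else (\<integral>y. f y \<partial>q) * (\<integral>y. f' y \<partial>q)) *
    (if j = l then (\<integral>y. g y * g' y \<partial>q) else (\<integral>y. g y \<partial>q) * (\<integral>y. g' y \<partial>q))"
proof -
  interpret q: prob_space q by fact
  interpret product_prob_space "\<lambda>_. q" ..
  define h where "h t y = (if t = i then f y else 1) * (if t = k then f' y else 1) *
    ((if t = j then g y else 1) * (if t = l then g' y else 1))" for t y
  have [measurable]: "h t \<in> borel_measurable q" for t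
    unfolding h_def by measurable
  have h1: "\<bar>h t y\<bar> \<le> 1" for t y
    unfolding h_def abs_mult using bd by (intro mult_le_one) auto
  have int: "integrable q (h t)" for t
    by (rule q.integrable_bounded[OF _ h1]) simp
  have "(\<integral>x. f (x i) * f' (x k) * (g (x j) * g' (x l)) \<partial>(\<Pi>\<^sub>M i\<in>I. q)) =
      (\<integral>x. (\<Prod>t\<in>I. h t (x t)) \<partial>(\<Pi>\<^sub>M i\<in>I. q))"
    unfolding h_def prod.distrib using idx by (simp add: prod.delta)
  also have "\<dots> = (\<Prod>t\<in>I. \<integral>y. h t y \<partial>q)"
    by (rule product_integral_prod) (use idx int in auto)
  also have "\<dots> = (\<Prod>t\<in>{i, k} \<union> {j, l}. \<integral>y. h t y \<partial>q)"
    by (rule prod.mono_neutral_right) (use idx in \<open>auto simp: h_def q.prob_space\<close>)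
  also have "\<dots> = (\<Prod>t\<in>{i, k}. \<integral>y. h t y \<partial>q) * (\<Prod>t\<in>{j, l}. \<integral>y. h t y \<partial>q)"
    by (rule prod.union_disjoint) (use idx in auto)
  also have "(\<Prod>t\<in>{i, k}. \<integral>y. h t y \<partial>q) =
      (if i = k then (\<integral>y. f y * f' y \<partial>q) else (\<integral>y. f y \<partial>q) * (\<integral>y. f' y \<partial>q))"
    using idx unfolding h_def by auto
  also have "(\<Prod>t\<in>{j, l}. \<integral>y. h t y \<partial>q) =
      (if j = l then (\<integral>y. g y * g' y \<partial>q) else (\<integral>y. g y \<partial>q) * (\<integral>y. g' y \<partial>q))"
    using idx unfolding h_def by auto
  finally show ?thesis .
qed

lemma sum_if_eq_pairs:
  fixes a b :: real
  shows "(\<Sum>i<m. \<Sum>k<m. if i = k then a else b) = real m * (a - b) + (real m)\<^sup>2 * b"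
proof -
  have "(\<Sum>k<m. if i = k then a else b) = (a - b) + real m * b" if "i < m" for i
  proof -
    have "(\<Sum>k<m. if i = k then a else b) = (\<Sum>k<m. (if i = k then a - b else 0) + b)"
      by (intro sum.cong) auto
    also have "\<dots> = (a - b) + real m * b"
      using that by (simp add: sum.distrib)
    finally show ?thesis .
  qed
  then have "(\<Sum>i<m. \<Sum>k<m. if i = k then a else b) = (\<Sum>i<m. (a - b) + real m * b)"
    by (intro sum.cong) auto
  then show ?thesis
    by (simp add: algebra_simps power2_eq_square)
qed

lemma sum_product4:
  fixes a b c d :: "_ \<Rightarrow> real"
  shows "sum a A * sum b B * (sum c C * sum d D) = (\<Sum>i\<in>A. \<Sum>k\<in>B. \<Sum>j\<in>C. \<Sum>l\<in>D. a i * b k * (c j * d l))"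
proof -
  have *: "sum a A * sum b B * X = (\<Sum>i\<in>A. \<Sum>k\<in>B. a i * b k * X)" for X
    unfolding sum_product[of a _ b] unfolding sum_distrib_right ..
  show ?thesis
    unfolding * unfolding sum_product[of c _ d] unfolding sum_distrib_left ..
qed

lemma integral_sum4:
  fixes F :: "_ \<Rightarrow> _ \<Rightarrow> _ \<Rightarrow> _ \<Rightarrow> _ \<Rightarrow> real"
  assumes "\<And>i k j l. i \<in> A \<Longrightarrow> k \<in> B \<Longrightarrow> j \<in> C \<Longrightarrow> l \<in> D \<Longrightarrow> integrable M (F i k j l)"
  shows "(\<integral>x. (\<Sum>i\<in>A. \<Sum>k\<in>B. \<Sum>j\<in>C. \<Sum>l\<in>D. F i k j l x) \<partial>M) =
    (\<Sum>i\<in>A. \<Sum>k\<in>B. \<Sum>j\<in>C. \<Sum>l\<in>D. \<integral>x. F i k j l x \<partial>M)"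
proof -
  have D: "integrable M (\<lambda>x. \<Sum>l\<in>D. F i k j l x)" if "i \<in> A" "k \<in> B" "j \<in> C" for i k j
    using assms[OF that] by (rule Bochner_Integration.integrable_sum)
  have C: "integrable M (\<lambda>x. \<Sum>j\<in>C. \<Sum>l\<in>D. F i k j l x)" if "i \<in> A" "k \<in> B" for i k
    using D[OF that] by (rule Bochner_Integration.integrable_sum)
  have B: "integrable M (\<lambda>x. \<Sum>k\<in>B. \<Sum>j\<in>C. \<Sum>l\<in>D. F i k j l x)" if "i \<in> A" for i
    using C[OF that] by (rule Bochner_Integration.integrable_sum)
  show ?thesis
    by (simp add: Bochner_Integration.integral_sum[OF B] Bochner_Integration.integral_sum[OF C]
        Bochner_Integration.integral_sum[OF D] Bochner_Integration.integral_sum[OF assms] cong: sum.cong)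
qed

text \<open>\<open>S a b\<close> is the mixed second moment of the sums of \<open>a\<close> and
  \<open>b\<close> over \<open>m\<close> independent samples. The batches use disjoint coordinates,
  so an expectation of order four is a product of two such moments and no fourth moment of a single
  sample occurs.\<close>

lemma expectation_two_batches:
  fixes q :: "'a measure" and f f' g g' :: "'a \<Rightarrow> real"
  assumes q: "prob_space q"
    and meas[measurable]: "f \<in> borel_measurable q" "f' \<in> borel_measurable q"
      "g \<in> borel_measurable q" "g' \<in> borel_measurable q"
    and bd: "\<And>x. \<bar>f x\<bar> \<le> 1" "\<And>x. \<bar>f' x\<bar> \<le> 1" "\<And>x. \<bar>g x\<bar> \<le> 1" "\<And>x. \<bar>g' x\<bar> \<le> 1"
  fixes m :: nat
  defines "S \<equiv> \<lambda>a b. real m * ((\<integral>y. a y * b y \<partial>q) - (\<integral>y. a y \<partial>q) * (\<integral>y. b y \<partial>q)) +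
      (real m)\<^sup>2 * ((\<integral>y. a y \<partial>q) * (\<integral>y. b y \<partial>q))"
  shows "(\<integral>x. (\<Sum>i<m. f (x i)) * (\<Sum>k<m. f' (x k)) * ((\<Sum>j<m. g (x (m + j))) * (\<Sum>l<m. g' (x (m + l))))
      \<partial>(\<Pi>\<^sub>M i\<in>{..<2 * m}. q)) = S f f' * S g g'"
proof -
  interpret q: prob_space q by fact
  interpret product_prob_space "\<lambda>_. q" ..
  interpret PM: prob_space "\<Pi>\<^sub>M i\<in>{..<2 * m}. q"
    by (intro prob_space_PiM q)
  have int: "integrable (\<Pi>\<^sub>M i\<in>{..<2 * m}. q) (\<lambda>x. f (x i) * f' (x k) * (g (x (m + j)) * g' (x (m + l))))"
    if "i < m" "k < m" "j < m" "l < m" for i j k l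
  proof (rule PM.integrable_bounded[where B = 1])
    have [measurable]: "i \<in> {..<2*m}" "k \<in> {..<2*m}" "m + j \<in> {..<2*m}" "m + l \<in> {..<2*m}"
      using that by auto
    show "(\<lambda>x. f (x i) * f' (x k) * (g (x (m + j)) * g' (x (m + l)))) \<in> borel_measurable (\<Pi>\<^sub>M i\<in>{..<2 * m}. q)"
      by measurable
    show "\<bar>f (x i) * f' (x k) * (g (x (m + j)) * g' (x (m + l)))\<bar> \<le> 1" for x
      unfolding abs_mult by (intro mult_le_one bd mult_nonneg_nonneg) auto
  qed
  have "(\<integral>x. (\<Sum>i<m. f (x i)) * (\<Sum>k<m. f' (x k)) * ((\<Sum>j<m. g (x (m + j))) * (\<Sum>l<m. g' (x (m + l))))
      \<partial>(\<Pi>\<^sub>M i\<in>{..<2 * m}. q)) =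
    (\<integral>x. (\<Sum>i<m. \<Sum>k<m. \<Sum>j<m. \<Sum>l<m. f (x i) * f' (x k) * (g (x (m + j)) * g' (x (m + l))))
      \<partial>(\<Pi>\<^sub>M i\<in>{..<2 * m}. q))"
    unfolding sum_product4 ..
  also have "\<dots> = (\<Sum>i<m. \<Sum>k<m. \<Sum>j<m. \<Sum>l<m.
      \<integral>x. f (x i) * f' (x k) * (g (x (m + j)) * g' (x (m + l))) \<partial>(\<Pi>\<^sub>M i\<in>{..<2 * m}. q))"
    by (rule integral_sum4) (use int in auto)
  also have "\<dots> = (\<Sum>i<m. \<Sum>k<m. \<Sum>j<m. \<Sum>l<m.
    (if i = k then (\<integral>y. f y * f' y \<partial>q) else (\<integral>y. f y \<partial>q) * (\<integral>y. f' y \<partial>q)) *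
    (if j = l then (\<integral>y. g y * g' y \<partial>q) else (\<integral>y. g y \<partial>q) * (\<integral>y. g' y \<partial>q)))"
  proof (intro sum.cong refl)
    fix i k j l assume "i \<in> {..<m}" "k \<in> {..<m}" "j \<in> {..<m}" "l \<in> {..<m}"
    then show "(\<integral>x. f (x i) * f' (x k) * (g (x (m + j)) * g' (x (m + l))) \<partial>(\<Pi>\<^sub>M i\<in>{..<2 * m}. q)) =
      (if i = k then (\<integral>y. f y * f' y \<partial>q) else (\<integral>y. f y \<partial>q) * (\<integral>y. f' y \<partial>q)) *
      (if j = l then (\<integral>y. g y * g' y \<partial>q) else (\<integral>y. g y \<partial>q) * (\<integral>y. g' y \<partial>q))"
      by (subst expectation_product4[OF q meas bd]) auto
  qed
  also have "\<dots> = S f f' * S g g'"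
    unfolding S_def sum_if_eq_pairs[symmetric] sum_distrib_left[symmetric] sum_distrib_right[symmetric] ..
  finally show ?thesis .
qed


text \<open>Jensen's inequality for a sub-probability weight: expand a weighted sum of squared
  deviations from \<open>\<mu>\<close>; missing mass only lowers the coefficient of
  \<open>\<mu>\<^sup>2\<close>.\<close>

lemma weighted_sum_square_le:
  fixes p t :: "'b \<Rightarrow> real"
  assumes "\<And>c. c \<in> C \<Longrightarrow> 0 \<le> p c" "sum p C \<le> 1"
  shows "(\<Sum>c\<in>C. p c * t c)\<^sup>2 \<le> (\<Sum>c\<in>C. p c * (t c)\<^sup>2)"
proof -
  define \<mu> where "\<mu> = (\<Sum>c\<in>C. p c * t c)"
  have "0 \<le> (\<Sum>c\<in>C. p c * (t c - \<mu>)\<^sup>2)"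
    by (intro sum_nonneg mult_nonneg_nonneg assms) auto
  also have "\<dots> = (\<Sum>c\<in>C. p c * (t c)\<^sup>2 - 2 * \<mu> * (p c * t c) + \<mu>\<^sup>2 * p c)"
    by (intro sum.cong) (auto simp: power2_eq_square algebra_simps)
  also have "\<dots> = (\<Sum>c\<in>C. p c * (t c)\<^sup>2) - 2 * \<mu> * \<mu> + \<mu>\<^sup>2 * sum p C"
    by (simp add: sum.distrib sum_subtractf sum_distrib_left[symmetric] \<mu>_def)
  also have "\<dots> \<le> (\<Sum>c\<in>C. p c * (t c)\<^sup>2) - 2 * \<mu> * \<mu> + \<mu>\<^sup>2 * 1"
    by (intro add_left_mono mult_left_mono assms) auto
  finally show ?thesis
    by (simp add: \<mu>_def power2_eq_square)
qed

lemma second_moment_algebra: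
  fixes p d w :: "'b \<Rightarrow> real" and m :: real
  assumes C: "finite C" and p: "\<And>c. c \<in> C \<Longrightarrow> 0 \<le> p c" "sum p C \<le> 1"
    and w: "\<And>c. c \<in> C \<Longrightarrow> 0 < w c" and m: "0 \<le> m"
  shows "(\<Sum>c\<in>C. \<Sum>c'\<in>C. (m * ((if c = c' then p c else 0) - p c * p c') + m\<^sup>2 * (d c * d c'))\<^sup>2 / (w c * w c'))
    - (m\<^sup>2 * (\<Sum>c\<in>C. (d c)\<^sup>2 / w c))\<^sup>2
    \<le> m\<^sup>2 * (\<Sum>c\<in>C. (p c / w c)\<^sup>2) + 2 * m ^ 3 * (\<Sum>c\<in>C. p c * (d c / w c)\<^sup>2)"
proof -
  define V where "V c c' = (if c = c' then p c else 0) - p c * p c'" for c c'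
  have VD: "(\<Sum>c\<in>C. \<Sum>c'\<in>C. V c c' * (d c * d c') / (w c * w c')) \<le> (\<Sum>c\<in>C. p c * (d c / w c)\<^sup>2)"
  proof -
    have "(\<Sum>c\<in>C. \<Sum>c'\<in>C. V c c' * (d c * d c') / (w c * w c')) =
      (\<Sum>c\<in>C. \<Sum>c'\<in>C. (if c = c' then p c * (d c / w c)\<^sup>2 else 0) - (p c * (d c / w c)) * (p c' * (d c' / w c')))"
      unfolding V_def by (intro sum.cong) (auto simp: power2_eq_square field_simps diff_divide_distrib)
    also have "\<dots> = (\<Sum>c\<in>C. p c * (d c / w c)\<^sup>2) - (\<Sum>c\<in>C. p c * (d c / w c))\<^sup>2"
      using C by (simp add: sum_subtractf power2_eq_square sum_product)
    finally show ?thesis by simp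
  qed
  have VV: "(\<Sum>c\<in>C. \<Sum>c'\<in>C. (V c c')\<^sup>2 / (w c * w c')) \<le> (\<Sum>c\<in>C. (p c / w c)\<^sup>2)"
  proof -
    have "(\<Sum>c\<in>C. \<Sum>c'\<in>C. (V c c')\<^sup>2 / (w c * w c')) =
      (\<Sum>c\<in>C. \<Sum>c'\<in>C. (if c = c' then (p c / w c)\<^sup>2 - 2 * (p c * (p c / w c)\<^sup>2) else 0)
        + (p c * (p c / w c)) * (p c' * (p c' / w c')))"
      unfolding V_def by (intro sum.cong refl) (auto simp: power2_eq_square algebra_simps add_divide_distrib diff_divide_distrib)
    also have "\<dots> = (\<Sum>c\<in>C. (p c / w c)\<^sup>2) - 2 * (\<Sum>c\<in>C. p c * (p c / w c)\<^sup>2) + (\<Sum>c\<in>C. p c * (p c / w c))\<^sup>2"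
      unfolding sum.distrib power2_eq_square[of "sum _ _"] sum_product
      using C by (simp add: sum_subtractf sum_distrib_left)
    also have "\<dots> \<le> (\<Sum>c\<in>C. (p c / w c)\<^sup>2)"
      using weighted_sum_square_le[of C p "\<lambda>c. p c / w c"] p
        sum_nonneg[of C "\<lambda>c. p c * (p c / w c)\<^sup>2"] by (simp add: mult_nonneg_nonneg)
    finally show ?thesis .
  qed
  have DD: "(\<Sum>c\<in>C. \<Sum>c'\<in>C. (d c * d c')\<^sup>2 / (w c * w c')) = (\<Sum>c\<in>C. (d c)\<^sup>2 / w c)\<^sup>2"
    by (simp add: power2_eq_square sum_product algebra_simps)
  have "(\<Sum>c\<in>C. \<Sum>c'\<in>C. (m * V c c' + m\<^sup>2 * (d c * d c'))\<^sup>2 / (w c * w c')) =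
    (\<Sum>c\<in>C. \<Sum>c'\<in>C. m\<^sup>2 * ((V c c')\<^sup>2 / (w c * w c')) + 2 * m ^ 3 * (V c c' * (d c * d c') / (w c * w c'))
       + m ^ 4 * ((d c * d c')\<^sup>2 / (w c * w c')))"
    by (intro sum.cong refl) (simp add: power2_eq_square power3_eq_cube power4_eq_xxxx algebra_simps add_divide_distrib)
  also have "\<dots> = m\<^sup>2 * (\<Sum>c\<in>C. \<Sum>c'\<in>C. (V c c')\<^sup>2 / (w c * w c')) +
      2 * m ^ 3 * (\<Sum>c\<in>C. \<Sum>c'\<in>C. V c c' * (d c * d c') / (w c * w c')) +
      m ^ 4 * (\<Sum>c\<in>C. (d c)\<^sup>2 / w c)\<^sup>2"
    unfolding DD[symmetric] by (simp only: sum.distrib sum_distrib_left)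
  also have "\<dots> \<le> m\<^sup>2 * (\<Sum>c\<in>C. (p c / w c)\<^sup>2) + 2 * m ^ 3 * (\<Sum>c\<in>C. p c * (d c / w c)\<^sup>2) +
      m ^ 4 * (\<Sum>c\<in>C. (d c)\<^sup>2 / w c)\<^sup>2"
    using m by (intro add_mono mult_left_mono VV VD order_refl) auto
  finally show ?thesis
    unfolding V_def by (simp add: power_mult_distrib flip: power_mult)
qed

text \<open>The first \<open>m\<close> samples form one batch and the next \<open>m\<close> the
  other; \<open>u\<close> will be the null mass of a cell and \<open>w\<close> its weight. The
  square of one centred count would have the variance of the count added to its squared mean; the
  product of two independent counts has no such excess.\<close>

definition cell_statistic ::
  "nat \<Rightarrow> 'b set \<Rightarrow> ('b \<Rightarrow> 'a set) \<Rightarrow> ('b \<Rightarrow> real) \<Rightarrow> ('b \<Rightarrow> real) \<Rightarrow> (nat \<Rightarrow> 'a) \<Rightarrow> real" where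
  "cell_statistic m C E u w x =
    (\<Sum>c\<in>C. (\<Sum>i<m. indicator (E c) (x i) - u c) * (\<Sum>j<m. indicator (E c) (x (m + j)) - u c) / w c)"

lemma cell_statistic_measurable:
  assumes [measurable]: "\<And>c. c \<in> C \<Longrightarrow> E c \<in> sets q" and "2 * m \<le> n"
  shows "cell_statistic m C E u w \<in> borel_measurable (\<Pi>\<^sub>M i\<in>{..<n}. q)"
  unfolding cell_statistic_def
proof (intro borel_measurable_sum borel_measurable_divide borel_measurable_times borel_measurable_diff
    borel_measurable_const)
  fix c i assume c[measurable]: "c \<in> C" and "i \<in> {..<m}"
  then have [measurable]: "i \<in> {..<n}" "m + i \<in> {..<n}" using assms by auto
  show "(\<lambda>x. indicator (E c) (x i) :: real) \<in> borel_measurable (\<Pi>\<^sub>M i\<in>{..<n}. q)"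
    "(\<lambda>x. indicator (E c) (x (m + i)) :: real) \<in> borel_measurable (\<Pi>\<^sub>M i\<in>{..<n}. q)"
    by measurable
qed

lemma cell_statistic_moments:
  fixes m :: nat and q :: "'a measure" and E :: "'b \<Rightarrow> 'a set" and u w :: "'b \<Rightarrow> real"
  assumes q: "prob_space q" and C: "finite C" and disj: "disjoint_family_on E C"
    and E: "\<And>c. c \<in> C \<Longrightarrow> E c \<in> sets q"
    and u: "\<And>c. c \<in> C \<Longrightarrow> 0 \<le> u c" "\<And>c. c \<in> C \<Longrightarrow> u c \<le> 1" and w: "\<And>c. c \<in> C \<Longrightarrow> 0 < w c"
  defines "p \<equiv> \<lambda>c. measure q (E c)" and "P \<equiv> \<Pi>\<^sub>M i\<in>{..<2 * m}. q" and "T \<equiv> cell_statistic m C E u w"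
  shows "integrable P T" "integrable P (\<lambda>x. (T x)\<^sup>2)"
    "(\<integral>x. T x \<partial>P) = (real m)\<^sup>2 * (\<Sum>c\<in>C. (p c - u c)\<^sup>2 / w c)"
    "(\<integral>x. (T x)\<^sup>2 \<partial>P) - (\<integral>x. T x \<partial>P)\<^sup>2 \<le>
      (real m)\<^sup>2 * (\<Sum>c\<in>C. (p c / w c)\<^sup>2) + 2 * real m ^ 3 * (\<Sum>c\<in>C. p c * ((p c - u c) / w c)\<^sup>2)"
proof -
  interpret q: prob_space q by fact
  interpret PM: prob_space P
    unfolding P_def by (intro prob_space_PiM q)
  define \<phi> where "\<phi> c y = (indicator (E c) y - u c :: real)" for c y
  have \<phi>_meas: "\<phi> c \<in> borel_measurable q" if "c \<in> C" for c
    using E[OF that] unfolding \<phi>_def by measurable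
  have \<phi>_bd: "\<bar>\<phi> c y\<bar> \<le> 1" if "c \<in> C" for c y
    using u[OF that] unfolding \<phi>_def by (auto simp: indicator_def)
  have int_ind: "integrable q (indicator (E c) :: 'a \<Rightarrow> real)" if "c \<in> C" for c
    using E[OF that] by (simp add: q.emeasure_eq_measure)
  have \<phi>_mean: "(\<integral>y. \<phi> c y \<partial>q) = p c - u c" if "c \<in> C" for c
    using int_ind[OF that] E[OF that] unfolding \<phi>_def p_def
    by (simp add: q.prob_space)
  have \<phi>_prod: "(\<integral>y. \<phi> c y * \<phi> c' y \<partial>q) =
      (if c = c' then p c else 0) - p c * u c' - u c * p c' + u c * u c'" if "c \<in> C" "c' \<in> C" for c c'
  proof -
    have eq: "\<phi> c y * \<phi> c' y = (if c = c' then indicator (E c) y else 0)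
        - indicator (E c) y * u c' - u c * indicator (E c') y + u c * u c'" for y
      using disj that unfolding \<phi>_def disjoint_family_on_def
      by (auto simp: indicator_def algebra_simps)
    show ?thesis
      unfolding eq using int_ind[OF that(1)] int_ind[OF that(2)] E[OF that(1)] E[OF that(2)]
      unfolding p_def by (cases "c = c'") (simp_all add: q.prob_space)
  qed
  have T_eq: "T x = (\<Sum>c\<in>C. (\<Sum>i<m. \<phi> c (x i)) * (\<Sum>j<m. \<phi> c (x (m + j))) / w c)" for x
    unfolding T_def cell_statistic_def \<phi>_def ..
  have T_meas: "T \<in> borel_measurable P"
    unfolding T_def P_def by (rule cell_statistic_measurable[OF E]) auto
  have sum_bd: "\<bar>\<Sum>i<m. \<phi> c (x (h i))\<bar> \<le> real m" if "c \<in> C" for c x and h :: "nat \<Rightarrow> nat"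
    by (rule order.trans[OF sum_abs], rule order.trans[OF sum_bounded_above[where K = 1]])
      (use \<phi>_bd[OF that] in auto)
  define B where "B = (\<Sum>c\<in>C. real m * real m / w c)"
  have T_bd: "\<bar>T x\<bar> \<le> B" for x
    unfolding T_eq B_def
  proof (rule order.trans[OF sum_abs], rule sum_mono)
    fix c assume c: "c \<in> C"
    show "\<bar>(\<Sum>i<m. \<phi> c (x i)) * (\<Sum>j<m. \<phi> c (x (m + j))) / w c\<bar> \<le> real m * real m / w c"
      unfolding abs_divide abs_mult using w[OF c] sum_bd[OF c, of x id] sum_bd[OF c, of x "\<lambda>j. m + j"]
      by (auto intro!: divide_right_mono mult_mono)
  qed
  show intT: "integrable P T"
    by (rule PM.integrable_bounded[OF T_meas T_bd])
  show intT2: "integrable P (\<lambda>x. (T x)\<^sup>2)"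
  proof (rule PM.integrable_bounded[where B = "B\<^sup>2"])
    show "\<bar>(T x)\<^sup>2\<bar> \<le> B\<^sup>2" for x
      using power_mono[OF T_bd[of x], of 2] by simp
  qed (use T_meas in measurable)
  define \<psi>' where "\<psi>' c x = (\<Sum>i<m. \<phi> c (x (m + i)))" for c and x :: "nat \<Rightarrow> 'a"
  define \<psi> where "\<psi> c x = (\<Sum>i<m. \<phi> c (x i))" for c and x :: "nat \<Rightarrow> 'a"
  have T_eq': "T x = (\<Sum>c\<in>C. \<psi> c x * \<psi>' c x / w c)" for x
    unfolding T_eq \<psi>_def \<psi>'_def ..
  have \<psi>_meas[measurable]: "\<psi> c \<in> borel_measurable P" "\<psi>' c \<in> borel_measurable P" if "c \<in> C" for c
  proof -
    note \<phi>_meas[OF that, measurable]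
    show "\<psi> c \<in> borel_measurable P" "\<psi>' c \<in> borel_measurable P"
      unfolding \<psi>_def \<psi>'_def P_def by (auto intro!: borel_measurable_sum measurable_compose[OF _ \<phi>_meas[OF that]])
  qed
  have \<psi>_bd: "\<bar>\<psi> c x\<bar> \<le> real m" "\<bar>\<psi>' c x\<bar> \<le> real m" if "c \<in> C" for c x
    unfolding \<psi>_def \<psi>'_def using sum_bd[OF that, of x id] sum_bd[OF that, of x "\<lambda>j. m + j"] by auto
  have mean1: "(\<integral>x. \<psi> c x * \<psi>' c x \<partial>P) = (real m)\<^sup>2 * (p c - u c)\<^sup>2" if c: "c \<in> C" for c
  proof (cases "m = 0")
    case True then show ?thesis by (simp add: \<psi>_def)
  next
    case False
    \<comment> \<open>The mean is the case \<open>f' = g' = 1\<close> of the two-batch formula. The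
      two constant sums contribute a factor \<open>m\<close> each, hence the multiplication by
      \<open>real m * real m\<close>, which is cancelled afterwards.\<close>
    have "(\<integral>x. \<psi> c x * \<psi>' c x \<partial>P) * (real m * real m) = (\<integral>x. \<psi> c x * real m * (\<psi>' c x * real m) \<partial>P)"
      by (subst integral_mult_left_zero[symmetric]) (simp add: ac_simps)
    also have "\<dots> = ((real m)\<^sup>2 * (p c - u c)) * ((real m)\<^sup>2 * (p c - u c))"
      using expectation_two_batches[OF q \<phi>_meas[OF c] _ \<phi>_meas[OF c] _ \<phi>_bd[OF c] _ \<phi>_bd[OF c],
          of "\<lambda>_. 1" "\<lambda>_. 1" m]
      by (simp add: \<psi>_def \<psi>'_def P_def \<phi>_mean[OF c] q.prob_space)
    finally show ?thesis
      using False by (simp add: power2_eq_square)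
  qed
  have int1: "integrable P (\<lambda>x. \<psi> c x * \<psi>' c x)" if "c \<in> C" for c
  proof (rule PM.integrable_bounded[where B = "real m * real m"])
    show "\<bar>\<psi> c x * \<psi>' c x\<bar> \<le> real m * real m" for x
      unfolding abs_mult by (intro mult_mono \<psi>_bd that) auto
    show "(\<lambda>x. \<psi> c x * \<psi>' c x) \<in> borel_measurable P" using \<psi>_meas[OF that] by measurable
  qed
  show mean: "(\<integral>x. T x \<partial>P) = (real m)\<^sup>2 * (\<Sum>c\<in>C. (p c - u c)\<^sup>2 / w c)"
    unfolding T_eq'
    using int1 mean1 by (simp add: sum_distrib_left)
  have int2: "integrable P (\<lambda>x. \<psi> c x * \<psi> c' x * (\<psi>' c x * \<psi>' c' x))" if "c \<in> C" "c' \<in> C" for c c'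
  proof (rule PM.integrable_bounded[where B = "real m * real m * (real m * real m)"])
    show "\<bar>\<psi> c x * \<psi> c' x * (\<psi>' c x * \<psi>' c' x)\<bar> \<le> real m * real m * (real m * real m)" for x
      unfolding abs_mult by (intro mult_mono \<psi>_bd that mult_nonneg_nonneg) auto
    show "(\<lambda>x. \<psi> c x * \<psi> c' x * (\<psi>' c x * \<psi>' c' x)) \<in> borel_measurable P"
      using \<psi>_meas[OF that(1)] \<psi>_meas[OF that(2)] by measurable
  qed
  \<comment> \<open>Both batches have the same law, so the two factors \<open>S\<close> coincide.
    Centring at \<open>u\<close> does not affect the covariance, which therefore contains the true
    masses only.\<close>
  have mean2: "(\<integral>x. \<psi> c x * \<psi> c' x * (\<psi>' c x * \<psi>' c' x) \<partial>P) =
      (real m * ((if c = c' then p c else 0) - p c * p c') + (real m)\<^sup>2 * ((p c - u c) * (p c' - u c')))\<^sup>2"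
    if c: "c \<in> C" "c' \<in> C" for c c'
    using expectation_two_batches[OF q \<phi>_meas[OF c(1)] \<phi>_meas[OF c(2)] \<phi>_meas[OF c(1)] \<phi>_meas[OF c(2)]
        \<phi>_bd[OF c(1)] \<phi>_bd[OF c(2)] \<phi>_bd[OF c(1)] \<phi>_bd[OF c(2)], of m]
    unfolding \<psi>_def \<psi>'_def P_def \<phi>_mean[OF c(1)] \<phi>_mean[OF c(2)] \<phi>_prod[OF c]
    by (simp add: power2_eq_square algebra_simps)
  have "(\<integral>x. (T x)\<^sup>2 \<partial>P) = (\<integral>x. (\<Sum>c\<in>C. \<Sum>c'\<in>C. \<psi> c x * \<psi> c' x * (\<psi>' c x * \<psi>' c' x) / (w c * w c')) \<partial>P)"
    unfolding T_eq' power2_eq_square sum_product by (simp add: ac_simps)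
  also have "\<dots> = (\<Sum>c\<in>C. \<Sum>c'\<in>C. (\<integral>x. \<psi> c x * \<psi> c' x * (\<psi>' c x * \<psi>' c' x) \<partial>P) / (w c * w c'))"
    using int2 by simp
  also have "\<dots> = (\<Sum>c\<in>C. \<Sum>c'\<in>C.
    (real m * ((if c = c' then p c else 0) - p c * p c') + (real m)\<^sup>2 * ((p c - u c) * (p c' - u c')))\<^sup>2 / (w c * w c'))"
    by (intro sum.cong refl) (simp only: mean2)
  finally have sq: "(\<integral>x. (T x)\<^sup>2 \<partial>P) = \<dots>" .
  have p1: "sum p C \<le> 1"
    unfolding p_def using q.finite_measure_finite_Union[OF C _ disj] E q.prob_le_1 by (metis image_subsetI)
  show "(\<integral>x. (T x)\<^sup>2 \<partial>P) - (\<integral>x. T x \<partial>P)\<^sup>2 \<le>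
      (real m)\<^sup>2 * (\<Sum>c\<in>C. (p c / w c)\<^sup>2) + 2 * real m ^ 3 * (\<Sum>c\<in>C. p c * ((p c - u c) / w c)\<^sup>2)"
    unfolding sq mean by (rule second_moment_algebra[OF C _ p1 w]) (auto simp: p_def)
qed

section \<open>The chi-square test on a finite partition\<close>

text \<open>Cauchy-Schwarz for \<open>\<bar>p c - u c\<bar> / sqrt (w c)\<close> and
  \<open>sqrt (w c)\<close>. The weights used later are null masses plus \<open>1 / card C\<close>,
  hence the total 2.\<close>

lemma chi_square_ge_L1:
  fixes p u w :: "'b \<Rightarrow> real"
  assumes "finite C" "\<And>c. c \<in> C \<Longrightarrow> 0 < w c" "sum w C \<le> 2"
  shows "(\<Sum>c\<in>C. \<bar>p c - u c\<bar>)\<^sup>2 \<le> 2 * (\<Sum>c\<in>C. (p c - u c)\<^sup>2 / w c)"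
proof -
  have "(\<Sum>c\<in>C. \<bar>p c - u c\<bar>)\<^sup>2 = (\<Sum>c\<in>C. (\<bar>p c - u c\<bar> / sqrt (w c)) * sqrt (w c))\<^sup>2"
    using assms(2) by (intro arg_cong[where f = "\<lambda>x. x\<^sup>2"] sum.cong) (force simp: less_imp_neq)+
  also have "\<dots> \<le> (\<Sum>c\<in>C. (\<bar>p c - u c\<bar> / sqrt (w c))\<^sup>2) * (\<Sum>c\<in>C. (sqrt (w c))\<^sup>2)"
    by (rule Cauchy_Schwarz_ineq_sum)
  also have "\<dots> = (\<Sum>c\<in>C. (p c - u c)\<^sup>2 / w c) * sum w C"
    using assms(2) by (intro arg_cong2[where f = "(*)"] sum.cong) (auto simp: power_divide less_imp_le)
  also have "\<dots> \<le> (\<Sum>c\<in>C. (p c - u c)\<^sup>2 / w c) * 2"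
    using assms by (intro mult_left_mono sum_nonneg) (auto simp: less_imp_le)
  finally show ?thesis by simp
qed

text \<open>Everything rests on \<open>w c\<close> being at least \<open>u c\<close> and at least
  \<open>1 / card C\<close>. Writing \<open>p = u + (p - u)\<close>, the part with \<open>u\<close>
  is dominated by the weight; the part with \<open>p - u\<close> costs a factor
  \<open>card C\<close> in the first estimate and the largest relative deviation in the
  second.\<close>

lemma variance_terms:
  fixes p u w :: "'b \<Rightarrow> real"
  assumes C: "finite C" and p: "\<And>c. c \<in> C \<Longrightarrow> 0 \<le> p c" and u: "\<And>c. c \<in> C \<Longrightarrow> 0 \<le> u c"
    and w: "\<And>c. c \<in> C \<Longrightarrow> w c = u c + 1 / real (card C)"
  defines "\<Delta> \<equiv> \<Sum>c\<in>C. (p c - u c)\<^sup>2 / w c"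
  shows "(\<Sum>c\<in>C. (p c / w c)\<^sup>2) \<le> 2 * real (card C) * \<Delta> + 2 * real (card C)"
    and "(\<Sum>c\<in>C. p c * ((p c - u c) / w c)\<^sup>2) \<le> \<Delta> + sqrt (real (card C)) * sqrt \<Delta> * \<Delta>"
    and "(\<Sum>c\<in>C. (u c / w c)\<^sup>2) \<le> real (card C)"
proof -
  define N where "N = real (card C)"
  have N: "0 < N" if "c \<in> C" for c
    using that C by (auto simp: N_def card_gt_0_iff)
  have w0: "0 < w c" and wN: "1 / w c \<le> N" and uw: "u c \<le> w c" if "c \<in> C" for c
  proof -
    have "1 / N \<le> w c" "0 < 1 / N" using N[OF that] u[OF that] w[OF that] by (auto simp: N_def)
    then show "0 < w c" by linarith
    with \<open>1 / N \<le> w c\<close> N[OF that] show "1 / w c \<le> N" by (simp add: field_simps)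
    show "u c \<le> w c" using w[OF that] N[OF that] by (simp add: N_def)
  qed
  have uw1: "(u c / w c)\<^sup>2 \<le> 1" if "c \<in> C" for c
    using w0[OF that] uw[OF that] u[OF that] by (intro power_le_one) auto
  then show u2: "(\<Sum>c\<in>C. (u c / w c)\<^sup>2) \<le> real (card C)"
    using sum_bounded_above[of C "\<lambda>c. (u c / w c)\<^sup>2" 1] by simp
  have \<Delta>_ge: "(p c - u c)\<^sup>2 / w c \<le> \<Delta>" if "c \<in> C" for c
    unfolding \<Delta>_def using that C w0 by (intro member_le_sum) (auto simp: less_imp_le)
  have d2: "((p c - u c) / w c)\<^sup>2 \<le> (p c - u c)\<^sup>2 / w c * N" if "c \<in> C" for c
  proof -
    have "((p c - u c) / w c)\<^sup>2 = (p c - u c)\<^sup>2 / w c * (1 / w c)"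
      by (simp add: power2_eq_square)
    also have "\<dots> \<le> (p c - u c)\<^sup>2 / w c * N"
      using wN[OF that] w0[OF that] by (intro mult_left_mono) auto
    finally show ?thesis .
  qed
  have "(p c / w c)\<^sup>2 \<le> 2 * N * ((p c - u c)\<^sup>2 / w c) + 2" if "c \<in> C" for c
  proof -
    have "p c / w c = (p c - u c) / w c + u c / w c"
      by (simp add: diff_divide_distrib)
    then have "(p c / w c)\<^sup>2 \<le> 2 * ((p c - u c) / w c)\<^sup>2 + 2 * (u c / w c)\<^sup>2"
      using sum_squares_bound[of "(p c - u c) / w c" "u c / w c"] by (simp add: power2_sum)
    moreover have "2 * ((p c - u c) / w c)\<^sup>2 \<le> 2 * N * ((p c - u c)\<^sup>2 / w c)"
      using d2[OF that] by (simp only: mult.assoc mult.commute[of N])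
    ultimately show ?thesis using uw1[OF that] by linarith
  qed
  then have "(\<Sum>c\<in>C. (p c / w c)\<^sup>2) \<le> (\<Sum>c\<in>C. 2 * N * ((p c - u c)\<^sup>2 / w c) + 2)"
    by (rule sum_mono)
  also have "\<dots> = 2 * real (card C) * \<Delta> + 2 * real (card C)"
    by (simp add: sum.distrib sum_distrib_left \<Delta>_def N_def)
  finally show "(\<Sum>c\<in>C. (p c / w c)\<^sup>2) \<le> 2 * real (card C) * \<Delta> + 2 * real (card C)" .
  have "p c * ((p c - u c) / w c)\<^sup>2 \<le> (p c - u c)\<^sup>2 / w c * (1 + sqrt N * sqrt \<Delta>)" if "c \<in> C" for c
  proof -
    \<comment> \<open>The relative deviation in one cell. A single chi-square term is at most the
      whole sum, so \<open>r\<close> never exceeds \<open>sqrt (N * \<Delta>)\<close> in absolute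
      value.\<close>
    define r where "r = (p c - u c) / w c"
    have wr: "w c * r\<^sup>2 = (p c - u c)\<^sup>2 / w c" "p c = u c + w c * r"
      using w0[OF that] by (simp_all add: r_def power2_eq_square)
    have "r\<^sup>2 \<le> N * \<Delta>"
    proof -
      have "r\<^sup>2 \<le> (p c - u c)\<^sup>2 / w c * N"
        unfolding r_def by (rule d2[OF that])
      also have "\<dots> \<le> \<Delta> * N"
        using \<Delta>_ge[OF that] N[OF that] by (intro mult_right_mono) auto
      finally show ?thesis by (simp add: mult.commute)
    qed
    then have r: "\<bar>r\<bar> \<le> sqrt N * sqrt \<Delta>"
      unfolding real_sqrt_mult[symmetric] real_sqrt_abs[symmetric] by (rule real_sqrt_le_mono)
    have "p c * r\<^sup>2 = u c * r\<^sup>2 + w c * r\<^sup>2 * r"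
      unfolding wr(2) by (simp add: algebra_simps)
    also have "\<dots> \<le> w c * r\<^sup>2 + w c * r\<^sup>2 * (sqrt N * sqrt \<Delta>)"
      using uw[OF that] r w0[OF that] by (intro add_mono mult_right_mono mult_left_mono) auto
    finally show ?thesis
      unfolding r_def[symmetric] wr(1)[symmetric] by (simp add: algebra_simps)
  qed
  then have "(\<Sum>c\<in>C. p c * ((p c - u c) / w c)\<^sup>2) \<le> (\<Sum>c\<in>C. (p c - u c)\<^sup>2 / w c * (1 + sqrt N * sqrt \<Delta>))"
    by (rule sum_mono)
  also have "\<dots> = \<Delta> + sqrt (real (card C)) * sqrt \<Delta> * \<Delta>"
    unfolding sum_distrib_right[symmetric] \<Delta>_def[symmetric] by (simp add: N_def algebra_simps)
  finally show "(\<Sum>c\<in>C. p c * ((p c - u c) / w c)\<^sup>2) \<le> \<Delta> + sqrt (real (card C)) * sqrt \<Delta> * \<Delta>" .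
qed

text \<open>Here \<open>s\<close> stands for the square root of the number of cells and
  \<open>m\<^sup>2 * \<Delta>\<close> for the mean. The factor 12 is what Chebyshev needs at a
  distance of half the mean, since 4 / 12 = 1 / 3. The four variance terms are at most 1/1800,
  1/1800, 1/30 and 1/30 of the squared mean, and 61/900 is below 1/12.\<close>

lemma variance_le_mean_square:
  fixes m s \<theta> \<Delta> V :: real
  assumes "0 < \<theta>" "\<theta> \<le> 1" "\<theta> \<le> \<Delta>" "1 \<le> s" "60 * s \<le> m * \<theta>"
    and V: "V \<le> m\<^sup>2 * (2 * s\<^sup>2 * \<Delta> + 2 * s\<^sup>2) + 2 * m ^ 3 * (\<Delta> + s * sqrt \<Delta> * \<Delta>)"
  shows "12 * V \<le> (m\<^sup>2 * \<Delta>)\<^sup>2"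
proof -
  define t where "t = sqrt \<Delta>"
  have t: "0 < t" "\<Delta> = t\<^sup>2" using assms by (auto simp: t_def)
  have m: "0 < m" using assms
    by (smt (verit) mult_le_0_iff)
  \<comment> \<open>Thanks to \<open>\<theta> \<le> 1\<close>, also \<open>sqrt \<Delta>\<close> is
    at least \<open>\<theta>\<close>, so the lower bound on \<open>m\<close> controls both
    \<open>s / \<Delta>\<close> and \<open>s / sqrt \<Delta>\<close>.\<close>
  have \<theta>t: "\<theta> \<le> t"
  proof -
    have "\<theta>\<^sup>2 \<le> \<theta>" using assms by (simp add: power2_eq_square mult_left_le)
    then have "\<theta>\<^sup>2 \<le> t\<^sup>2" using assms t by linarith
    then show ?thesis by (rule power2_le_imp_le) (use t in auto)
  qed
  have st: "s \<le> m * t / 60" "1 \<le> m * \<Delta> / 60" "s \<le> m * \<Delta> / 60"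
  proof -
    have "m * \<theta> \<le> m * t" "m * \<theta> \<le> m * \<Delta>"
      using m \<theta>t assms(3) by (auto intro!: mult_left_mono)
    then show "s \<le> m * t / 60" "1 \<le> m * \<Delta> / 60" "s \<le> m * \<Delta> / 60"
      using assms(4,5) by linarith+
  qed
  have s2: "s\<^sup>2 \<le> m\<^sup>2 * \<Delta> / 3600"
  proof -
    have "s\<^sup>2 \<le> (m * t / 60)\<^sup>2" using st assms by (intro power_mono) auto
    then show ?thesis by (simp add: t(2) power_divide power_mult_distrib)
  qed
  have s2': "s\<^sup>2 \<le> m\<^sup>2 * \<Delta>\<^sup>2 / 3600"
  proof -
    have "s\<^sup>2 \<le> (m * \<Delta> / 60)\<^sup>2" using st assms by (intro power_mono) auto
    then show ?thesis by (simp add: power_divide power_mult_distrib)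
  qed
  define Q where "Q = (m\<^sup>2 * \<Delta>)\<^sup>2"
  have "m\<^sup>2 * (2 * s\<^sup>2 * \<Delta>) \<le> m\<^sup>2 * (2 * (m\<^sup>2 * \<Delta> / 3600) * \<Delta>)"
    using s2 assms by (intro mult_left_mono mult_right_mono) auto
  then have 1: "m\<^sup>2 * (2 * s\<^sup>2 * \<Delta>) \<le> Q / 1800"
    by (simp add: Q_def power2_eq_square algebra_simps)
  have "m\<^sup>2 * (2 * s\<^sup>2) \<le> m\<^sup>2 * (2 * (m\<^sup>2 * \<Delta>\<^sup>2 / 3600))"
    using s2' by (intro mult_left_mono) auto
  then have 2: "m\<^sup>2 * (2 * s\<^sup>2) \<le> Q / 1800"
    by (simp add: Q_def power2_eq_square algebra_simps)
  have "2 * m ^ 3 * (\<Delta> * 1) \<le> 2 * m ^ 3 * (\<Delta> * (m * \<Delta> / 60))"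
    using st assms m by (intro mult_left_mono) auto
  then have 3: "2 * m ^ 3 * \<Delta> \<le> Q / 30"
    by (simp add: Q_def power2_eq_square power3_eq_cube algebra_simps)
  have "2 * m ^ 3 * (s * t * \<Delta>) \<le> 2 * m ^ 3 * (m * t / 60 * t * \<Delta>)"
    using st assms m t by (intro mult_left_mono mult_right_mono) auto
  then have 4: "2 * m ^ 3 * (s * t * \<Delta>) \<le> Q / 30"
    unfolding t(2) by (simp add: Q_def t(2) power2_eq_square power3_eq_cube algebra_simps)
  have "V \<le> m\<^sup>2 * (2 * s\<^sup>2 * \<Delta>) + m\<^sup>2 * (2 * s\<^sup>2) + 2 * m ^ 3 * \<Delta> + 2 * m ^ 3 * (s * t * \<Delta>)"
    using V unfolding t_def by (simp add: algebra_simps)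
  with 1 2 3 4 have "V \<le> Q / 1800 + Q / 1800 + Q / 30 + Q / 30" by linarith
  moreover have "0 \<le> Q" by (simp add: Q_def)
  ultimately show ?thesis unfolding Q_def[symmetric] by linarith
qed

text \<open>\<open>\<theta>\<close> is the chi-square distance to be detected and \<open>B\<close> a
  confidence parameter: 60 suffices for detection, and larger values push the false alarm
  probability down to \<open>4 / B\<^sup>2\<close>, which later pays for a union bound over levels.
  The threshold of the test is half of the smallest mean to be detected.\<close>

locale cell_test =
  fixes C :: "'b set" and E :: "'b \<Rightarrow> 'a set" and u w :: "'b \<Rightarrow> real" and m :: nat and \<theta> B :: real
  assumes C: "finite C" "C \<noteq> {}" and disj: "disjoint_family_on E C"
    and u: "\<And>c. 0 \<le> u c" "\<And>c. u c \<le> 1" and w: "\<And>c. w c = u c + 1 / real (card C)"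
    and \<theta>: "0 < \<theta>" "\<theta> \<le> 1" and B: "60 \<le> B" and m: "B * sqrt (real (card C)) \<le> real m * \<theta>"
begin

lemma card_C: "1 \<le> card C"
  using C by (simp add: Suc_le_eq card_gt_0_iff)

lemma w_pos: "0 < w c"
  using w[of c] u(1)[of c] card_C by (simp add: add_nonneg_pos)

lemma m_pos: "0 < m"
proof -
  have "0 < B * sqrt (real (card C))" using B card_C by simp
  with m have "0 < real m * \<theta>" by linarith
  with \<theta> show ?thesis by (simp add: zero_less_mult_iff)
qed

text \<open>The mean is 0 and the variance at most \<open>m\<^sup>2 * card C\<close>, so Chebyshev
  at the threshold gives \<open>4 * card C / (m * \<theta>)\<^sup>2\<close>.\<close>

lemma accept_null:
  fixes q :: "'a measure"
  assumes q: "prob_space q" and E: "\<And>c. c \<in> C \<Longrightarrow> E c \<in> sets q"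
    and null: "\<And>c. c \<in> C \<Longrightarrow> measure q (E c) = u c"
  defines "P \<equiv> \<Pi>\<^sub>M i\<in>{..<2 * m}. q"
  shows "measure P {x\<in>space P. (real m)\<^sup>2 * \<theta> / 2 \<le> cell_statistic m C E u w x} \<le> 4 / B\<^sup>2"
proof -
  interpret q: prob_space q by fact
  interpret P: prob_space P
    unfolding P_def by (intro prob_space_PiM q)
  define T where "T = cell_statistic m C E u w"
  note mom = cell_statistic_moments[where u = u and w = w and m = m, OF q C(1) disj E u w_pos, folded P_def T_def]
  have mean: "P.expectation T = 0"
    using mom(3) null by simp
  define a where "a = (real m)\<^sup>2 * \<theta> / 2"
  have a: "0 < a" using m_pos \<theta> by (simp add: a_def)
  have "P.variance T = P.expectation (\<lambda>x. (T x)\<^sup>2) - (P.expectation T)\<^sup>2"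
    by (rule P.variance_eq[OF mom(1,2)])
  also have "\<dots> \<le> (real m)\<^sup>2 * (\<Sum>c\<in>C. (u c / w c)\<^sup>2)"
    using mom(4) null by simp
  also have "\<dots> \<le> (real m)\<^sup>2 * real (card C)"
    using variance_terms(3)[OF C(1), of u u w] u w by (intro mult_left_mono) auto
  finally have var: "P.variance T \<le> (real m)\<^sup>2 * real (card C)" .
  have "measure P {x\<in>space P. a \<le> T x} \<le> measure P {x\<in>space P. a \<le> \<bar>T x - P.expectation T\<bar>}"
    unfolding mean using mom(1) by (intro P.finite_measure_mono) auto
  also have "\<dots> \<le> P.variance T / a\<^sup>2"
    using mom a by (intro P.Chebyshev_inequality) auto
  also have "\<dots> \<le> (real m)\<^sup>2 * real (card C) / a\<^sup>2"
    using var by (intro divide_right_mono) auto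
  also have "\<dots> = 4 * real (card C) / (real m * \<theta>)\<^sup>2"
    using m_pos \<theta> by (simp add: a_def power2_eq_square field_simps)
  also have "\<dots> \<le> 4 * real (card C) / (B * sqrt (real (card C)))\<^sup>2"
    using m B card_C m_pos \<theta> by (intro divide_left_mono power_mono zero_less_power mult_pos_pos) auto
  also have "\<dots> = 4 / B\<^sup>2"
    using card_C by (simp add: power_mult_distrib)
  finally show ?thesis by (simp add: a_def T_def)
qed

text \<open>The threshold is fixed by \<open>\<theta>\<close>, but the deviation is measured against
  the actual mean \<open>m\<^sup>2 * \<Delta>\<close>: staying below the threshold means losing at
  least half of that mean, however large \<open>\<Delta>\<close> is.\<close>

lemma reject_far:
  fixes q :: "'a measure"
  assumes q: "prob_space q" and E: "\<And>c. c \<in> C \<Longrightarrow> E c \<in> sets q"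
    and far: "\<theta> \<le> (\<Sum>c\<in>C. (measure q (E c) - u c)\<^sup>2 / w c)"
  defines "P \<equiv> \<Pi>\<^sub>M i\<in>{..<2 * m}. q"
  shows "measure P {x\<in>space P. cell_statistic m C E u w x < (real m)\<^sup>2 * \<theta> / 2} \<le> 1 / 3"
proof -
  interpret q: prob_space q by fact
  interpret P: prob_space P
    unfolding P_def by (intro prob_space_PiM q)
  define T where "T = cell_statistic m C E u w"
  define \<Delta> where "\<Delta> = (\<Sum>c\<in>C. (measure q (E c) - u c)\<^sup>2 / w c)"
  have \<Delta>: "\<theta> \<le> \<Delta>" using far by (simp add: \<Delta>_def)
  note mom = cell_statistic_moments[where u = u and w = w and m = m, OF q C(1) disj E u w_pos, folded P_def T_def \<Delta>_def]
  have mean: "P.expectation T = (real m)\<^sup>2 * \<Delta>"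
    using mom(3) by (simp add: \<Delta>_def)
  have "P.variance T = P.expectation (\<lambda>x. (T x)\<^sup>2) - (P.expectation T)\<^sup>2"
    by (rule P.variance_eq[OF mom(1,2)])
  also have "\<dots> \<le> (real m)\<^sup>2 * (\<Sum>c\<in>C. (measure q (E c) / w c)\<^sup>2) +
      2 * real m ^ 3 * (\<Sum>c\<in>C. measure q (E c) * ((measure q (E c) - u c) / w c)\<^sup>2)"
    by (rule mom(4))
  also have "\<dots> \<le> (real m)\<^sup>2 * (2 * (sqrt (real (card C)))\<^sup>2 * \<Delta> + 2 * (sqrt (real (card C)))\<^sup>2) +
      2 * real m ^ 3 * (\<Delta> + sqrt (real (card C)) * sqrt \<Delta> * \<Delta>)"
    using variance_terms(1,2)[OF C(1), of "\<lambda>c. measure q (E c)" u w] u w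
    unfolding \<Delta>_def[symmetric] by (intro add_mono mult_left_mono) auto
  finally have var: "12 * P.variance T \<le> ((real m)\<^sup>2 * \<Delta>)\<^sup>2"
  proof (rule variance_le_mean_square[OF \<theta> \<Delta>, rotated 2])
    show "60 * sqrt (real (card C)) \<le> real m * \<theta>"
      using m B mult_right_mono[of 60 B "sqrt (real (card C))"] by simp
  qed (use card_C in simp)
  define a where "a = (real m)\<^sup>2 * \<Delta> / 2"
  have a: "0 < a" using m_pos \<theta> \<Delta> by (simp add: a_def)
  have mean_a: "P.expectation T = 2 * a" by (simp add: mean a_def)
  have "(real m)\<^sup>2 * \<theta> / 2 \<le> a"
    unfolding a_def using \<Delta> by (intro divide_right_mono mult_left_mono) auto
  then have "measure P {x\<in>space P. T x < (real m)\<^sup>2 * \<theta> / 2} \<le> measure P {x\<in>space P. a \<le> \<bar>T x - P.expectation T\<bar>}"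
    unfolding mean_a using mom(1) a
    by (intro P.finite_measure_mono) auto
  also have "\<dots> \<le> P.variance T / a\<^sup>2"
    using mom a by (intro P.Chebyshev_inequality) auto
  also have "\<dots> \<le> ((real m)\<^sup>2 * \<Delta>)\<^sup>2 / 12 / a\<^sup>2"
    using var by (intro divide_right_mono) auto
  also have "\<dots> = 1 / 3"
    using a m_pos by (auto simp: a_def power_divide)
  finally show ?thesis by (simp add: T_def)
qed

end

section \<open>Couplings from greedy matching on a tree\<close>

text \<open>A transport plan under construction: \<open>r\<close> and \<open>s\<close> are the parts
  of \<open>p\<close> and \<open>u\<close> still unmatched. With \<open>r\<close> and
  \<open>s\<close> zero it is a coupling of the two mass vectors.\<close>

definition partial_coupling ::
  "'b set \<Rightarrow> ('b \<Rightarrow> real) \<Rightarrow> ('b \<Rightarrow> real) \<Rightarrow> ('b \<Rightarrow> real) \<Rightarrow> ('b \<Rightarrow> real) \<Rightarrow> ('b \<Rightarrow> 'b \<Rightarrow> real) \<Rightarrow> bool" where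
  "partial_coupling C p u r s \<pi> \<longleftrightarrow>
     (\<forall>c\<in>C. \<forall>c'\<in>C. 0 \<le> \<pi> c c') \<and> (\<forall>c\<in>C. 0 \<le> r c \<and> 0 \<le> s c) \<and>
     (\<forall>c\<in>C. p c = (\<Sum>c'\<in>C. \<pi> c c') + r c) \<and> (\<forall>c'\<in>C. u c' = (\<Sum>c\<in>C. \<pi> c c') + s c')"

text \<open>Within each cell \<open>a\<close> of the partition \<open>f\<close>, the smaller of the two unmatched masses \<open>R a\<close>, \<open>S a\<close>
  is matched completely, in product form.\<close>

lemma greedy_matching_step:
  fixes C :: "'b set" and f :: "'b \<Rightarrow> 'l" and \<pi> cost :: "'b \<Rightarrow> 'b \<Rightarrow> real"
  assumes C: "finite C" and pc: "partial_coupling C p u r s \<pi>"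
    and supp: "\<And>c c'. c \<in> C \<Longrightarrow> c' \<in> C \<Longrightarrow> \<pi> c c' \<noteq> 0 \<Longrightarrow> f c = f c'"
    and cost: "\<And>c c'. c \<in> C \<Longrightarrow> c' \<in> C \<Longrightarrow> f c = f c' \<Longrightarrow> cost c c' \<le> D"
    and D: "0 \<le> D"
  shows "\<exists>r' s' \<pi>'. partial_coupling C p u r' s' \<pi>' \<and>
    (\<forall>c\<in>C. \<forall>c'\<in>C. \<pi>' c c' \<noteq> 0 \<longrightarrow> f c = f c') \<and>
    (\<forall>c\<in>C. \<forall>c'\<in>C. f c = f c' \<longrightarrow> r' c = 0 \<or> s' c' = 0) \<and>
    (\<Sum>c\<in>C. \<Sum>c'\<in>C. \<pi>' c c' * cost c c') \<le> (\<Sum>c\<in>C. \<Sum>c'\<in>C. \<pi> c c' * cost c c') + D * sum r C"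
proof -
  have rs: "0 \<le> r c" "0 \<le> s c" if "c \<in> C" for c
    using pc that by (auto simp: partial_coupling_def)
  define R where "R a = (\<Sum>c\<in>{c\<in>C. f c = a}. r c)" for a
  define S where "S a = (\<Sum>c\<in>{c\<in>C. f c = a}. s c)" for a
  define m where "m a = max (R a) (S a)" for a
  \<comment> \<open>Dividing by the larger total makes the row sums \<open>r * S / m\<close> and the
    column sums \<open>s * R / m\<close>: no residual is overdrawn, and the side with the smaller
    total is used up.\<close>
  define \<alpha> where "\<alpha> c c' = (if f c = f c' then r c * s c' / m (f c) else 0)" for c c'
  have RS: "0 \<le> R a" "0 \<le> S a" for a
    unfolding R_def S_def using rs by (auto intro!: sum_nonneg)
  have m: "0 \<le> m a" "R a \<le> m a" "S a \<le> m a" for a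
    using RS by (auto simp: m_def le_max_iff_disj)
  have \<alpha>0: "0 \<le> \<alpha> c c'" if "c \<in> C" "c' \<in> C" for c c'
    using rs that m by (auto simp: \<alpha>_def)
  have row: "(\<Sum>c'\<in>C. \<alpha> c c') = r c * (S (f c) / m (f c))" if "c \<in> C" for c
  proof -
    have "(\<Sum>c'\<in>C. \<alpha> c c') = (\<Sum>c'\<in>{c'\<in>C. f c' = f c}. r c * s c' / m (f c))"
      using C unfolding \<alpha>_def by (subst sum.inter_filter) (auto intro!: sum.cong)
    then show ?thesis
      by (simp add: S_def sum_distrib_left sum_divide_distrib)
  qed
  have col: "(\<Sum>c\<in>C. \<alpha> c c') = s c' * (R (f c') / m (f c'))" if "c' \<in> C" for c'
  proof -
    have "(\<Sum>c\<in>C. \<alpha> c c') = (\<Sum>c\<in>{c\<in>C. f c = f c'}. r c * s c' / m (f c'))"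
      using C unfolding \<alpha>_def by (subst sum.inter_filter) (auto intro!: sum.cong)
    then show ?thesis
      by (simp add: R_def sum_distrib_left sum_divide_distrib mult.commute)
  qed
  have quot: "S a / m a \<le> 1" "R a / m a \<le> 1" for a
    using m[of a] by (auto simp: divide_le_eq_1)
  have rowle: "r c * (S (f c) / m (f c)) \<le> r c" "s c * (R (f c) / m (f c)) \<le> s c" if "c \<in> C" for c
    using quot[of "f c"] rs[OF that] by (simp_all only: mult_left_le)
  define r' where "r' c = r c - r c * (S (f c) / m (f c))" for c
  define s' where "s' c = s c - s c * (R (f c) / m (f c))" for c
  define \<pi>' where "\<pi>' c c' = \<pi> c c' + \<alpha> c c'" for c c'
  have R0: "r c = 0" if "c \<in> C" "R (f c) = 0" for c
    using that rs C unfolding R_def by (subst (asm) sum_nonneg_eq_0_iff) auto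
  have S0: "s c = 0" if "c \<in> C" "S (f c) = 0" for c
    using that rs C unfolding S_def by (subst (asm) sum_nonneg_eq_0_iff) auto
  have "partial_coupling C p u r' s' \<pi>'"
    using pc \<alpha>0 rowle unfolding partial_coupling_def \<pi>'_def r'_def s'_def
    by (auto simp: sum.distrib row col)
  moreover have "\<forall>c\<in>C. \<forall>c'\<in>C. \<pi>' c c' \<noteq> 0 \<longrightarrow> f c = f c'"
    using supp by (auto simp: \<pi>'_def \<alpha>_def)
  moreover have "r' c = 0 \<or> s' c' = 0" if c: "c \<in> C" "c' \<in> C" "f c = f c'" for c c'
  proof (cases "R (f c) \<le> S (f c)")
    case True
    \<comment> \<open>If \<open>S\<close> is 0, the quotient is 0 and nothing is matched; but then
      \<open>R\<close> is 0 as well, and with it \<open>r c\<close>.\<close>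
    then have "r' c = 0"
      using R0[OF c(1)] RS[of "f c"] by (cases "S (f c) = 0") (auto simp: r'_def m_def max_def)
    then show ?thesis ..
  next
    case False
    then have "s' c' = 0"
      using RS[of "f c"] c by (auto simp: s'_def m_def max_def)
    then show ?thesis ..
  qed
  moreover have "(\<Sum>c\<in>C. \<Sum>c'\<in>C. \<pi>' c c' * cost c c') \<le> (\<Sum>c\<in>C. \<Sum>c'\<in>C. \<pi> c c' * cost c c') + D * sum r C"
  proof -
    have "(\<Sum>c\<in>C. \<Sum>c'\<in>C. \<alpha> c c' * cost c c') \<le> (\<Sum>c\<in>C. \<Sum>c'\<in>C. \<alpha> c c' * D)"
    proof (intro sum_mono)
      fix c c' assume "c \<in> C" "c' \<in> C"
      then show "\<alpha> c c' * cost c c' \<le> \<alpha> c c' * D"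
        using \<alpha>0[of c c'] cost[of c c'] mult_left_mono[of "cost c c'" D "\<alpha> c c'"]
        by (cases "f c = f c'") (simp_all add: \<alpha>_def)
    qed
    also have "\<dots> = D * (\<Sum>c\<in>C. r c * (S (f c) / m (f c)))"
      unfolding sum_distrib_right[symmetric] by (simp add: row mult.commute)
    also have "\<dots> \<le> D * sum r C"
      using D rowle(1) by (intro mult_left_mono sum_mono) auto
    finally show ?thesis
      unfolding \<pi>'_def by (simp add: distrib_right sum.distrib)
  qed
  ultimately show ?thesis by blast
qed

text \<open>Mass matched inside a class counts equally on both sides, so the difference of the class
  masses is the difference of the residuals. One of these is zero, hence the residual of
  \<open>p\<close> is at most the absolute difference.\<close>

lemma unmatched_mass_le:
  fixes C :: "'b set" and f :: "'b \<Rightarrow> 'l" and \<pi> :: "'b \<Rightarrow> 'b \<Rightarrow> real"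
  assumes C: "finite C" and pc: "partial_coupling C p u r s \<pi>"
    and supp: "\<And>c c'. c \<in> C \<Longrightarrow> c' \<in> C \<Longrightarrow> \<pi> c c' \<noteq> 0 \<Longrightarrow> f c = f c'"
    and disj: "\<And>c c'. c \<in> C \<Longrightarrow> c' \<in> C \<Longrightarrow> f c = f c' \<Longrightarrow> r c = 0 \<or> s c' = 0"
  shows "sum r C \<le> (\<Sum>a\<in>f ` C. \<bar>sum p {c\<in>C. f c = a} - sum u {c\<in>C. f c = a}\<bar>)"
proof -
  have "sum r C = (\<Sum>a\<in>f ` C. sum r {c\<in>C. f c = a})"
    by (rule sum.image_gen[OF C])
  also have "\<dots> \<le> (\<Sum>a\<in>f ` C. \<bar>sum p {c\<in>C. f c = a} - sum u {c\<in>C. f c = a}\<bar>)"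
  proof (rule sum_mono)
    fix a
    let ?A = "{c\<in>C. f c = a}"
    have rows: "(\<Sum>c'\<in>C. \<pi> c c') = (\<Sum>c'\<in>?A. \<pi> c c')" if "c \<in> ?A" for c
      using C that supp by (intro sum.mono_neutral_right) auto
    have cols: "(\<Sum>c\<in>C. \<pi> c c') = (\<Sum>c\<in>?A. \<pi> c c')" if "c' \<in> ?A" for c'
      using C that supp by (intro sum.mono_neutral_right) auto
    have "sum p ?A = (\<Sum>c\<in>?A. (\<Sum>c'\<in>?A. \<pi> c c') + r c)"
      using pc rows by (intro sum.cong) (auto simp: partial_coupling_def)
    moreover have "sum u ?A = (\<Sum>c'\<in>?A. (\<Sum>c\<in>?A. \<pi> c c') + s c')"
      using pc cols by (intro sum.cong) (auto simp: partial_coupling_def)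
    moreover have "(\<Sum>c'\<in>?A. \<Sum>c\<in>?A. \<pi> c c') = (\<Sum>c\<in>?A. \<Sum>c'\<in>?A. \<pi> c c')"
      by (rule sum.swap)
    ultimately have diff: "sum p ?A - sum u ?A = sum r ?A - sum s ?A"
      by (simp add: sum.distrib)
    have "sum r ?A = 0 \<or> sum s ?A = 0"
    proof (cases "\<forall>c\<in>?A. r c = 0")
      case False
      then obtain c where "c \<in> ?A" "r c \<noteq> 0" by auto
      then have "\<forall>c'\<in>?A. s c' = 0" using disj by fastforce
      then show ?thesis by simp
    qed simp
    moreover have "0 \<le> sum s ?A"
      using pc by (intro sum_nonneg) (auto simp: partial_coupling_def)
    ultimately show "sum r ?A \<le> \<bar>sum p ?A - sum u ?A\<bar>"
      unfolding diff by auto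
  qed
  finally show ?thesis .
qed

text \<open>Matching proceeds from the leaves to the root. The residual left by level
  \<open>k + 1\<close> is at most the L1 discrepancy of that level and is charged \<open>D k\<close>
  per unit, whether or not level \<open>k\<close> manages to match all of it; this explains the
  index shift. The term \<open>D L\<close> pays for the total mass 1 at the finest level.\<close>

lemma tree_coupling:
  fixes C :: "'b set" and lab :: "nat \<Rightarrow> 'b \<Rightarrow> 'l" and cost :: "'b \<Rightarrow> 'b \<Rightarrow> real"
  assumes C: "finite C" and p: "\<And>c. c \<in> C \<Longrightarrow> 0 \<le> p c" "sum p C = 1"
    and u: "\<And>c. c \<in> C \<Longrightarrow> 0 \<le> u c" "sum u C = 1"
    and nested: "\<And>k c c'. k < L \<Longrightarrow> c \<in> C \<Longrightarrow> c' \<in> C \<Longrightarrow> lab (Suc k) c = lab (Suc k) c' \<Longrightarrow> lab k c = lab k c'"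
    and root: "\<And>c c'. c \<in> C \<Longrightarrow> c' \<in> C \<Longrightarrow> lab 0 c = lab 0 c'"
    and cost: "\<And>k c c'. k \<le> L \<Longrightarrow> c \<in> C \<Longrightarrow> c' \<in> C \<Longrightarrow> lab k c = lab k c' \<Longrightarrow> cost c c' \<le> D k"
    and D: "\<And>k. 0 \<le> D k"
  shows "\<exists>\<pi>. partial_coupling C p u (\<lambda>_. 0) (\<lambda>_. 0) \<pi> \<and>
    (\<Sum>c\<in>C. \<Sum>c'\<in>C. \<pi> c c' * cost c c') \<le> D L + (\<Sum>k<L. D k *
      (\<Sum>a\<in>lab (Suc k) ` C. \<bar>sum p {c\<in>C. lab (Suc k) c = a} - sum u {c\<in>C. lab (Suc k) c = a}\<bar>))"
proof -
  define TV where "TV k = (\<Sum>a\<in>lab k ` C. \<bar>sum p {c\<in>C. lab k c = a} - sum u {c\<in>C. lab k c = a}\<bar>)" for k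
  \<comment> \<open>The invariant once level \<open>L - j\<close> has been processed: mass has moved
    only inside the cells of that level, and each cell is exhausted on one side.\<close>
  have "\<exists>r s \<pi>. partial_coupling C p u r s \<pi> \<and>
    (\<forall>c\<in>C. \<forall>c'\<in>C. \<pi> c c' \<noteq> 0 \<longrightarrow> lab (L - j) c = lab (L - j) c') \<and>
    (\<forall>c\<in>C. \<forall>c'\<in>C. lab (L - j) c = lab (L - j) c' \<longrightarrow> r c = 0 \<or> s c' = 0) \<and>
    (\<Sum>c\<in>C. \<Sum>c'\<in>C. \<pi> c c' * cost c c') \<le> D L + (\<Sum>k\<in>{L - j..<L}. D k * TV (Suc k))" if "j \<le> L" for j
    using that
  proof (induction j)
    case 0
    have "partial_coupling C p u p u (\<lambda>_ _. 0)"
      using p u by (auto simp: partial_coupling_def)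
    from greedy_matching_step[OF C this, of "lab L" cost "D L"] cost[of L] D p(2) show ?case
      by auto
  next
    case (Suc j)
    define k where "k = L - Suc j"
    have k: "k < L" "L - j = Suc k" "L - Suc j = k" using Suc.prems by (auto simp: k_def)
    from Suc have "\<exists>r s \<pi>. partial_coupling C p u r s \<pi> \<and>
      (\<forall>c\<in>C. \<forall>c'\<in>C. \<pi> c c' \<noteq> 0 \<longrightarrow> lab (Suc k) c = lab (Suc k) c') \<and>
      (\<forall>c\<in>C. \<forall>c'\<in>C. lab (Suc k) c = lab (Suc k) c' \<longrightarrow> r c = 0 \<or> s c' = 0) \<and>
      (\<Sum>c\<in>C. \<Sum>c'\<in>C. \<pi> c c' * cost c c') \<le> D L + (\<Sum>k\<in>{Suc k..<L}. D k * TV (Suc k))"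
      unfolding k by simp
    then obtain r s \<pi> where pc: "partial_coupling C p u r s \<pi>"
      and supp: "\<And>c c'. c \<in> C \<Longrightarrow> c' \<in> C \<Longrightarrow> \<pi> c c' \<noteq> 0 \<Longrightarrow> lab (Suc k) c = lab (Suc k) c'"
      and disj: "\<And>c c'. c \<in> C \<Longrightarrow> c' \<in> C \<Longrightarrow> lab (Suc k) c = lab (Suc k) c' \<Longrightarrow> r c = 0 \<or> s c' = 0"
      and bd: "(\<Sum>c\<in>C. \<Sum>c'\<in>C. \<pi> c c' * cost c c') \<le> D L + (\<Sum>k\<in>{Suc k..<L}. D k * TV (Suc k))"
      by blast
    have "sum r C \<le> TV (Suc k)"
      unfolding TV_def by (rule unmatched_mass_le[OF C pc supp disj])
    then have "D k * sum r C \<le> D k * TV (Suc k)"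
      using D by (rule mult_left_mono)
    moreover have "(\<Sum>k\<in>{k..<L}. D k * TV (Suc k)) = D k * TV (Suc k) + (\<Sum>k\<in>{Suc k..<L}. D k * TV (Suc k))"
      using k by (simp add: sum.atLeast_Suc_lessThan)
    moreover obtain r' s' \<pi>' where pc': "partial_coupling C p u r' s' \<pi>'"
      and supp': "\<forall>c\<in>C. \<forall>c'\<in>C. \<pi>' c c' \<noteq> 0 \<longrightarrow> lab k c = lab k c'"
      and disj': "\<forall>c\<in>C. \<forall>c'\<in>C. lab k c = lab k c' \<longrightarrow> r' c = 0 \<or> s' c' = 0"
      and "(\<Sum>c\<in>C. \<Sum>c'\<in>C. \<pi>' c c' * cost c c') \<le> (\<Sum>c\<in>C. \<Sum>c'\<in>C. \<pi> c c' * cost c c') + D k * sum r C"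
    proof -
      have "\<exists>r' s' \<pi>'. partial_coupling C p u r' s' \<pi>' \<and>
        (\<forall>c\<in>C. \<forall>c'\<in>C. \<pi>' c c' \<noteq> 0 \<longrightarrow> lab k c = lab k c') \<and>
        (\<forall>c\<in>C. \<forall>c'\<in>C. lab k c = lab k c' \<longrightarrow> r' c = 0 \<or> s' c' = 0) \<and>
        (\<Sum>c\<in>C. \<Sum>c'\<in>C. \<pi>' c c' * cost c c') \<le> (\<Sum>c\<in>C. \<Sum>c'\<in>C. \<pi> c c' * cost c c') + D k * sum r C"
      proof (rule greedy_matching_step[OF C pc])
        show "lab k c = lab k c'" if "c \<in> C" "c' \<in> C" "\<pi> c c' \<noteq> 0" for c c'
          by (rule nested[OF k(1) that(1,2) supp[OF that]])
        show "cost c c' \<le> D k" if "c \<in> C" "c' \<in> C" "lab k c = lab k c'" for c c'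
          using k(1) that by (intro cost) auto
      qed (rule D)
      then show thesis using that by blast
    qed
    ultimately have "(\<Sum>c\<in>C. \<Sum>c'\<in>C. \<pi>' c c' * cost c c') \<le> D L + (\<Sum>k\<in>{k..<L}. D k * TV (Suc k))"
      using bd by linarith
    then show ?case
      unfolding k using pc' supp' disj' by blast
  qed
  from this[of L] obtain r s \<pi> where pc: "partial_coupling C p u r s \<pi>"
    and disj0: "\<forall>c\<in>C. \<forall>c'\<in>C. lab 0 c = lab 0 c' \<longrightarrow> r c = 0 \<or> s c' = 0"
    and bd: "(\<Sum>c\<in>C. \<Sum>c'\<in>C. \<pi> c c' * cost c c') \<le> D L + (\<Sum>k\<in>{0..<L}. D k * TV (Suc k))"
    unfolding diff_self_eq_0 by blast
  have disj: "r c = 0 \<or> s c' = 0" if "c \<in> C" "c' \<in> C" for c c'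
    using disj0 root[OF that] that by blast
  have "sum p C = (\<Sum>c\<in>C. (\<Sum>c'\<in>C. \<pi> c c') + r c)" "sum u C = (\<Sum>c'\<in>C. (\<Sum>c\<in>C. \<pi> c c') + s c')"
    using pc by (auto simp: partial_coupling_def intro!: sum.cong)
  moreover have "(\<Sum>c'\<in>C. \<Sum>c\<in>C. \<pi> c c') = (\<Sum>c\<in>C. \<Sum>c'\<in>C. \<pi> c c')"
    by (rule sum.swap)
  ultimately have eq: "sum r C = sum s C"
    using p u by (simp add: sum.distrib)
  \<comment> \<open>The root is a single class, so one side has no residual at all; equal total
    masses then empty the other side too.\<close>
  have "(\<forall>c\<in>C. r c = 0) \<or> (\<forall>c\<in>C. s c = 0)"
    using disj by blast
  then have "sum r C = 0 \<and> sum s C = 0" using eq by auto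
  then have "(\<forall>c\<in>C. r c = 0) \<and> (\<forall>c\<in>C. s c = 0)"
    using pc C by (subst (asm) (1 2) sum_nonneg_eq_0_iff) (auto simp: partial_coupling_def)
  then have "partial_coupling C p u (\<lambda>_. 0) (\<lambda>_. 0) \<pi>"
    using pc by (auto simp: partial_coupling_def)
  then show ?thesis
    using bd unfolding TV_def by (auto simp: lessThan_atLeast0)
qed

text \<open>A coupling of cell masses is lifted to points by making them independent inside each
  pair of cells, that is, by the density \<open>\<pi> c c' / (p c * u c')\<close> with respect to
  \<open>q \<Otimes>\<^sub>M v\<close>. This restores the marginals exactly, and the cost depends on
  the cells alone.\<close>

lemma wasserstein_le_discrete:
  fixes q v :: "(real ^ 'd) measure" and cell :: "real ^ 'd \<Rightarrow> 'b"
  assumes q: "q \<in> distributions_on X" and v: "v \<in> distributions_on X"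
    and C: "finite C" and cell_C: "\<And>x. cell x \<in> C"
    and E: "\<And>c. c \<in> C \<Longrightarrow> {x. cell x = c} \<in> sets borel"
    and pc: "partial_coupling C (\<lambda>c. measure q {x. cell x = c}) (\<lambda>c. measure v {x. cell x = c}) (\<lambda>_. 0) (\<lambda>_. 0) \<pi>"
    and cost: "\<And>x y. x \<in> X \<Longrightarrow> y \<in> X \<Longrightarrow> norm (x - y) \<le> cost (cell x) (cell y)"
    and cost0: "\<And>c c'. 0 \<le> cost c c'"
  shows "wasserstein X q v \<le> ennreal (\<Sum>c\<in>C. \<Sum>c'\<in>C. \<pi> c c' * cost c c')"
proof -
  interpret q: prob_space q using q by (simp add: distributions_on_def)
  interpret v: prob_space v using v by (simp add: distributions_on_def)
  have sets[measurable_cong, simp]: "sets q = sets borel" "sets v = sets borel"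
    using q v by (auto simp: distributions_on_def)
  have sp[simp]: "space q = UNIV" "space v = UNIV"
    using sets_eq_imp_space_eq[OF sets(1)] sets_eq_imp_space_eq[OF sets(2)] by auto
  have X[measurable]: "X \<in> sets borel"
    using q emeasure_notin_sets[of X q] by (auto simp: distributions_on_def)
  interpret qv: pair_prob_space q v ..
  define F where "F c = {x. cell x = c}" for c
  have F[measurable]: "c \<in> C \<Longrightarrow> F c \<in> sets borel" for c using E by (simp add: F_def)
  define p where "p c = measure q (F c)" for c
  define u where "u c = measure v (F c)" for c
  have pi0: "0 \<le> \<pi> c c'" and row: "p c = (\<Sum>c'\<in>C. \<pi> c c')" and col: "u c' = (\<Sum>c\<in>C. \<pi> c c')"
    if "c \<in> C" "c' \<in> C" for c c'
    using pc that by (auto simp: partial_coupling_def p_def u_def F_def)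
  \<comment> \<open>A cell of mass zero has a zero row in the plan, which agrees with the value 0
    that the quotient \<open>g\<close> takes when its denominator vanishes.\<close>
  have pi_p: "\<pi> c c' = 0" if "c \<in> C" "c' \<in> C" "p c = 0" for c c'
    using member_le_sum[of c' C "\<pi> c"] row[OF that(1,2)] that pi0 C by (auto intro!: antisym)
  have pi_u: "\<pi> c c' = 0" if "c \<in> C" "c' \<in> C" "u c' = 0" for c c'
    using member_le_sum[of c C "\<lambda>c. \<pi> c c'"] col[OF that(1,2)] that pi0 C by (auto intro!: antisym)
  define g where "g c c' = \<pi> c c' / (p c * u c')" for c c'
  have g0: "0 \<le> g c c'" if "c \<in> C" "c' \<in> C" for c c'
    using pi0[OF that] by (simp add: g_def p_def u_def)
  define G where "G z = (\<Sum>c\<in>C. \<Sum>c'\<in>C. ennreal (g c c') * indicator (F c \<times> F c') z)" for z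
  have G_meas[measurable]: "G \<in> borel_measurable (q \<Otimes>\<^sub>M v)"
  proof -
    have "F c \<times> F c' \<in> sets (q \<Otimes>\<^sub>M v)" if "c \<in> C" "c' \<in> C" for c c'
      using F[OF that(1)] F[OF that(2)] by (intro pair_measureI) auto
    then show ?thesis
      unfolding G_def by (intro borel_measurable_sum borel_measurable_times_ennreal borel_measurable_indicator) auto
  qed
  have G_eq: "G (x, y) = ennreal (g (cell x) (cell y))" for x y
  proof -
    have "G (x, y) = (\<Sum>c\<in>C. \<Sum>c'\<in>C. if cell y = c' then (if cell x = c then ennreal (g c c') else 0) else 0)"
      unfolding G_def by (intro sum.cong refl) (auto simp: indicator_def F_def)
    then show ?thesis using C cell_C by simp
  qed
  define M where "M = density (q \<Otimes>\<^sub>M v) G"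
  have setsM: "sets M = sets borel"
    unfolding M_def by (simp add: borel_prod[symmetric] cong: sets_pair_measure_cong)
  have M_F: "(\<integral>\<^sup>+z. h z \<partial>M) = (\<integral>\<^sup>+z. G z * h z \<partial>(q \<Otimes>\<^sub>M v))" if "h \<in> borel_measurable borel" for h
  proof -
    have "h \<in> borel_measurable (q \<Otimes>\<^sub>M v)"
      using that by (subst measurable_cong_sets[OF _ refl, of _ borel])
        (simp_all add: borel_prod[symmetric] cong: sets_pair_measure_cong)
    then show ?thesis unfolding M_def by (subst nn_integral_density) auto
  qed
  \<comment> \<open>General \<open>A\<close> and \<open>B\<close> are for the marginals; the cost
    integral is the case \<open>A = B = UNIV\<close> with the cost included in
    \<open>h\<close>.\<close>
  have int_FF: "(\<integral>\<^sup>+z. (\<Sum>c\<in>C. \<Sum>c'\<in>C. ennreal (h c c') * indicator ((A \<inter> F c) \<times> (B \<inter> F c')) z) \<partial>(q \<Otimes>\<^sub>M v))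
      = ennreal (\<Sum>c\<in>C. \<Sum>c'\<in>C. h c c' * (measure q (A \<inter> F c) * measure v (B \<inter> F c')))"
    if [measurable]: "A \<in> sets borel" "B \<in> sets borel" and h: "\<And>c c'. c \<in> C \<Longrightarrow> c' \<in> C \<Longrightarrow> 0 \<le> h c c'" for A B h
  proof -
    have AB: "(A \<inter> F c) \<times> (B \<inter> F c') \<in> sets (q \<Otimes>\<^sub>M v)" if "c \<in> C" "c' \<in> C" for c c'
      using F[OF that(1)] F[OF that(2)] \<open>A \<in> sets borel\<close> \<open>B \<in> sets borel\<close> by (intro pair_measureI) auto
    have "(\<integral>\<^sup>+z. (\<Sum>c\<in>C. \<Sum>c'\<in>C. ennreal (h c c') * indicator ((A \<inter> F c) \<times> (B \<inter> F c')) z) \<partial>(q \<Otimes>\<^sub>M v))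
      = (\<Sum>c\<in>C. \<Sum>c'\<in>C. ennreal (h c c') * emeasure (q \<Otimes>\<^sub>M v) ((A \<inter> F c) \<times> (B \<inter> F c')))"
    proof -
      have meas: "(\<lambda>z. ennreal (h c c') * indicator ((A \<inter> F c) \<times> (B \<inter> F c')) z) \<in> borel_measurable (q \<Otimes>\<^sub>M v)"
        if "c \<in> C" "c' \<in> C" for c c'
        using AB[OF that] by measurable
      show ?thesis
        using AB by (simp add: nn_integral_sum meas borel_measurable_sum nn_integral_cmult_indicator)
    qed
    also have "\<dots> = (\<Sum>c\<in>C. \<Sum>c'\<in>C. ennreal (h c c' * (measure q (A \<inter> F c) * measure v (B \<inter> F c'))))"
    proof (intro sum.cong refl)
      fix c c' assume c: "c \<in> C" "c' \<in> C"
      note F[OF c(1), measurable] F[OF c(2), measurable]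
      show "ennreal (h c c') * emeasure (q \<Otimes>\<^sub>M v) ((A \<inter> F c) \<times> (B \<inter> F c')) =
        ennreal (h c c' * (measure q (A \<inter> F c) * measure v (B \<inter> F c')))"
        using h[OF c] by (subst v.emeasure_pair_measure_Times)
          (auto simp: q.emeasure_eq_measure v.emeasure_eq_measure ennreal_mult)
    qed
    also have "\<dots> = ennreal (\<Sum>c\<in>C. \<Sum>c'\<in>C. h c c' * (measure q (A \<inter> F c) * measure v (B \<inter> F c')))"
      using h by (simp add: sum_ennreal sum_nonneg)
    finally show ?thesis .
  qed
  have rect: "emeasure M (A \<times> B) =
      ennreal (\<Sum>c\<in>C. \<Sum>c'\<in>C. g c c' * (measure q (A \<inter> F c) * measure v (B \<inter> F c')))"
    if AB: "A \<in> sets borel" "B \<in> sets borel" for A B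
  proof -
    have AxB: "A \<times> B \<in> sets (q \<Otimes>\<^sub>M v)" using AB by (intro pair_measureI) auto
    have "emeasure M (A \<times> B) = (\<integral>\<^sup>+z. G z * indicator (A \<times> B) z \<partial>(q \<Otimes>\<^sub>M v))"
      unfolding M_def using AxB by (rule emeasure_density[OF G_meas])
    also have "\<dots> = (\<integral>\<^sup>+z. (\<Sum>c\<in>C. \<Sum>c'\<in>C. ennreal (g c c') * indicator ((A \<inter> F c) \<times> (B \<inter> F c')) z) \<partial>(q \<Otimes>\<^sub>M v))"
      unfolding G_def sum_distrib_right by (intro nn_integral_cong sum.cong refl) (auto simp: indicator_def)
    also have "\<dots> = ennreal (\<Sum>c\<in>C. \<Sum>c'\<in>C. g c c' * (measure q (A \<inter> F c) * measure v (B \<inter> F c')))"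
      using AB g0 by (rule int_FF)
    finally show ?thesis .
  qed
  have part: "(\<Sum>c\<in>C. measure \<mu> (A \<inter> F c)) = measure \<mu> A"
    if "prob_space \<mu>" "sets \<mu> = sets borel" "A \<in> sets borel" for \<mu> :: "(real ^ 'd) measure" and A
  proof -
    interpret \<mu>: prob_space \<mu> by fact
    have "measure \<mu> (\<Union>c\<in>C. A \<inter> F c) = (\<Sum>c\<in>C. measure \<mu> (A \<inter> F c))"
      using C F that by (intro \<mu>.finite_measure_finite_Union) (auto simp: disjoint_family_on_def F_def)
    moreover have "(\<Union>c\<in>C. A \<inter> F c) = A" using cell_C by (auto simp: F_def)
    ultimately show ?thesis by simp
  qed
  have fst_M: "emeasure M (A \<times> UNIV) = emeasure q A" if A: "A \<in> sets borel" for A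
  proof -
    have "(\<Sum>c'\<in>C. g c c' * (measure q (A \<inter> F c) * u c')) = measure q (A \<inter> F c)" if c: "c \<in> C" for c
    proof (cases "p c = 0")
      case True
      have "measure q (A \<inter> F c) \<le> p c"
        unfolding p_def using F[OF c] A by (intro q.finite_measure_mono) auto
      then have "measure q (A \<inter> F c) = 0" using True by (simp add: measure_le_0_iff)
      then show ?thesis by simp
    next
      case False
      have "(\<Sum>c'\<in>C. g c c' * (measure q (A \<inter> F c) * u c')) = (\<Sum>c'\<in>C. measure q (A \<inter> F c) / p c * \<pi> c c')"
        using pi_u[OF c] by (intro sum.cong refl) (auto simp: g_def)
      also have "\<dots> = measure q (A \<inter> F c)"
        unfolding sum_distrib_left[symmetric] using row[OF c c] False by simp
      finally show ?thesis .
    qed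
    then show ?thesis
      using rect[OF A, of UNIV] part[OF _ _ A, of q] by (simp add: u_def q.prob_space_axioms q.emeasure_eq_measure)
  qed
  have snd_M: "emeasure M (UNIV \<times> A) = emeasure v A" if A: "A \<in> sets borel" for A
  proof -
    have "(\<Sum>c\<in>C. g c c' * (p c * measure v (A \<inter> F c'))) = measure v (A \<inter> F c')" if c: "c' \<in> C" for c'
    proof (cases "u c' = 0")
      case True
      have "measure v (A \<inter> F c') \<le> u c'"
        unfolding u_def using F[OF c] A by (intro v.finite_measure_mono) auto
      then have "measure v (A \<inter> F c') = 0" using True by (simp add: measure_le_0_iff)
      then show ?thesis by simp
    next
      case False
      have "(\<Sum>c\<in>C. g c c' * (p c * measure v (A \<inter> F c'))) = (\<Sum>c\<in>C. measure v (A \<inter> F c') / u c' * \<pi> c c')"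
        using pi_p[OF _ c] by (intro sum.cong refl) (auto simp: g_def)
      also have "\<dots> = measure v (A \<inter> F c')"
        unfolding sum_distrib_left[symmetric] using col[OF c c] False by simp
      finally show ?thesis .
    qed
    then show ?thesis
      using rect[OF _ A, of UNIV] part[OF _ _ A, of v] sum.swap[of _ C C]
      by (simp add: p_def v.prob_space_axioms v.emeasure_eq_measure
          sum.swap[of "\<lambda>c c'. g c c' * (p c * measure v (A \<inter> F c'))" C C, unfolded p_def])
  qed
  have spM: "space M = UNIV" using sets_eq_imp_space_eq[OF setsM] by simp
  interpret M: prob_space M
  proof
    show "emeasure M (space M) = 1"
      using fst_M[of UNIV] q.emeasure_space_1 spM by simp
  qed
  \<comment> \<open>The marginals give full mass to both strips, and the intersection of the strips
    is \<open>X \<times> X\<close>.\<close>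
  have "AE z in M. z \<in> X \<times> UNIV" "AE z in M. z \<in> UNIV \<times> X"
    using fst_M[OF X] snd_M[OF X] q v X
    by (auto simp: M.emeasure_eq_measure distributions_on_def setsM borel_prod[symmetric] intro!: M.AE_prob_1)
  then have AE_X: "AE z in M. z \<in> X \<times> X"
    by eventually_elim auto
  have XX: "X \<times> X \<in> sets M" using X by (simp add: setsM borel_prod[symmetric])
  have proj: "fst \<in> M \<rightarrow>\<^sub>M borel" "snd \<in> M \<rightarrow>\<^sub>M borel"
    unfolding measurable_cong_sets[OF setsM refl] borel_prod[symmetric] by simp_all
  have "M \<in> coup X q v"
  proof -
    have "emeasure M (X \<times> X) = 1"
      using M.emeasure_eq_1_AE[OF XX AE_X] .
    moreover have "distr M borel fst = q"
    proof (rule measure_eqI)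
      fix A assume "A \<in> sets (distr M borel fst)"
      then have A: "A \<in> sets borel" by simp
      have "fst -` A \<inter> space M = A \<times> UNIV" using spM by auto
      then show "emeasure (distr M borel fst) A = emeasure q A"
        using A fst_M[OF A] by (simp add: emeasure_distr[OF proj(1)])
    qed simp
    moreover have "distr M borel snd = v"
    proof (rule measure_eqI)
      fix A assume "A \<in> sets (distr M borel snd)"
      then have A: "A \<in> sets borel" by simp
      have "snd -` A \<inter> space M = UNIV \<times> A" using spM by auto
      then show "emeasure (distr M borel snd) A = emeasure v A"
        using A snd_M[OF A] by (simp add: emeasure_distr[OF proj(2)])
    qed simp
    ultimately show ?thesis
      using setsM M.prob_space_axioms by (auto simp: coup_def distributions_on_def)
  qed
  then have "wasserstein X q v \<le> (\<integral>\<^sup>+ (x, y). ennreal (norm (x - y)) \<partial>M)"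
    unfolding wasserstein_def by (rule INF_lower)
  also have "\<dots> \<le> (\<integral>\<^sup>+ (x, y). ennreal (cost (cell x) (cell y)) \<partial>M)"
    by (rule nn_integral_mono_AE, rule AE_mp[OF AE_X]) (auto intro!: AE_I2 ennreal_leI cost)
  also have "\<dots> = (\<integral>\<^sup>+ z. (\<Sum>c\<in>C. \<Sum>c'\<in>C. ennreal (cost c c') * indicator (F c \<times> F c') z) \<partial>M)"
  proof (intro nn_integral_cong)
    fix z :: "(real ^ 'd) \<times> (real ^ 'd)"
    obtain x y where z: "z = (x, y)" by (cases z)
    have "(\<Sum>c\<in>C. \<Sum>c'\<in>C. ennreal (cost c c') * indicator (F c \<times> F c') z) =
      (\<Sum>c\<in>C. \<Sum>c'\<in>C. if cell y = c' then (if cell x = c then ennreal (cost c c') else 0) else 0)"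
      unfolding z by (intro sum.cong refl) (auto simp: indicator_def F_def)
    then show "(case z of (x, y) \<Rightarrow> ennreal (cost (cell x) (cell y))) =
      (\<Sum>c\<in>C. \<Sum>c'\<in>C. ennreal (cost c c') * indicator (F c \<times> F c') z)"
      using C cell_C z by simp
  qed
  also have "\<dots> = (\<integral>\<^sup>+ z. (\<Sum>c\<in>C. \<Sum>c'\<in>C. ennreal (g c c' * cost c c') * indicator ((UNIV \<inter> F c) \<times> (UNIV \<inter> F c')) z) \<partial>(q \<Otimes>\<^sub>M v))"
  proof (subst M_F)
    have "F c \<times> F c' \<in> sets borel" if "c \<in> C" "c' \<in> C" for c c'
      using F[OF that(1)] F[OF that(2)] by (simp add: borel_prod[symmetric])
    then show "(\<lambda>z. \<Sum>c\<in>C. \<Sum>c'\<in>C. ennreal (cost c c') * indicator (F c \<times> F c') z) \<in> borel_measurable borel"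
      by (intro borel_measurable_sum borel_measurable_times_ennreal borel_measurable_indicator) auto
    show "(\<integral>\<^sup>+z. G z * (\<Sum>c\<in>C. \<Sum>c'\<in>C. ennreal (cost c c') * indicator (F c \<times> F c') z) \<partial>(q \<Otimes>\<^sub>M v)) =
      (\<integral>\<^sup>+ z. (\<Sum>c\<in>C. \<Sum>c'\<in>C. ennreal (g c c' * cost c c') * indicator ((UNIV \<inter> F c) \<times> (UNIV \<inter> F c')) z) \<partial>(q \<Otimes>\<^sub>M v))"
    proof (intro nn_integral_cong)
      fix z :: "(real ^ 'd) \<times> (real ^ 'd)"
      obtain x y where z: "z = (x, y)" by (cases z)
      show "G z * (\<Sum>c\<in>C. \<Sum>c'\<in>C. ennreal (cost c c') * indicator (F c \<times> F c') z) =
        (\<Sum>c\<in>C. \<Sum>c'\<in>C. ennreal (g c c' * cost c c') * indicator ((UNIV \<inter> F c) \<times> (UNIV \<inter> F c')) z)"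
        unfolding z G_eq sum_distrib_left
        by (intro sum.cong refl) (auto simp: indicator_def F_def ennreal_mult g0 cost0)
    qed
  qed
  also have "\<dots> = ennreal (\<Sum>c\<in>C. \<Sum>c'\<in>C. g c c' * cost c c' * (measure q (UNIV \<inter> F c) * measure v (UNIV \<inter> F c')))"
    by (rule int_FF) (auto simp: g0 cost0)
  also have "\<dots> = ennreal (\<Sum>c\<in>C. \<Sum>c'\<in>C. \<pi> c c' * cost c c')"
  proof (intro arg_cong[where f = ennreal] sum.cong refl)
    fix c c' assume c: "c \<in> C" "c' \<in> C"
    show "g c c' * cost c c' * (measure q (UNIV \<inter> F c) * measure v (UNIV \<inter> F c')) = \<pi> c c' * cost c c'"
      using pi_p[OF c] pi_u[OF c] unfolding g_def p_def[symmetric] u_def[symmetric] by (auto simp: p_def u_def)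
  qed
  finally show ?thesis .
qed

section \<open>Multiscale tester on dyadic cells\<close>

text \<open>For a deterministic tester, encoded as a kernel of point masses, the verdict is an event
  of the sample space.\<close>

lemma measure_verdict_return:
  fixes q :: "(real ^ 'd) measure"
  assumes q: "prob_space q" "sets q = sets borel"
    and P: "Measurable.pred (\<Pi>\<^sub>M i\<in>{..<n}. borel) P"
  shows "measure (verdict n (\<lambda>x. return (count_space UNIV) (P x)) q) {b} =
    measure (\<Pi>\<^sub>M i\<in>{..<n}. q) {x\<in>space (\<Pi>\<^sub>M i\<in>{..<n}. q). P x = b}"
proof -
  interpret Q: prob_space "\<Pi>\<^sub>M i\<in>{..<n}. q"
    by (intro prob_space_PiM q)
  have sets: "sets (\<Pi>\<^sub>M i\<in>{..<n}. q) = sets (\<Pi>\<^sub>M i\<in>{..<n}. borel)"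
    by (intro sets_PiM_cong refl q)
  have P': "P \<in> (\<Pi>\<^sub>M i\<in>{..<n}. q) \<rightarrow>\<^sub>M count_space UNIV"
    using P unfolding measurable_cong_sets[OF sets refl] .
  have "verdict n (\<lambda>x. return (count_space UNIV) (P x)) q = distr (\<Pi>\<^sub>M i\<in>{..<n}. q) (count_space UNIV) P"
    unfolding verdict_def using bind_return_distr[OF Q.not_empty P'] by (simp add: comp_def)
  moreover have "P -` {b} \<inter> space (\<Pi>\<^sub>M i\<in>{..<n}. q) = {x\<in>space (\<Pi>\<^sub>M i\<in>{..<n}. q). P x = b}"
    by auto
  ultimately show ?thesis
    by (simp add: measure_distr[OF P'])
qed

text \<open>Accept when the statistics of all levels stay below their thresholds. False alarms are
  added up over \<open>K\<close>; for a far distribution, the one level supplied by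
  \<open>far\<close> already rejects often enough.\<close>

lemma uniformity_tester_multiscale:
  fixes X :: "(real ^ 'd) set" and C :: "nat \<Rightarrow> 'b set" and E :: "nat \<Rightarrow> 'b \<Rightarrow> (real ^ 'd) set"
  defines "U \<equiv> uniform_on X"
  assumes U: "uniform_on X \<in> distributions_on X"
    and K: "finite K" "real (card K) * (4 / B\<^sup>2) \<le> 1 / 3"
    and test: "\<And>k. k \<in> K \<Longrightarrow> cell_test (C k) (E k) (\<lambda>c. measure U (E k c)) (w k) m (\<theta> k) B"
    and E: "\<And>k c. E k c \<in> sets borel"
    and far: "\<And>q. q \<in> distributions_on X \<Longrightarrow> far_from X \<epsilon> U q \<Longrightarrow>
      \<exists>k\<in>K. \<theta> k \<le> (\<Sum>c\<in>C k. (measure q (E k c) - measure U (E k c))\<^sup>2 / w k c)"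
  shows "\<exists>A. uniformity_tester X \<epsilon> (2 * m) A"
proof -
  define T where "T k = cell_statistic m (C k) (E k) (\<lambda>c. measure U (E k c)) (w k)" for k
  define Acc where "Acc x \<longleftrightarrow> (\<forall>k\<in>K. T k x < (real m)\<^sup>2 * \<theta> k / 2)" for x
  have T_meas: "T k \<in> borel_measurable (\<Pi>\<^sub>M i\<in>{..<2 * m}. borel)" for k
    unfolding T_def by (rule cell_statistic_measurable) (auto simp: E)
  have Acc_meas: "Measurable.pred (\<Pi>\<^sub>M i\<in>{..<2 * m}. borel) Acc"
    unfolding Acc_def using T_meas K(1) by measurable
  define A where "A x = return (count_space UNIV) (Acc x)" for x
  have "A \<in> randomized_algorithms (2 * m)"
    unfolding randomized_algorithms_def A_def
    by (intro measurable_prob_algebraI measurable_compose[OF Acc_meas return_measurable] prob_space_return) simp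
  moreover have "measure (verdict (2 * m) A U) {True} \<ge> 2 / 3"
  proof -
    have U': "prob_space U" "sets U = sets borel" using U by (auto simp: U_def distributions_on_def)
    define P where "P = (\<Pi>\<^sub>M i\<in>{..<2 * m}. U)"
    interpret P: prob_space P unfolding P_def by (intro prob_space_PiM U')
    have sets: "sets P = sets (\<Pi>\<^sub>M i\<in>{..<2 * m}. borel)"
      unfolding P_def by (intro sets_PiM_cong refl U')
    have T_meas'[measurable]: "T k \<in> borel_measurable P" for k
      using T_meas unfolding measurable_cong_sets[OF sets refl] .
    have fail: "P.prob {x\<in>space P. (real m)\<^sup>2 * \<theta> k / 2 \<le> T k x} \<le> 4 / B\<^sup>2" if k: "k \<in> K" for k
      using cell_test.accept_null[OF test[OF k] U'(1)] U'(2) E unfolding P_def T_def by simp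
    have "P.prob {x\<in>space P. Acc x = False} \<le> P.prob (\<Union>k\<in>K. {x\<in>space P. (real m)\<^sup>2 * \<theta> k / 2 \<le> T k x})"
      using K(1) by (intro P.finite_measure_mono) (auto simp: Acc_def not_less)
    also have "\<dots> \<le> (\<Sum>k\<in>K. P.prob {x\<in>space P. (real m)\<^sup>2 * \<theta> k / 2 \<le> T k x})"
      using K(1) by (intro P.finite_measure_subadditive_finite) auto
    also have "\<dots> \<le> real (card K) * (4 / B\<^sup>2)"
      using fail by (intro sum_bounded_above)
    also have "\<dots> \<le> 1 / 3" by (rule K)
    finally have "P.prob {x\<in>space P. \<not> Acc x} \<le> 1 / 3" by simp
    moreover have "{x\<in>space P. Acc x} \<in> P.events"
      using Acc_meas K(1) unfolding pred_def by (simp add: sets sets_eq_imp_space_eq[OF sets])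
    ultimately have "P.prob {x\<in>space P. Acc x} \<ge> 2 / 3"
      using P.prob_neg[of Acc] by simp
    then show ?thesis
      unfolding A_def using measure_verdict_return[OF U' Acc_meas, of True] by (simp add: P_def)
  qed
  moreover have "measure (verdict (2 * m) A q) {False} \<ge> 2 / 3"
    if q: "q \<in> distributions_on X" and farq: "far_from X \<epsilon> U q" for q
  proof -
    obtain k where k: "k \<in> K" "\<theta> k \<le> (\<Sum>c\<in>C k. (measure q (E k c) - measure U (E k c))\<^sup>2 / w k c)"
      using far[OF q farq] by auto
    have q': "prob_space q" "sets q = sets borel" using q by (auto simp: distributions_on_def)
    define P where "P = (\<Pi>\<^sub>M i\<in>{..<2 * m}. q)"
    interpret P: prob_space P unfolding P_def by (intro prob_space_PiM q')
    have sets: "sets P = sets (\<Pi>\<^sub>M i\<in>{..<2 * m}. borel)"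
      unfolding P_def by (intro sets_PiM_cong refl q')
    have T_meas'[measurable]: "T k \<in> borel_measurable P" for k
      using T_meas unfolding measurable_cong_sets[OF sets refl] .
    have "P.prob {x\<in>space P. Acc x} \<le> P.prob {x\<in>space P. T k x < (real m)\<^sup>2 * \<theta> k / 2}"
      using k by (intro P.finite_measure_mono) (auto simp: Acc_def)
    also have "\<dots> \<le> 1 / 3"
      unfolding T_def P_def by (rule cell_test.reject_far[OF test[OF k(1)] q'(1) _ k(2)]) (simp add: q' E)
    finally have "P.prob {x\<in>space P. Acc x} \<le> 1 / 3" .
    moreover have "{x\<in>space P. Acc x} \<in> P.events"
      using Acc_meas K(1) unfolding pred_def by (simp add: sets sets_eq_imp_space_eq[OF sets])
    ultimately have "P.prob {x\<in>space P. \<not> Acc x} \<ge> 2 / 3"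
      using P.prob_neg[of Acc] by simp
    then show ?thesis
      unfolding A_def using measure_verdict_return[OF q' Acc_meas, of False] by (simp add: P_def)
  qed
  ultimately show ?thesis
    unfolding uniformity_tester_def U_def by blast
qed

section \<open>Dyadic cells and the transport bound they give\<close>

definition int_grid :: "nat \<Rightarrow> (int ^ 'd) set" where
  "int_grid M = {v. \<forall>i. 0 \<le> v $ i \<and> v $ i < int M}"

lemma int_grid_eq: "int_grid M = (\<lambda>f. \<chi> i. f i) ` (UNIV \<rightarrow>\<^sub>E {0..<int M})"
proof (intro set_eqI iffI)
  fix v :: "int ^ 'd" assume "v \<in> int_grid M"
  then have "v = (\<chi> i. (\<lambda>i. v $ i) i)" "(\<lambda>i. v $ i) \<in> UNIV \<rightarrow>\<^sub>E {0..<int M}"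
    by (auto simp: int_grid_def)
  then show "v \<in> (\<lambda>f. \<chi> i. f i) ` (UNIV \<rightarrow>\<^sub>E {0..<int M})" by blast
qed (auto simp: int_grid_def PiE_def Pi_def)

lemma finite_int_grid: "finite (int_grid M :: (int ^ 'd) set)"
  unfolding int_grid_eq by (intro finite_imageI finite_PiE) auto

lemma card_int_grid: "card (int_grid M :: (int ^ 'd) set) = M ^ CARD('d)"
proof -
  have "inj_on (\<lambda>f. \<chi> i. f i) (UNIV \<rightarrow>\<^sub>E {0..<int M} :: ('d \<Rightarrow> int) set)"
    by (auto simp: inj_on_def vec_eq_iff)
  then show ?thesis
    unfolding int_grid_eq by (simp add: card_image card_PiE)
qed

text \<open>The map \<open>t \<mapsto> (t + 1) / 3\<close> sends \<open>[-1, 1]\<close> into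
  \<open>[0, 2/3]\<close>, strictly below 1, so that the right end needs no special cell. The box
  contains both the cube and the ball; cells have side \<open>3 / 2 ^ k\<close>. The value 0 off the
  box makes the map total with values in the grid.\<close>

definition dyadic_cell :: "nat \<Rightarrow> real ^ 'd \<Rightarrow> int ^ 'd" where
  "dyadic_cell k x = (if \<forall>i. \<bar>x $ i\<bar> \<le> 1 then \<chi> i. \<lfloor>2 ^ k * ((x $ i + 1) / 3)\<rfloor> else 0)"

lemma dyadic_cell_in_grid: "dyadic_cell k x \<in> int_grid (2 ^ k)"
proof (cases "\<forall>i. \<bar>x $ i\<bar> \<le> 1")
  case True
  have "0 \<le> \<lfloor>2 ^ k * ((x $ i + 1) / 3)\<rfloor> \<and> \<lfloor>2 ^ k * ((x $ i + 1) / 3)\<rfloor> < 2 ^ k" for i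
  proof -
    have x: "-1 \<le> x $ i" "x $ i \<le> 1" using True[rule_format, of i] by auto
    then have "0 \<le> 2 ^ k * ((x $ i + 1) / 3)" by simp
    moreover have "2 ^ k * ((x $ i + 1) / 3) < 2 ^ k * 1"
      using x by (intro mult_strict_left_mono) auto
    ultimately show ?thesis by (simp add: floor_less_iff)
  qed
  with True show ?thesis by (simp add: dyadic_cell_def int_grid_def)
next
  case False
  then have "dyadic_cell k x = 0" by (simp only: dyadic_cell_def if_False)
  then show ?thesis by (simp add: int_grid_def)
qed

lemma dyadic_cell_sets: "{x :: real ^ 'd. dyadic_cell k x = c} \<in> sets borel"
proof -
  have "{x :: real ^ 'd. dyadic_cell k x = c} =
    {x. if \<forall>i. \<bar>x $ i\<bar> \<le> 1 then \<forall>i. \<lfloor>2 ^ k * ((x $ i + 1) / 3)\<rfloor> = c $ i else c = 0}"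
    by (auto simp: dyadic_cell_def vec_eq_iff)
  also have "\<dots> \<in> sets borel"
    by measurable
  finally show ?thesis .
qed

text \<open>Floor commutes with division by a positive integer, so coarse cells are read off from
  fine ones and the levels form a tree. The default cell 0 is its own parent.\<close>

lemma dyadic_cell_parent:
  assumes "k \<le> L"
  shows "dyadic_cell k x = (\<chi> i. dyadic_cell L x $ i div 2 ^ (L - k))"
proof -
  have "\<lfloor>2 ^ k * t\<rfloor> = \<lfloor>2 ^ L * t\<rfloor> div 2 ^ (L - k)" for t :: real
  proof -
    have "(2::real) ^ L = 2 ^ k * 2 ^ (L - k)"
      using assms by (simp flip: power_add)
    then have "2 ^ k * t = (2 ^ L * t) / real_of_int (2 ^ (L - k))"
      by simp
    then show ?thesis
      by (simp only:) (rule floor_divide_real_eq_div, simp)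
  qed
  from this[of "(x $ i + 1) / 3" for i] show ?thesis
    by (simp add: dyadic_cell_def vec_eq_iff del: times_divide_eq_right)
qed

lemma div_eq_imp_dist_less:
  fixes a b n :: int
  assumes "a div n = b div n" "0 < n"
  shows "\<bar>a - b\<bar> < n"
proof -
  have "a = n * (b div n) + a mod n" "b = n * (b div n) + b mod n"
    using assms(1) by (metis mult_div_mod_eq)+
  moreover have "0 \<le> a mod n" "a mod n < n" "0 \<le> b mod n" "b mod n < n"
    using assms(2) by auto
  ultimately show ?thesis by linarith
qed

definition dyadic_discrepancy :: "(real ^ 'd) measure \<Rightarrow> (real ^ 'd) measure \<Rightarrow> nat \<Rightarrow> real" where
  "dyadic_discrepancy q v k =
    (\<Sum>a\<in>int_grid (2 ^ k). \<bar>measure q {x. dyadic_cell k x = a} - measure v {x. dyadic_cell k x = a}\<bar>)"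

text \<open>The leaves are the cells of level \<open>L\<close>, labelled at level \<open>k\<close>
  by integer division. Estimating the Euclidean norm by the sum of the coordinate distances gives
  the factor \<open>CARD('d)\<close>; the 3 is the side of the coarsest cell.\<close>

lemma wasserstein_le_dyadic:
  fixes q v :: "(real ^ 'd) measure"
  assumes q: "q \<in> distributions_on X" and v: "v \<in> distributions_on X"
    and X: "X \<subseteq> {x. \<forall>i. \<bar>x $ i\<bar> \<le> 1}"
  shows "wasserstein X q v \<le> ennreal (3 * real CARD('d) *
    ((1 / 2) ^ L + (\<Sum>k<L. (1 / 2) ^ k * dyadic_discrepancy q v (Suc k))))"
proof -
  define C where "C = (int_grid (2 ^ L) :: (int ^ 'd) set)"
  define lab where "lab k c = (\<chi> i. c $ i div 2 ^ (L - k))" for k and c :: "int ^ 'd"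
  define D where "D k = 3 * real CARD('d) * (1 / 2) ^ k" for k :: nat
  \<comment> \<open>The \<open>+ 1\<close> is needed because reals are less than one further apart
    than their floors. It is absorbed again: cells with the same label at level \<open>k\<close>
    differ by at most \<open>2 ^ (L - k) - 1\<close> in each coordinate.\<close>
  define cost where "cost c c' = 3 / 2 ^ L * (\<Sum>i\<in>UNIV. real_of_int (\<bar>c $ i - c' $ i\<bar> + 1))" for c c' :: "int ^ 'd"
  define p where "p c = measure q {x. dyadic_cell L x = c}" for c
  define u where "u c = measure v {x. dyadic_cell L x = c}" for c
  have C: "finite C" by (simp add: C_def finite_int_grid)
  have cellC: "dyadic_cell L x \<in> C" for x by (simp add: C_def dyadic_cell_in_grid)
  have union: "(\<Sum>c\<in>{c\<in>C. R c}. measure \<mu> {x. dyadic_cell L x = c}) = measure \<mu> {x. R (dyadic_cell L x)}"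
    if "\<mu> \<in> distributions_on X" for \<mu> :: "(real ^ 'd) measure" and R
  proof -
    interpret prob_space \<mu> using that by (simp add: distributions_on_def)
    have "measure \<mu> (\<Union>c\<in>{c\<in>C. R c}. {x. dyadic_cell L x = c}) = (\<Sum>c\<in>{c\<in>C. R c}. measure \<mu> {x. dyadic_cell L x = c})"
      using that C dyadic_cell_sets
      by (intro finite_measure_finite_Union) (auto simp: disjoint_family_on_def distributions_on_def)
    moreover have "(\<Union>c\<in>{c\<in>C. R c}. {x. dyadic_cell L x = c}) = {x. R (dyadic_cell L x)}"
      using cellC by auto
    ultimately show ?thesis by simp
  qed
  have total: "(\<Sum>c\<in>C. measure \<mu> {x. dyadic_cell L x = c}) = 1"
    if "\<mu> \<in> distributions_on X" for \<mu> :: "(real ^ 'd) measure"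
  proof -
    interpret prob_space \<mu> using that by (simp add: distributions_on_def)
    have "space \<mu> = UNIV" using that sets_eq_imp_space_eq[of \<mu> borel] by (auto simp: distributions_on_def)
    then show ?thesis
      using union[OF that, of "\<lambda>_. True"] prob_space by simp
  qed
  have labC: "lab k ` C \<subseteq> int_grid (2 ^ k)" if "k \<le> L" for k
  proof -
    have "0 \<le> a div 2 ^ (L - k) \<and> a div 2 ^ (L - k) < 2 ^ k" if "0 \<le> a" "a < 2 ^ L" for a :: int
    proof -
      have "(2::int) ^ L = 2 ^ k * 2 ^ (L - k)"
        using \<open>k \<le> L\<close> by (simp flip: power_add)
      moreover have "(a div 2 ^ (L - k)) * 2 ^ (L - k) \<le> a"
        using div_mult_mod_eq[of a "2 ^ (L - k)"] pos_mod_sign[of "2 ^ (L - k)" a]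
        by (smt (verit) zero_less_power)
      ultimately have "(a div 2 ^ (L - k)) * 2 ^ (L - k) < 2 ^ k * 2 ^ (L - k)"
        using that by linarith
      then show ?thesis using that by (simp add: pos_imp_zdiv_nonneg_iff)
    qed
    then show ?thesis by (auto simp: lab_def C_def int_grid_def)
  qed
  have lab_cell: "lab k (dyadic_cell L x) = dyadic_cell k x" if "k \<le> L" for k x
    unfolding lab_def dyadic_cell_parent[OF that, of x] ..
  have "\<exists>\<pi>. partial_coupling C p u (\<lambda>_. 0) (\<lambda>_. 0) \<pi> \<and>
    (\<Sum>c\<in>C. \<Sum>c'\<in>C. \<pi> c c' * cost c c') \<le> D L + (\<Sum>k<L. D k *
      (\<Sum>a\<in>lab (Suc k) ` C. \<bar>sum p {c\<in>C. lab (Suc k) c = a} - sum u {c\<in>C. lab (Suc k) c = a}\<bar>))"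
  proof (rule tree_coupling[OF C])
    show "0 \<le> p c" "0 \<le> u c" for c by (simp_all add: p_def u_def)
    show "sum p C = 1" "sum u C = 1" unfolding p_def u_def using total q v by auto
    show "0 \<le> D k" for k by (simp add: D_def)
    show "lab 0 c = lab 0 c'" if "c \<in> C" "c' \<in> C" for c c'
      using that by (auto simp: lab_def C_def int_grid_def vec_eq_iff div_pos_pos_trivial)
    show "lab k c = lab k c'" if "k < L" "lab (Suc k) c = lab (Suc k) c'" for k c c'
    proof -
      have "L - k = Suc (L - Suc k)" using that by simp
      then have "c $ i div 2 ^ (L - k) = (c $ i div 2 ^ (L - Suc k)) div 2" for c :: "int ^ 'd" and i
        by (simp add: zdiv_zmult2_eq[symmetric] mult.commute)
      then show ?thesis using that by (simp add: lab_def vec_eq_iff)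
    qed
    show "cost c c' \<le> D k" if "k \<le> L" "lab k c = lab k c'" for k c c'
    proof -
      have "real_of_int (\<bar>c $ i - c' $ i\<bar> + 1) \<le> 2 ^ (L - k)" for i
      proof -
        have "\<bar>c $ i - c' $ i\<bar> < 2 ^ (L - k)"
          using that by (intro div_eq_imp_dist_less) (auto simp: lab_def vec_eq_iff)
        then have "\<bar>c $ i - c' $ i\<bar> + 1 \<le> 2 ^ (L - k)" by simp
        then have "real_of_int (\<bar>c $ i - c' $ i\<bar> + 1) \<le> real_of_int (2 ^ (L - k))"
          by (simp only: of_int_le_iff)
        then show ?thesis by simp
      qed
      then have "cost c c' \<le> 3 / 2 ^ L * (real CARD('d) * 2 ^ (L - k))"
        unfolding cost_def by (intro mult_left_mono sum_bounded_above) auto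
      also have "\<dots> = D k"
        using that by (simp add: D_def power_diff power_divide)
      finally show ?thesis .
    qed
  qed
  then obtain \<pi> where pc: "partial_coupling C p u (\<lambda>_. 0) (\<lambda>_. 0) \<pi>"
    and bd: "(\<Sum>c\<in>C. \<Sum>c'\<in>C. \<pi> c c' * cost c c') \<le> D L + (\<Sum>k<L. D k *
      (\<Sum>a\<in>lab (Suc k) ` C. \<bar>sum p {c\<in>C. lab (Suc k) c = a} - sum u {c\<in>C. lab (Suc k) c = a}\<bar>))"
    by blast
  have "wasserstein X q v \<le> ennreal (\<Sum>c\<in>C. \<Sum>c'\<in>C. \<pi> c c' * cost c c')"
  proof (rule wasserstein_le_discrete[OF q v C cellC dyadic_cell_sets])
    show "partial_coupling C (\<lambda>c. measure q {x. dyadic_cell L x = c}) (\<lambda>c. measure v {x. dyadic_cell L x = c})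
        (\<lambda>_. 0) (\<lambda>_. 0) \<pi>"
      using pc unfolding p_def u_def .
    show "0 \<le> cost c c'" for c c'
      unfolding cost_def by (intro mult_nonneg_nonneg sum_nonneg) auto
    show "norm (x - y) \<le> cost (dyadic_cell L x) (dyadic_cell L y)" if "x \<in> X" "y \<in> X" for x y
    proof -
      have "\<bar>x $ i - y $ i\<bar> \<le> 3 / 2 ^ L * real_of_int (\<bar>dyadic_cell L x $ i - dyadic_cell L y $ i\<bar> + 1)" for i
      proof -
        define s t where "s = 2 ^ L * ((x $ i + 1) / 3)" and "t = 2 ^ L * ((y $ i + 1) / 3)"
        have cells: "dyadic_cell L x $ i = \<lfloor>s\<rfloor>" "dyadic_cell L y $ i = \<lfloor>t\<rfloor>"
          using that X by (auto simp: dyadic_cell_def s_def t_def)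
        have "\<bar>s - t\<bar> \<le> real_of_int (\<bar>\<lfloor>s\<rfloor> - \<lfloor>t\<rfloor>\<bar> + 1)"
          by linarith
        then have "3 / 2 ^ L * \<bar>s - t\<bar> \<le> 3 / 2 ^ L * real_of_int (\<bar>\<lfloor>s\<rfloor> - \<lfloor>t\<rfloor>\<bar> + 1)"
          by (rule mult_left_mono) simp
        moreover have "\<bar>x $ i - y $ i\<bar> = 3 / 2 ^ L * \<bar>s - t\<bar>"
        proof -
          have "x $ i - y $ i = 3 / 2 ^ L * (s - t)"
            by (simp add: s_def t_def field_simps)
          then show ?thesis by (simp only: abs_mult) simp
        qed
        ultimately show ?thesis
          unfolding cells by (simp only:)
      qed
      then have "(\<Sum>i\<in>UNIV. \<bar>(x - y) $ i\<bar>) \<le> cost (dyadic_cell L x) (dyadic_cell L y)"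
        unfolding cost_def sum_distrib_left by (intro sum_mono) auto
      with norm_le_l1_cart[of "x - y"] show ?thesis by (rule order.trans)
    qed
  qed
  also have "\<dots> \<le> ennreal (3 * real CARD('d) *
    ((1 / 2) ^ L + (\<Sum>k<L. (1 / 2) ^ k * dyadic_discrepancy q v (Suc k))))"
  proof (rule ennreal_leI, rule order.trans[OF bd])
    have "(\<Sum>a\<in>lab (Suc k) ` C. \<bar>sum p {c\<in>C. lab (Suc k) c = a} - sum u {c\<in>C. lab (Suc k) c = a}\<bar>)
      \<le> dyadic_discrepancy q v (Suc k)" if "k < L" for k
    proof -
      have "sum p {c\<in>C. lab (Suc k) c = a} = measure q {x. dyadic_cell (Suc k) x = a}"
        "sum u {c\<in>C. lab (Suc k) c = a} = measure v {x. dyadic_cell (Suc k) x = a}" for a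
        unfolding p_def u_def union[OF q] union[OF v] using that by (simp_all add: lab_cell)
      then show ?thesis
        unfolding dyadic_discrepancy_def using labC[of "Suc k"] that finite_int_grid by (auto intro!: sum_mono2)
    qed
    then have "D L + (\<Sum>k<L. D k *
      (\<Sum>a\<in>lab (Suc k) ` C. \<bar>sum p {c\<in>C. lab (Suc k) c = a} - sum u {c\<in>C. lab (Suc k) c = a}\<bar>))
      \<le> D L + (\<Sum>k<L. D k * dyadic_discrepancy q v (Suc k))"
      by (intro add_left_mono sum_mono mult_left_mono) (auto simp: D_def)
    also have "\<dots> = 3 * real CARD('d) *
    ((1 / 2) ^ L + (\<Sum>k<L. (1 / 2) ^ k * dyadic_discrepancy q v (Suc k)))"
      by (simp add: D_def sum_distrib_left distrib_left mult.assoc)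
    finally show "D L + (\<Sum>k<L. D k *
      (\<Sum>a\<in>lab (Suc k) ` C. \<bar>sum p {c\<in>C. lab (Suc k) c = a} - sum u {c\<in>C. lab (Suc k) c = a}\<bar>)) \<le>
      3 * real CARD('d) * ((1 / 2) ^ L + (\<Sum>k<L. (1 / 2) ^ k * dyadic_discrepancy q v (Suc k)))" .
  qed
  finally show ?thesis .
qed

section \<open>Sample complexity of the multiscale tester\<close>

text \<open>Half of \<open>\<epsilon>\<close> is spent on the finest scale and the other half is
  shared equally by the \<open>L\<close> levels. Level \<open>k\<close> enters with weight
  \<open>2 / 2 ^ k\<close>, which turns the share \<open>\<epsilon> / (2 * D * L)\<close> into the
  bound with the 4. For \<open>L = 0\<close> the assumptions contradict each other.\<close>

lemma level_with_large_discrepancy: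
  fixes G :: "nat \<Rightarrow> real"
  assumes \<epsilon>: "0 < \<epsilon>" and D: "0 < D" "D * (1 / 2) ^ L \<le> \<epsilon> / 2"
    and le: "\<epsilon> \<le> D * ((1 / 2) ^ L + (\<Sum>k<L. (1 / 2) ^ k * G (Suc k)))"
  shows "\<exists>k\<in>{1..L}. \<epsilon> * 2 ^ k / (4 * D * real L) \<le> G k"
proof (rule ccontr)
  assume *: "\<not> ?thesis"
  have small: "G (Suc k) < \<epsilon> * 2 ^ Suc k / (4 * D * real L)" if "k < L" for k
  proof -
    have "Suc k \<in> {1..L}" using that by simp
    with * show ?thesis by (meson not_le)
  qed
  have "\<epsilon> \<le> \<epsilon> / 2 + D * (\<Sum>k<L. (1 / 2) ^ k * G (Suc k))"
    using le D by (simp add: distrib_left)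
  moreover have "D * (\<Sum>k<L. (1 / 2) ^ k * G (Suc k)) < \<epsilon> / 2"
  proof (cases "L = 0")
    case False
    have "(\<Sum>k<L. (1 / 2) ^ k * G (Suc k)) < (\<Sum>k<L. \<epsilon> / (2 * D * real L))"
    proof (rule sum_strict_mono)
      fix k assume "k \<in> {..<L}"
      then have "(1 / 2) ^ k * G (Suc k) < (1 / 2) ^ k * (\<epsilon> * 2 ^ Suc k / (4 * D * real L))"
        using small[of k] by (intro mult_strict_left_mono) auto
      then show "(1 / 2) ^ k * G (Suc k) < \<epsilon> / (2 * D * real L)"
        by (simp add: power_divide)
    qed (use False in auto)
    also have "\<dots> = \<epsilon> / 2 / D"
      using False by simp
    finally show ?thesis
      using D by (simp add: pos_less_divide_eq mult.commute)
  qed (use \<epsilon> in simp)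
  ultimately show False by linarith
qed

text \<open>The quotient is \<open>2 ^ k\<close> to the power \<open>d / 2 - 2\<close>. The sign of
  this exponent decides whether \<open>2 ^ k \<le> R\<close> or \<open>1 \<le> 2 ^ k\<close> is the
  relevant bound; the maximum treats both cases at once.\<close>

lemma dyadic_factor_le:
  fixes d k :: nat and R :: real
  assumes R: "2 ^ k \<le> R"
  shows "sqrt ((2 ^ k) ^ d) / 4 ^ k \<le> R powr max (real d / 2 - 2) 0"
proof -
  have x1: "1 \<le> (2::real) ^ k" by simp
  have "sqrt ((2 ^ k) ^ d) = (2 ^ k) powr (real d / 2)"
    by (simp add: powr_half_sqrt[symmetric] powr_powr flip: powr_realpow)
  moreover have "(4::real) ^ k = (2 ^ k) powr 2"
    by (simp add: powr_numeral power_mult[symmetric] mult.commute[of k] power_mult)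
  ultimately have "sqrt ((2 ^ k) ^ d) / 4 ^ k = (2 ^ k) powr (real d / 2 - 2)"
    by (simp add: powr_diff)
  also have "\<dots> \<le> (2 ^ k) powr max (real d / 2 - 2) 0"
    using x1 by (intro powr_mono) auto
  also have "\<dots> \<le> R powr max (real d / 2 - 2) 0"
    using R by (intro powr_mono2) auto
  finally show ?thesis .
qed

text \<open>Half the square of the discrepancy that some level must have; the half is the constant
  lost in \<open>chi_square_ge_L1\<close>.\<close>

definition level_threshold :: "real \<Rightarrow> nat \<Rightarrow> real \<Rightarrow> nat \<Rightarrow> real" where
  "level_threshold D L \<epsilon> k = (\<epsilon> * 2 ^ k / (4 * D * real L))\<^sup>2 / 2"

text \<open>1920 is 60 times the 32 in the denominator of the threshold. One power of
  \<open>L + 1\<close> is the confidence parameter of the union bound, two come from sharing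
  \<open>\<epsilon>\<close> among the levels. The exponent \<open>max (d / 2 - 2) 0\<close> grows by
  2 through the division by \<open>\<epsilon>\<^sup>2\<close>.\<close>

lemma sample_size_term_le:
  fixes d k L :: nat
  assumes \<epsilon>: "0 < \<epsilon>" and D: "1 \<le> D" and L: "2 ^ L \<le> 4 * D / \<epsilon>" and k: "1 \<le> k" "k \<le> L"
  shows "60 * real (L + 1) * sqrt (real ((2 ^ k) ^ d)) / level_threshold D L \<epsilon> k \<le>
    1920 * D\<^sup>2 * (4 * D) powr max (real d / 2 - 2) 0 * real (L + 1) ^ 3 * \<epsilon> powr (- max (real d / 2) 2)"
proof -
  define e where "e = max (real d / 2 - 2) 0"
  have L0: "0 < real L" using k by simp
  have "60 * real (L + 1) * sqrt (real ((2 ^ k) ^ d)) / level_threshold D L \<epsilon> k =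
    1920 * D\<^sup>2 * real (L + 1) * (real L)\<^sup>2 * (sqrt ((2 ^ k) ^ d) / 4 ^ k) / \<epsilon>\<^sup>2"
    unfolding level_threshold_def using \<epsilon> D L0
    by (simp add: power_divide power_mult_distrib field_simps power2_eq_square flip: power_mult_distrib)
  also have "\<dots> \<le> 1920 * D\<^sup>2 * real (L + 1) * (real (L + 1))\<^sup>2 * (4 * D / \<epsilon>) powr e / \<epsilon>\<^sup>2"
  proof (intro divide_right_mono mult_mono)
    have "(2::real) ^ k \<le> 2 ^ L" using k by simp
    also have "\<dots> \<le> 4 * D / \<epsilon>" by (rule L)
    finally show "sqrt ((2 ^ k) ^ d) / 4 ^ k \<le> (4 * D / \<epsilon>) powr e"
      unfolding e_def by (rule dyadic_factor_le)
  qed (use D in auto)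
  also have "\<dots> = 1920 * D\<^sup>2 * (4 * D) powr e * real (L + 1) ^ 3 * (\<epsilon> powr (- e) * \<epsilon> powr (- 2))"
    using \<epsilon> D by (simp add: powr_divide powr_minus powr_numeral power3_eq_cube power2_eq_square field_simps)
  also have "\<epsilon> powr (- e) * \<epsilon> powr (- 2) = \<epsilon> powr (- max (real d / 2) 2)"
    unfolding powr_add[symmetric] e_def by (intro arg_cong[where f = "\<lambda>x. \<epsilon> powr x"]) auto
  finally show ?thesis unfolding e_def .
qed

text \<open>For \<open>\<epsilon> < exp (- 1)\<close> both \<open>ln (1 / \<epsilon>)\<close> and
  \<open>\<epsilon> powr (- r)\<close> are at least 1, so the additive constants in the logarithm
  and the 2 left by rounding are absorbed into the product.\<close>

lemma soft_bigo_intro: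
  fixes n :: "real \<Rightarrow> nat" and r :: real
  assumes D: "1 \<le> D" and c: "0 \<le> c" and r: "0 \<le> r"
    and n: "\<And>\<epsilon>. 0 < \<epsilon> \<Longrightarrow> real (n \<epsilon>) \<le> c * real (nat \<lceil>log 2 (2 * D / \<epsilon>)\<rceil> + 1) ^ 4 * \<epsilon> powr (- r) + 2"
  shows "(\<lambda>\<epsilon>. real (n \<epsilon>)) \<in> soft_bigo (\<lambda>\<epsilon>. \<epsilon> powr (- r))"
proof -
  define b where "b = log 2 (2 * D) + 2 + 1 / ln 2"
  have b: "0 \<le> b" using D unfolding b_def by (intro add_nonneg_nonneg) auto
  have "(\<lambda>\<epsilon>. real (n \<epsilon>)) \<in> O[at_right 0](\<lambda>\<epsilon>. \<epsilon> powr (- r) * ln (1 / \<epsilon>) ^ 4)"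
  proof (rule bigoI[where c = "c * b ^ 4 + 2"])
    have "eventually (\<lambda>\<epsilon>::real. \<epsilon> \<in> {0<..<exp (- 1)}) (at_right 0)"
      by (rule eventually_at_right_real) simp
    then show "\<forall>\<^sub>F \<epsilon> in at_right 0. norm (real (n \<epsilon>)) \<le> (c * b ^ 4 + 2) * norm (\<epsilon> powr (- r) * ln (1 / \<epsilon>) ^ 4)"
    proof eventually_elim
      case (elim \<epsilon>)
      then have \<epsilon>: "0 < \<epsilon>" "\<epsilon> < exp (- 1)" by auto
      define l where "l = ln (1 / \<epsilon>)"
      have "ln \<epsilon> < ln (exp (- 1))" using \<epsilon> by (subst ln_less_cancel_iff) auto
      then have l: "1 \<le> l" using \<epsilon> by (simp add: l_def ln_div)
      have "\<epsilon> \<le> 1" using \<epsilon> less_trans[of \<epsilon> "exp (- 1)" 1] by simp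
      have p1: "1 \<le> \<epsilon> powr (- r)"
        using \<epsilon> \<open>\<epsilon> \<le> 1\<close> r by (simp add: powr_minus one_le_inverse_iff powr_le1)
      have lg: "log 2 (2 * D / \<epsilon>) = log 2 (2 * D) + l / ln 2"
        using \<epsilon> D by (simp add: log_def l_def ln_div ln_mult add_divide_distrib diff_divide_distrib)
      have lD: "0 \<le> log 2 (2 * D)" using D by simp
      have "real (nat \<lceil>log 2 (2 * D / \<epsilon>)\<rceil> + 1) \<le> log 2 (2 * D / \<epsilon>) + 2"
        unfolding lg using lD l by (simp add: of_nat_nat ceiling_correct) linarith
      also have "\<dots> = (log 2 (2 * D) + 2) * 1 + 1 / ln 2 * l"
        unfolding lg by simp
      also have "\<dots> \<le> (log 2 (2 * D) + 2) * l + 1 / ln 2 * l"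
        using lD l by (intro add_right_mono mult_left_mono) auto
      also have "\<dots> = b * l"
        by (simp add: b_def algebra_simps)
      finally have "real (nat \<lceil>log 2 (2 * D / \<epsilon>)\<rceil> + 1) \<le> b * l" .
      then have "real (nat \<lceil>log 2 (2 * D / \<epsilon>)\<rceil> + 1) ^ 4 \<le> (b * l) ^ 4"
        by (intro power_mono) auto
      then have "c * real (nat \<lceil>log 2 (2 * D / \<epsilon>)\<rceil> + 1) ^ 4 * \<epsilon> powr (- r) \<le> c * (b * l) ^ 4 * \<epsilon> powr (- r)"
        using c by (intro mult_right_mono mult_left_mono) auto
      moreover have "1 * 1 \<le> \<epsilon> powr (- r) * l ^ 4"
        using p1 l by (intro mult_mono one_le_power) auto
      ultimately have "real (n \<epsilon>) \<le> (c * b ^ 4 + 2) * (\<epsilon> powr (- r) * l ^ 4)"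
        using n[OF \<epsilon>(1)] by (simp add: algebra_simps power_mult_distrib)
      moreover have "0 \<le> \<epsilon> powr (- r) * l ^ 4" using l by simp
      ultimately show ?case unfolding l_def by simp
    qed
  qed
  then show ?thesis unfolding soft_bigo_def by blast
qed

lemma soft_bigo_tester:
  fixes X :: "(real ^ 'd) set"
  assumes X: "X \<subseteq> {x. \<forall>i. \<bar>x $ i\<bar> \<le> 1}" and U: "uniform_on X \<in> distributions_on X"
  shows "\<exists>(n :: real \<Rightarrow> nat) (A :: real \<Rightarrow> (nat \<Rightarrow> real ^ 'd) \<Rightarrow> bool measure).
        (\<lambda>\<epsilon>. real (n \<epsilon>)) \<in> soft_bigo (\<lambda>\<epsilon>. \<epsilon> powr (- max (real CARD('d) / 2) 2)) \<and>
        (\<forall>\<epsilon>>0. uniformity_tester X \<epsilon> (n \<epsilon>) (A \<epsilon>))"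
proof -
  define D where "D = 3 * real CARD('d)"
  have D: "1 \<le> D" using zero_less_card_finite[where 'a = 'd] unfolding D_def by linarith
  define L where "L \<epsilon> = nat \<lceil>log 2 (2 * D / \<epsilon>)\<rceil>" for \<epsilon> :: real
  define N where "N k = real ((2 ^ k) ^ CARD('d))" for k :: nat
  \<comment> \<open>The sum over the levels exceeds every single requirement and costs only one more
    logarithm than the maximum. For \<open>L \<epsilon> = 0\<close> it is empty: no samples are
    drawn, and no distribution is that far from uniform.\<close>
  define m where "m \<epsilon> = nat \<lceil>\<Sum>k\<in>{1..L \<epsilon>}. 60 * real (L \<epsilon> + 1) * sqrt (N k) / level_threshold D (L \<epsilon>) \<epsilon> k\<rceil>" for \<epsilon>
  define c where "c = 1920 * D\<^sup>2 * (4 * D) powr max (real CARD('d) / 2 - 2) 0"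
  have c0: "0 \<le> c" by (simp add: c_def)
  have L_upper: "2 ^ L \<epsilon> \<le> 4 * D / \<epsilon>" if \<epsilon>: "0 < \<epsilon>" "L \<epsilon> \<noteq> 0" for \<epsilon>
  proof -
    have "real (L \<epsilon>) \<le> log 2 (2 * D / \<epsilon>) + 1"
      using \<epsilon>(2) unfolding L_def by linarith
    then have "2 powr real (L \<epsilon>) \<le> 2 powr (log 2 (2 * D / \<epsilon>) + 1)"
      by (intro powr_mono) auto
    also have "\<dots> = 4 * D / \<epsilon>"
      using \<epsilon> D by (simp add: powr_add)
    finally show ?thesis by (simp add: powr_realpow)
  qed
  have L_lower: "D * (1 / 2) ^ L \<epsilon> \<le> \<epsilon> / 2" if \<epsilon>: "0 < \<epsilon>" for \<epsilon>
  proof -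
    have "2 * D / \<epsilon> = 2 powr (log 2 (2 * D / \<epsilon>))"
      using \<epsilon> D by simp
    also have "\<dots> \<le> 2 powr real (L \<epsilon>)"
      unfolding L_def by (intro powr_mono) linarith+
    finally have "2 * D / \<epsilon> \<le> 2 ^ L \<epsilon>"
      by (simp add: powr_realpow)
    then show ?thesis
      using \<epsilon> by (simp add: field_simps power_divide)
  qed
  \<comment> \<open>The bound 1 is the requirement \<open>\<theta> \<le> 1\<close> of the test. It
    holds because rounding up in \<open>L\<close> costs at most a factor 2, so that
    \<open>\<epsilon> * 2 ^ L \<epsilon>\<close> is at most \<open>4 * D\<close>.\<close>
  have thr: "0 < level_threshold D (L \<epsilon>) \<epsilon> k" "level_threshold D (L \<epsilon>) \<epsilon> k \<le> 1"
    if \<epsilon>: "0 < \<epsilon>" and k: "k \<in> {1..L \<epsilon>}" for \<epsilon> k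
  proof -
    define y where "y = \<epsilon> * 2 ^ k / (4 * D * real (L \<epsilon>))"
    have L0: "1 \<le> real (L \<epsilon>)" using k by auto
    have y0: "0 < y" unfolding y_def using \<epsilon> D L0 by simp
    have "\<epsilon> * 2 ^ k \<le> \<epsilon> * 2 ^ L \<epsilon>" using k \<epsilon> by simp
    also have "\<dots> \<le> 4 * D * 1" using L_upper[OF \<epsilon>] k \<epsilon> by (simp add: field_simps)
    also have "\<dots> \<le> 4 * D * real (L \<epsilon>)" using L0 D by (intro mult_left_mono) auto
    finally have "y \<le> 1" unfolding y_def using D L0 by (simp add: divide_le_eq_1)
    then have "y\<^sup>2 \<le> 1" using y0 by (intro power_le_one) auto
    then show "0 < level_threshold D (L \<epsilon>) \<epsilon> k" "level_threshold D (L \<epsilon>) \<epsilon> k \<le> 1"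
      using y0 unfolding level_threshold_def y_def[symmetric] by auto
  qed
  have "\<exists>A :: (nat \<Rightarrow> real ^ 'd) \<Rightarrow> bool measure. uniformity_tester X \<epsilon> (2 * m \<epsilon>) A" if \<epsilon>: "0 < \<epsilon>" for \<epsilon>
  proof (rule uniformity_tester_multiscale[where K = "{1..L \<epsilon>}" and B = "60 * real (L \<epsilon> + 1)"
        and C = "\<lambda>k. int_grid (2 ^ k)" and E = "\<lambda>k c. {x. dyadic_cell k x = c}"
        and w = "\<lambda>k c. measure (uniform_on X) {x. dyadic_cell k x = c} + 1 / N k"
        and \<theta> = "level_threshold D (L \<epsilon>) \<epsilon>", OF U])
    interpret U: prob_space "uniform_on X" using U by (simp add: distributions_on_def)
    \<comment> \<open>A confidence parameter linear in the number of levels makes each false alarm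
      probability quadratically small, so their sum stays bounded.\<close>
    show "real (card {1..L \<epsilon>}) * (4 / (60 * real (L \<epsilon> + 1))\<^sup>2) \<le> 1 / 3"
    proof -
      define Z where "Z = (real (L \<epsilon> + 1))\<^sup>2"
      have Z: "real (L \<epsilon>) \<le> Z"
        by (simp add: Z_def power2_eq_square algebra_simps)
      have "0 < Z"
        unfolding Z_def by (intro zero_less_power) simp
      have "(60 * real (L \<epsilon> + 1))\<^sup>2 = 3600 * Z"
        by (simp only: power_mult_distrib Z_def) simp
      then show ?thesis
        using Z \<open>0 < Z\<close> by (simp add: field_simps)
    qed
    show "{x. dyadic_cell k x = c} \<in> sets borel" for k c
      by (rule dyadic_cell_sets)
    show "cell_test (int_grid (2 ^ k)) (\<lambda>c. {x. dyadic_cell k x = c})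
        (\<lambda>c. measure (uniform_on X) {x. dyadic_cell k x = c})
        (\<lambda>c. measure (uniform_on X) {x. dyadic_cell k x = c} + 1 / N k)
        (m \<epsilon>) (level_threshold D (L \<epsilon>) \<epsilon> k) (60 * real (L \<epsilon> + 1))" if k: "k \<in> {1..L \<epsilon>}" for k
    proof
      show "int_grid (2 ^ k) \<noteq> ({} :: (int ^ 'd) set)"
        using dyadic_cell_in_grid by blast
      show "60 * real (L \<epsilon> + 1) * sqrt (real (card (int_grid (2 ^ k) :: (int ^ 'd) set)))
          \<le> real (m \<epsilon>) * level_threshold D (L \<epsilon>) \<epsilon> k"
      proof -
        have "60 * real (L \<epsilon> + 1) * sqrt (N k) / level_threshold D (L \<epsilon>) \<epsilon> k \<le>
            (\<Sum>k\<in>{1..L \<epsilon>}. 60 * real (L \<epsilon> + 1) * sqrt (N k) / level_threshold D (L \<epsilon>) \<epsilon> k)"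
          using k thr[OF \<epsilon>] by (intro member_le_sum) (auto simp: N_def intro!: divide_nonneg_pos)
        also have "\<dots> \<le> real (m \<epsilon>)"
          unfolding m_def by linarith
        finally show ?thesis
          using thr[OF \<epsilon> k] by (simp add: card_int_grid N_def pos_divide_le_eq)
      qed
    qed (use thr[OF \<epsilon> k] in \<open>auto simp: finite_int_grid disjoint_family_on_def card_int_grid N_def\<close>)
    show "\<exists>k\<in>{1..L \<epsilon>}. level_threshold D (L \<epsilon>) \<epsilon> k \<le> (\<Sum>c\<in>int_grid (2 ^ k).
        (measure q {x. dyadic_cell k x = c} - measure (uniform_on X) {x. dyadic_cell k x = c})\<^sup>2 /
        (measure (uniform_on X) {x. dyadic_cell k x = c} + 1 / N k))"
      if q: "q \<in> distributions_on X" and far: "far_from X \<epsilon> (uniform_on X) q" for q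
    proof -
      have "ennreal \<epsilon> \<le> wasserstein X (uniform_on X) q"
        using far by (simp add: far_from_def)
      also have "\<dots> \<le> ennreal (D * ((1 / 2) ^ L \<epsilon> + (\<Sum>k<L \<epsilon>. (1 / 2) ^ k * dyadic_discrepancy (uniform_on X) q (Suc k))))"
        unfolding D_def by (rule wasserstein_le_dyadic[OF U q X])
      finally have "\<epsilon> \<le> D * ((1 / 2) ^ L \<epsilon> + (\<Sum>k<L \<epsilon>. (1 / 2) ^ k * dyadic_discrepancy (uniform_on X) q (Suc k)))"
        using D by (subst (asm) ennreal_le_iff)
          (auto intro!: mult_nonneg_nonneg add_nonneg_nonneg sum_nonneg simp: dyadic_discrepancy_def)
      from level_with_large_discrepancy[OF \<epsilon> _ L_lower[OF \<epsilon>] this] D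
      obtain k where k: "k \<in> {1..L \<epsilon>}"
        and large: "\<epsilon> * 2 ^ k / (4 * D * real (L \<epsilon>)) \<le> dyadic_discrepancy (uniform_on X) q k" by auto
      define w where "w c = measure (uniform_on X) {x. dyadic_cell k x = c} + 1 / N k" for c
      \<comment> \<open>Together with the added terms \<open>1 / N k\<close>, which sum to 1 over
        the grid, the weights have total at most 2, as \<open>chi_square_ge_L1\<close>
        demands.\<close>
      have sum_u: "(\<Sum>c\<in>int_grid (2 ^ k). measure (uniform_on X) {x. dyadic_cell k x = c}) \<le> 1"
      proof -
        have "U.prob (\<Union>c\<in>int_grid (2 ^ k). {x. dyadic_cell k x = c}) =
          (\<Sum>c\<in>int_grid (2 ^ k). measure (uniform_on X) {x. dyadic_cell k x = c})"
          by (rule U.finite_measure_finite_Union)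
            (auto simp: finite_int_grid disjoint_family_on_def dyadic_cell_sets)
        then show ?thesis using U.prob_le_1 by metis
      qed
      have "level_threshold D (L \<epsilon>) \<epsilon> k \<le> (dyadic_discrepancy (uniform_on X) q k)\<^sup>2 / 2"
        unfolding level_threshold_def using large \<epsilon> D by (intro divide_right_mono power_mono) auto
      also have "dyadic_discrepancy (uniform_on X) q k = (\<Sum>c\<in>int_grid (2 ^ k).
          \<bar>measure q {x. dyadic_cell k x = c} - measure (uniform_on X) {x. dyadic_cell k x = c}\<bar>)"
        unfolding dyadic_discrepancy_def by (intro sum.cong refl) simp
      also have "(\<dots>)\<^sup>2 / 2 \<le> (\<Sum>c\<in>int_grid (2 ^ k).
        (measure q {x. dyadic_cell k x = c} - measure (uniform_on X) {x. dyadic_cell k x = c})\<^sup>2 / w c)"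
        using chi_square_ge_L1[of "int_grid (2 ^ k)" w "\<lambda>c. measure q {x. dyadic_cell k x = c}"
            "\<lambda>c. measure (uniform_on X) {x. dyadic_cell k x = c}"] sum_u
        by (simp add: finite_int_grid w_def sum.distrib card_int_grid N_def add_nonneg_pos)
      finally show ?thesis using k unfolding w_def by blast
    qed
  qed simp_all
  then obtain A :: "real \<Rightarrow> (nat \<Rightarrow> real ^ 'd) \<Rightarrow> bool measure"
    where A: "\<And>\<epsilon>. 0 < \<epsilon> \<Longrightarrow> uniformity_tester X \<epsilon> (2 * m \<epsilon>) (A \<epsilon>)" by metis
  have "(\<lambda>\<epsilon>. real (2 * m \<epsilon>)) \<in> soft_bigo (\<lambda>\<epsilon>. \<epsilon> powr (- max (real CARD('d) / 2) 2))"
  proof (rule soft_bigo_intro[OF D])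
    show "real (2 * m \<epsilon>) \<le> (2 * c) * real (nat \<lceil>log 2 (2 * D / \<epsilon>)\<rceil> + 1) ^ 4 * \<epsilon> powr (- max (real CARD('d) / 2) 2) + 2"
      if \<epsilon>: "0 < \<epsilon>" for \<epsilon>
    proof -
      define z where "z = c * real (L \<epsilon> + 1) ^ 3 * \<epsilon> powr (- max (real CARD('d) / 2) 2)"
      have z: "0 \<le> z" using c0 by (simp add: z_def)
      have "(\<Sum>k\<in>{1..L \<epsilon>}. 60 * real (L \<epsilon> + 1) * sqrt (N k) / level_threshold D (L \<epsilon>) \<epsilon> k) \<le> (\<Sum>k\<in>{1..L \<epsilon>}. z)"
        unfolding N_def z_def c_def
        by (intro sum_mono sample_size_term_le[OF \<epsilon> D]) (use L_upper[OF \<epsilon>] in auto)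
      also have "\<dots> \<le> real (L \<epsilon> + 1) * z"
        using z by (simp add: mult_right_mono)
      finally have "real (m \<epsilon>) \<le> real (L \<epsilon> + 1) * z + 1"
        using mult_nonneg_nonneg[OF of_nat_0_le_iff z, of "L \<epsilon> + 1"] unfolding m_def by linarith
      then show ?thesis
        unfolding z_def L_def[symmetric] by (simp add: power3_eq_cube power4_eq_xxxx algebra_simps)
    qed
  qed (use c0 in auto)
  then show ?thesis
    using A by (intro exI[of _ "\<lambda>\<epsilon>. 2 * m \<epsilon>"] exI[of _ A] conjI allI impI)
qed

section \<open>The uniform distributions on the cube and the ball\<close>

lemma uniform_on_distribution:
  assumes "X \<in> sets borel" "emeasure lborel X \<noteq> 0" "emeasure lborel X \<noteq> \<infinity>"
  shows "uniform_on X \<in> distributions_on X"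
  using assms prob_space_uniform_measure[OF assms(2,3)]
  by (auto simp: distributions_on_def less_top intro!: ennreal_divide_self)

lemma unit_cube_eq_cbox: "unit_cube = cbox 0 1"
  by (auto simp: mem_box_cart)

lemma measure_box_cart:
  fixes a b :: "real ^ 'd"
  assumes "\<And>i. a $ i \<le> b $ i"
  shows "measure lborel (cbox a b) = (\<Prod>i\<in>UNIV. b $ i - a $ i)"
    and "measure lborel (box a b) = (\<Prod>i\<in>UNIV. b $ i - a $ i)"
proof -
  have "cbox a b \<noteq> {}" using assms by (simp add: interval_ne_empty_cart)
  then show cb: "measure lborel (cbox a b) = (\<Prod>i\<in>UNIV. b $ i - a $ i)"
    by (rule content_cbox_cart)
  have "measure lborel (box a b) = measure lborel (cbox a b)"
    unfolding measure_def emeasure_lborel_box_eq emeasure_lborel_cbox_eq ..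
  with cb show "measure lborel (box a b) = (\<Prod>i\<in>UNIV. b $ i - a $ i)" by simp
qed

lemma emeasure_unit_cube: "emeasure lborel (unit_cube :: (real ^ 'd) set) = 1"
proof -
  have "emeasure lborel (cbox 0 1 :: (real ^ 'd) set) = ennreal (measure lborel (cbox 0 1 :: (real ^ 'd) set))"
    using emeasure_lborel_cbox_finite[of "0 :: real ^ 'd" 1] by (intro emeasure_eq_ennreal_measure) auto
  then show ?thesis
    unfolding unit_cube_eq_cbox by (simp add: measure_box_cart(1))
qed

lemma uniform_on_unit_cube: "uniform_on (unit_cube :: (real ^ 'd) set) \<in> distributions_on unit_cube"
  by (rule uniform_on_distribution) (simp_all only: emeasure_unit_cube, simp_all add: unit_cube_eq_cbox)

lemma uniform_on_unit_ball: "uniform_on (unit_ball :: (real ^ 'd) set) \<in> distributions_on unit_ball"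
proof (rule uniform_on_distribution)
  show "emeasure lborel (unit_ball :: (real ^ 'd) set) \<noteq> 0"
    using content_cball_pos[of 1 "0 :: real ^ 'd"] by (auto simp: measure_def)
  show "emeasure lborel (unit_ball :: (real ^ 'd) set) \<noteq> \<infinity>"
    using emeasure_lborel_cball_finite[of "0 :: real ^ 'd" 1] by auto
qed simp

lemma measure_uniform_on_unit_cube:
  assumes "A \<in> sets borel" "A \<subseteq> (unit_cube :: (real ^ 'd) set)"
  shows "measure (uniform_on unit_cube) A = measure lborel A"
  using assms by (simp add: emeasure_unit_cube[unfolded unit_cube_eq_cbox] Int_absorb1 measure_def unit_cube_eq_cbox divide_ennreal_def)

section \<open>Tools for the lower bound: product densities, test functions, random signs\<close>

lemma PiM_density:
  fixes f :: "'a \<Rightarrow> ennreal"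
  assumes U: "prob_space U" and D: "prob_space (density U f)" and f: "f \<in> borel_measurable U" and I: "finite I"
  shows "(\<Pi>\<^sub>M i\<in>I. density U f) = density (\<Pi>\<^sub>M i\<in>I. U) (\<lambda>x. \<Prod>i\<in>I. f (x i))"
proof -
  interpret U0: prob_space U by fact
  interpret D0: prob_space "density U f" by fact
  interpret U: product_prob_space "\<lambda>_. U" I ..
  interpret D: product_prob_space "\<lambda>_. density U f" I ..
  show ?thesis
  proof (rule sym, rule D.PiM_eqI[OF I])
    show "sets (density (\<Pi>\<^sub>M i\<in>I. U) (\<lambda>x. \<Prod>i\<in>I. f (x i))) = sets (\<Pi>\<^sub>M i\<in>I. density U f)"
      unfolding sets_density by (intro sets_PiM_cong) auto
  next
    fix A assume "\<And>i. i \<in> I \<Longrightarrow> A i \<in> sets (density U f)"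
    then have A: "A i \<in> sets U" if "i \<in> I" for i using that by simp
    have PE: "Pi\<^sub>E I A \<in> sets (\<Pi>\<^sub>M i\<in>I. U)"
      using A I by (intro sets_PiM_I_finite) auto
    have meas: "(\<lambda>x. \<Prod>i\<in>I. f (x i)) \<in> borel_measurable (\<Pi>\<^sub>M i\<in>I. U)"
      using f by measurable
    have "emeasure (density (\<Pi>\<^sub>M i\<in>I. U) (\<lambda>x. \<Prod>i\<in>I. f (x i))) (Pi\<^sub>E I A) =
      (\<integral>\<^sup>+x. (\<Prod>i\<in>I. f (x i)) * indicator (Pi\<^sub>E I A) x \<partial>(\<Pi>\<^sub>M i\<in>I. U))"
      by (rule emeasure_density[OF meas PE])
    also have "\<dots> = (\<integral>\<^sup>+x. (\<Prod>i\<in>I. f (x i) * indicator (A i) (x i)) \<partial>(\<Pi>\<^sub>M i\<in>I. U))"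
    proof (rule nn_integral_cong)
      fix x assume "x \<in> space (\<Pi>\<^sub>M i\<in>I. U)"
      then have "indicator (Pi\<^sub>E I A) x = (\<Prod>i\<in>I. indicator (A i) (x i) :: ennreal)"
        using I by (auto simp: indicator_def space_PiM PiE_def Pi_def prod_zero_iff)
      then show "(\<Prod>i\<in>I. f (x i)) * indicator (Pi\<^sub>E I A) x = (\<Prod>i\<in>I. f (x i) * indicator (A i) (x i))"
        by (simp add: prod.distrib)
    qed
    also have "\<dots> = (\<Prod>i\<in>I. \<integral>\<^sup>+x. f x * indicator (A i) x \<partial>U)"
      using f A by (intro U.product_nn_integral_prod[OF I] borel_measurable_times_ennreal borel_measurable_indicator) auto
    also have "\<dots> = (\<Prod>i\<in>I. emeasure (density U f) (A i))"
      using A f by (intro prod.cong refl) (simp add: emeasure_density)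
    finally show "emeasure (density (\<Pi>\<^sub>M i\<in>I. U) (\<lambda>x. \<Prod>i\<in>I. f (x i))) (Pi\<^sub>E I A) =
      (\<Prod>i\<in>I. emeasure (density U f) (A i))" .
  qed
qed

text \<open>The easy half of Kantorovich-Rubinstein duality: under any coupling the difference of
  the means is the integral of \<open>h y - h x\<close>. Its positive part is nonnegative and can be
  compared with the cost in \<open>ennreal\<close>.\<close>

lemma wasserstein_ge_Lipschitz:
  fixes p q :: "(real ^ 'd) measure" and h :: "real ^ 'd \<Rightarrow> real"
  assumes h[measurable]: "h \<in> borel_measurable borel" and bd: "\<And>x. \<bar>h x\<bar> \<le> B"
    and lip: "\<And>x y. \<bar>h x - h y\<bar> \<le> norm (x - y)"
  shows "ennreal ((\<integral>x. h x \<partial>q) - (\<integral>x. h x \<partial>p)) \<le> wasserstein X p q"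
  unfolding wasserstein_def
proof (rule INF_greatest)
  fix M assume "M \<in> coup X p q"
  then have M: "prob_space M" "sets M = sets borel" "distr M borel fst = p" "distr M borel snd = q"
    by (auto simp: coup_def distributions_on_def)
  interpret M: prob_space M by fact
  have proj[measurable]: "fst \<in> M \<rightarrow>\<^sub>M borel" "snd \<in> M \<rightarrow>\<^sub>M borel"
    unfolding measurable_cong_sets[OF M(2) refl] borel_prod[symmetric] by simp_all
  have int: "integrable M (\<lambda>z. h (snd z))" "integrable M (\<lambda>z. h (fst z))"
    by (rule M.integrable_bounded[where B = B]; use bd in measurable)+
  have "(\<integral>x. h x \<partial>q) - (\<integral>x. h x \<partial>p) = (\<integral>z. h (snd z) \<partial>M) - (\<integral>z. h (fst z) \<partial>M)"
    unfolding M(3,4)[symmetric] by (simp add: integral_distr)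
  also have "\<dots> = (\<integral>z. h (snd z) - h (fst z) \<partial>M)"
    using int by simp
  also have "\<dots> \<le> (\<integral>z. max 0 (h (snd z) - h (fst z)) \<partial>M)"
    using int by (intro integral_mono) auto
  finally have "ennreal ((\<integral>x. h x \<partial>q) - (\<integral>x. h x \<partial>p)) \<le> ennreal (\<integral>z. max 0 (h (snd z) - h (fst z)) \<partial>M)"
    by (rule ennreal_leI)
  also have "\<dots> = (\<integral>\<^sup>+z. ennreal (max 0 (h (snd z) - h (fst z))) \<partial>M)"
    using int by (intro nn_integral_eq_integral[symmetric]) auto
  also have "\<dots> \<le> (\<integral>\<^sup>+ (x, y). ennreal (norm (x - y)) \<partial>M)"
  proof (rule nn_integral_mono)
    fix z
    show "ennreal (max 0 (h (snd z) - h (fst z))) \<le> (case z of (x, y) \<Rightarrow> ennreal (norm (x - y)))"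
      using lip[of "fst z" "snd z"] by (cases z) (auto intro!: ennreal_leI)
  qed
  finally show "ennreal ((\<integral>x. h x \<partial>q) - (\<integral>x. h x \<partial>p)) \<le> (\<integral>\<^sup>+ (x, y). ennreal (norm (x - y)) \<partial>M)" .
qed

text \<open>This is \<open>cosh t \<le> exp (t\<^sup>2 / 2)\<close>, the moment generating function
  of a fair sign: Hoeffding's lemma with probability 1/2 and length \<open>2 * t\<close>.\<close>

lemma cosh_bound:
  fixes t :: real
  assumes "0 \<le> t"
  shows "exp t + exp (- t) \<le> 2 * exp (t\<^sup>2 / 2)"
proof -
  have "- (2 * t) * (1 / 2) + ln (1 + 1 / 2 * (exp (2 * t) - 1)) \<le> (2 * t)\<^sup>2 / 8"
    using assms by (intro Hoeffdings_lemma_aux) auto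
  then have "ln (1 + 1 / 2 * (exp (2 * t) - 1)) \<le> t + t\<^sup>2 / 2"
    by (simp add: power2_eq_square)
  moreover have pos: "0 < 1 + 1 / 2 * (exp (2 * t) - 1)"
    by (simp add: add_pos_nonneg add_pos_pos diff_divide_distrib)
  ultimately have "exp (ln (1 + 1 / 2 * (exp (2 * t) - 1))) \<le> exp (t + t\<^sup>2 / 2)"
    by (simp only: exp_le_cancel_iff)
  then have "1 + 1 / 2 * (exp (2 * t) - 1) \<le> exp (t + t\<^sup>2 / 2)"
    unfolding exp_ln[OF pos] .
  then have "(exp (2 * t) + 1) * exp (- t) \<le> 2 * exp (t + t\<^sup>2 / 2) * exp (- t)"
    by (intro mult_right_mono) (simp_all add: algebra_simps)
  then show ?thesis
    by (simp add: exp_add[symmetric] algebra_simps flip: exp_add)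
qed

text \<open>Up to normalization, the left-hand side is the second moment, under the uniform distribution, of the
  likelihood ratio of the mixture over random signs.\<close>

lemma sign_average_le:
  fixes N n :: nat and \<delta> :: real
  assumes N: "1 \<le> N" and \<delta>: "0 \<le> \<delta>" "\<delta> \<le> 1"
  defines "Z \<equiv> {..<N} \<rightarrow>\<^sub>E {-1, 1 :: real}"
  shows "(\<Sum>z\<in>Z. \<Sum>z'\<in>Z. (1 + \<delta>\<^sup>2 / N * (\<Sum>a<N. z a * z' a)) ^ n) \<le>
    (real (card Z))\<^sup>2 * exp ((real n)\<^sup>2 * \<delta> ^ 4 / (2 * real N))"
proof -
  \<comment> \<open>From \<open>1 + y \<le> exp y\<close>, the \<open>n\<close>-th power is at most
    a product over the pairs of the factors \<open>exp (t * (z a * z' a))\<close>.\<close>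
  define t where "t = real n * \<delta>\<^sup>2 / real N"
  have t: "0 \<le> t" using \<delta> by (simp add: t_def)
  have cardZ: "real (card Z) = 2 ^ N"
    unfolding Z_def by (simp add: card_funcsetE)
  have sgn: "z a = 1 \<or> z a = - 1" if "z \<in> Z" "a < N" for z a
    using that by (auto simp: Z_def)
  have abs1: "\<bar>\<delta>\<^sup>2 / N * (\<Sum>a<N. z a * z' a)\<bar> \<le> 1" if "z \<in> Z" "z' \<in> Z" for z z'
  proof -
    have "\<bar>\<Sum>a<N. z a * z' a\<bar> \<le> (\<Sum>a<N. \<bar>z a * z' a\<bar>)" by (rule sum_abs)
    also have "\<dots> = (\<Sum>a<N. 1)"
    proof (rule sum.cong[OF refl])
      fix a assume "a \<in> {..<N}"
      then show "\<bar>z a * z' a\<bar> = 1"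
        using sgn[OF that(1), of a] sgn[OF that(2), of a] by auto
    qed
    finally have "\<bar>\<Sum>a<N. z a * z' a\<bar> \<le> real N" by simp
    moreover have "\<delta>\<^sup>2 \<le> 1" using \<delta> by (simp add: power_le_one)
    ultimately have "\<delta>\<^sup>2 * \<bar>\<Sum>a<N. z a * z' a\<bar> \<le> 1 * real N"
      by (intro mult_mono) auto
    then show ?thesis using N by (simp add: abs_mult divide_le_eq)
  qed
  have inner: "(\<Sum>z\<in>Z. (1 + \<delta>\<^sup>2 / N * (\<Sum>a<N. z a * z' a)) ^ n) \<le> (2 * exp (t\<^sup>2 / 2)) ^ N"
    if z': "z' \<in> Z" for z'
  proof -
    have "(\<Sum>z\<in>Z. (1 + \<delta>\<^sup>2 / N * (\<Sum>a<N. z a * z' a)) ^ n) \<le> (\<Sum>z\<in>Z. \<Prod>a<N. exp (t * (z a * z' a)))"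
    proof (rule sum_mono)
      fix z assume z: "z \<in> Z"
      let ?y = "\<delta>\<^sup>2 / N * (\<Sum>a<N. z a * z' a)"
      \<comment> \<open>Raising to the power \<open>n\<close> requires \<open>1 + ?y\<close> to be
        nonnegative, which is where \<open>\<delta> \<le> 1\<close> enters.\<close>
      have "(1 + ?y) ^ n \<le> exp ?y ^ n"
      proof (rule power_mono)
        show "1 + ?y \<le> exp ?y" by (rule exp_ge_add_one_self)
        show "0 \<le> 1 + ?y" using abs1[OF z z'] by linarith
      qed
      also have "\<dots> = exp (\<Sum>a<N. t * (z a * z' a))"
        unfolding sum_distrib_left[symmetric] by (simp add: t_def exp_of_nat_mult[symmetric])
      also have "\<dots> = (\<Prod>a<N. exp (t * (z a * z' a)))"
        by (rule exp_sum) simp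
      finally show "(1 + ?y) ^ n \<le> (\<Prod>a<N. exp (t * (z a * z' a)))" .
    qed
    also have "\<dots> = (\<Prod>a<N. \<Sum>s\<in>{-1, 1}. exp (t * (s * z' a)))"
      unfolding Z_def by (rule prod_sum_PiE[symmetric]) auto
    \<comment> \<open>Multiplication by the fixed sign \<open>z' a\<close> only permutes the two
      values of \<open>s\<close>.\<close>
    also have "\<dots> = (\<Prod>a<N. exp t + exp (- t))"
    proof (rule prod.cong[OF refl])
      fix a assume "a \<in> {..<N}"
      then show "(\<Sum>s\<in>{-1, 1}. exp (t * (s * z' a))) = exp t + exp (- t)"
        using sgn[OF z', of a] by auto
    qed
    also have "\<dots> \<le> (2 * exp (t\<^sup>2 / 2)) ^ N"
      unfolding prod_constant card_lessThan using cosh_bound[OF t]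
      by (intro power_mono add_nonneg_nonneg) auto
    finally show ?thesis .
  qed
  have "(\<Sum>z\<in>Z. \<Sum>z'\<in>Z. (1 + \<delta>\<^sup>2 / N * (\<Sum>a<N. z a * z' a)) ^ n) =
      (\<Sum>z'\<in>Z. \<Sum>z\<in>Z. (1 + \<delta>\<^sup>2 / N * (\<Sum>a<N. z a * z' a)) ^ n)"
    by (rule sum.swap)
  also have "\<dots> \<le> real (card Z) * (2 * exp (t\<^sup>2 / 2)) ^ N"
    using inner by (rule sum_bounded_above)
  also have "\<dots> = (real (card Z))\<^sup>2 * exp (real N * (t\<^sup>2 / 2))"
    unfolding exp_of_nat_mult by (simp add: cardZ power_mult_distrib power2_eq_square)
  also have "real N * (t\<^sup>2 / 2) = (real n)\<^sup>2 * \<delta> ^ 4 / (2 * real N)"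
    using N by (simp add: t_def power2_eq_square power4_eq_xxxx field_simps)
  finally show ?thesis .
qed

section \<open>Randomly perturbed grids\<close>

definition dist_to_int :: "real \<Rightarrow> real" where
  "dist_to_int t = min (frac t) (1 - frac t)"

lemma dist_to_int_bounds: "0 \<le> dist_to_int t" "dist_to_int t \<le> 1"
  using frac_ge_0[of t] frac_lt_1[of t] by (auto simp: dist_to_int_def)

lemma dist_to_int_Lipschitz:
  assumes "\<lfloor>s\<rfloor> = \<lfloor>t\<rfloor>"
  shows "dist_to_int s \<le> dist_to_int t + \<bar>s - t\<bar>"
  using assms unfolding dist_to_int_def frac_def min_def by auto

text \<open>An integer separates \<open>s\<close> and \<open>t\<close>, and the stretches on its two
  sides are at least the distances to the nearest integer.\<close>

lemma dist_to_int_add_le: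
  assumes "\<lfloor>s\<rfloor> \<noteq> \<lfloor>t\<rfloor>"
  shows "dist_to_int s + dist_to_int t \<le> \<bar>s - t\<bar>"
proof -
  have *: "dist_to_int s + dist_to_int t \<le> \<bar>s - t\<bar>" if "\<lfloor>s\<rfloor> < \<lfloor>t\<rfloor>" for s t
  proof -
    have "real_of_int \<lfloor>s\<rfloor> + 1 \<le> real_of_int \<lfloor>t\<rfloor>" using that by linarith
    moreover have "dist_to_int s \<le> 1 - (s - real_of_int \<lfloor>s\<rfloor>)" "dist_to_int t \<le> t - real_of_int \<lfloor>t\<rfloor>"
      by (auto simp: dist_to_int_def frac_def)
    ultimately show ?thesis by linarith
  qed
  show ?thesis
    using assms *[of s t] *[of t s] by (cases "\<lfloor>s\<rfloor> < \<lfloor>t\<rfloor>") (auto simp: abs_minus_commute add.commute)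
qed

text \<open>The \<open>M ^ d\<close> cells of the grid are paired up by the bijection \<open>e\<close>; a sign vector \<open>z\<close> moves mass
  between the two cells of each pair.\<close>

locale signed_grid =
  fixes M N :: nat and e :: "int ^ 'd \<Rightarrow> nat \<times> bool" and \<delta> :: real
  assumes M: "0 < M" and e: "bij_betw e (int_grid M) ({..<N} \<times> UNIV)" and \<delta>: "0 < \<delta>" "\<delta> \<le> 1"
begin

definition cell :: "real ^ 'd \<Rightarrow> int ^ 'd" where
  "cell x = (\<chi> i. \<lfloor>real M * x $ i\<rfloor>)"

text \<open>Half-open cells leave the upper faces of the cube outside \<open>int_grid M\<close>. The
  value 0 there, as off the cube, makes functions of the cell finite sums over the grid.\<close>

definition \<sigma> :: "(nat \<Rightarrow> real) \<Rightarrow> int ^ 'd \<Rightarrow> real" where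
  "\<sigma> z j = (if j \<in> int_grid M then if snd (e j) then z (fst (e j)) else - z (fst (e j)) else 0)"

definition Z :: "(nat \<Rightarrow> real) set" where
  "Z = {..<N} \<rightarrow>\<^sub>E {-1, 1}"

abbreviation U :: "(real ^ 'd) measure" where
  "U \<equiv> uniform_on unit_cube"

definition f :: "(nat \<Rightarrow> real) \<Rightarrow> real ^ 'd \<Rightarrow> real" where
  "f z x = 1 + \<delta> * \<sigma> z (cell x)"

definition perturbed :: "(nat \<Rightarrow> real) \<Rightarrow> (real ^ 'd) measure" where
  "perturbed z = density U (\<lambda>x. ennreal (f z x))"

text \<open>The Euclidean distance from \<open>x\<close> to the nearest wall, the walls being the
  hyperplanes on which some \<open>real M * x $ i\<close> is an integer.\<close>

definition margin :: "real ^ 'd \<Rightarrow> real" where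
  "margin x = Min (range (\<lambda>i. dist_to_int (real M * x $ i))) / real M"

lemma card_grid: "real M ^ CARD('d) = 2 * real N"
  using bij_betw_same_card[OF e] by (simp add: card_int_grid card_cartesian_product flip: of_nat_power)

lemma N_pos: "1 \<le> N"
proof -
  have "0 < real M ^ CARD('d)" using M by simp
  then show ?thesis unfolding card_grid by simp
qed

lemma prob_U: "prob_space U" and sets_U[measurable_cong, simp]: "sets U = sets borel"
  using uniform_on_unit_cube by (auto simp: distributions_on_def)

sublocale U: prob_space U by (rule prob_U)

lemma measure_U_UNIV [simp]: "measure U UNIV = 1"
  using U.prob_space sets_eq_imp_space_eq[OF sets_U] by simp

lemma Z_signs: "z \<in> Z \<Longrightarrow> a < N \<Longrightarrow> z a = 1 \<or> z a = - 1"
  by (auto simp: Z_def)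

lemma card_Z: "0 < card Z"
  by (simp add: Z_def card_funcsetE)

lemma \<sigma>_abs:
  assumes "z \<in> Z" "j \<in> int_grid M"
  shows "\<bar>\<sigma> z j\<bar> = 1"
proof -
  have "fst (e j) < N" using bij_betwE[OF e] assms(2) by (force simp: mem_Times_iff)
  then show ?thesis using Z_signs[OF assms(1)] assms(2) by (fastforce simp: \<sigma>_def)
qed

lemma \<sigma>_le_1: "z \<in> Z \<Longrightarrow> \<bar>\<sigma> z j\<bar> \<le> 1"
  using \<sigma>_abs[of z j] by (cases "j \<in> int_grid M") (auto simp: \<sigma>_def)

lemma cell_sets: "{x. cell x = j} \<in> sets borel"
proof -
  have "{x. cell x = j} = {x. \<forall>i. \<lfloor>real M * x $ i\<rfloor> = j $ i}"
    by (auto simp: cell_def vec_eq_iff)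
  also have "\<dots> \<in> sets borel" by measurable
  finally show ?thesis .
qed

text \<open>The half-open cell lies between an open and a closed box of the same volume.\<close>

lemma measure_cell:
  assumes j: "j \<in> int_grid M"
  shows "measure U {x. cell x = j} = 1 / real M ^ CARD('d)"
proof -
  define a b where "a = (\<chi> i. real_of_int (j $ i) / real M)" and "b = (\<chi> i. (real_of_int (j $ i) + 1) / real M)"
  have iff: "cell x = j \<longleftrightarrow> (\<forall>i. a $ i \<le> x $ i \<and> x $ i < b $ i)" for x
    using M by (auto simp: cell_def vec_eq_iff floor_eq_iff a_def b_def field_simps)
  have ab: "a $ i \<le> b $ i" "b $ i - a $ i = 1 / real M" for i
    using M by (auto simp: a_def b_def field_simps)
  have prod: "(\<Prod>i\<in>UNIV. b $ i - a $ i) = 1 / real M ^ CARD('d)"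
    by (simp add: ab power_divide)
  have "0 \<le> a $ i \<and> b $ i \<le> 1" for i
  proof -
    have "0 \<le> j $ i" "j $ i < int M" using j by (auto simp: int_grid_def)
    then have "0 \<le> real_of_int (j $ i)" "real_of_int (j $ i) + 1 \<le> real M"
      by linarith+
    then show ?thesis using M by (simp add: a_def b_def)
  qed
  then have "{x. cell x = j} \<subseteq> unit_cube"
    unfolding iff by (auto intro: order.trans less_imp_le less_le_trans)
  then have eq: "measure U {x. cell x = j} = measure lborel {x. cell x = j}"
    using measure_uniform_on_unit_cube[OF cell_sets] by simp
  have sub: "box a b \<subseteq> {x. cell x = j}" "{x. cell x = j} \<subseteq> cbox a b"
    unfolding iff by (auto simp: mem_box_cart less_imp_le)
  have fm: "{x. cell x = j} \<in> fmeasurable lborel"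
    by (rule fmeasurableI2[OF _ sub(2)]) (use cell_sets in auto)
  have "measure lborel (box a b) \<le> measure lborel {x. cell x = j}"
    using sub fm by (intro measure_mono_fmeasurable) auto
  moreover have "measure lborel {x. cell x = j} \<le> measure lborel (cbox a b)"
    using sub cell_sets by (intro measure_mono_fmeasurable) auto
  ultimately show ?thesis
    using measure_box_cart[of a b] ab prod eq by simp
qed

lemma grid_fun_eq:
  fixes \<psi> :: "_ \<Rightarrow> real"
  assumes "\<And>j. j \<notin> int_grid M \<Longrightarrow> \<psi> j = 0"
  shows "\<psi> (cell x) = (\<Sum>j\<in>int_grid M. \<psi> j * indicator {x. cell x = j} x)"
proof -
  have "(\<Sum>j\<in>int_grid M. \<psi> j * indicator {x. cell x = j} x) = (\<Sum>j\<in>int_grid M. if cell x = j then \<psi> j else 0)"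
    by (intro sum.cong) (auto simp: indicator_def)
  then show ?thesis using assms[of "cell x"] by (simp add: finite_int_grid)
qed

lemma grid_fun_integral:
  fixes \<psi> :: "_ \<Rightarrow> real"
  assumes "\<And>j. j \<notin> int_grid M \<Longrightarrow> \<psi> j = 0"
  shows "integrable U (\<lambda>x. \<psi> (cell x))" "(\<integral>x. \<psi> (cell x) \<partial>U) = (\<Sum>j\<in>int_grid M. \<psi> j) / real M ^ CARD('d)"
proof -
  have int: "integrable U (\<lambda>x. \<psi> j * indicator {x. cell x = j} x)" for j
    using cell_sets by (auto simp: U.emeasure_eq_measure)
  have eq: "(\<lambda>x. \<psi> (cell x)) = (\<lambda>x. \<Sum>j\<in>int_grid M. \<psi> j * indicator {x. cell x = j} x)"
    by (intro ext grid_fun_eq assms)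
  show "integrable U (\<lambda>x. \<psi> (cell x))"
    unfolding eq using int by (rule Bochner_Integration.integrable_sum)
  have "(\<integral>x. \<psi> (cell x) \<partial>U) = (\<Sum>j\<in>int_grid M. \<integral>x. \<psi> j * indicator {x. cell x = j} x \<partial>U)"
    unfolding eq using int by (rule Bochner_Integration.integral_sum)
  also have "\<dots> = (\<Sum>j\<in>int_grid M. \<psi> j * (1 / real M ^ CARD('d)))"
    using cell_sets by (intro sum.cong refl) (simp add: measure_cell)
  finally show "(\<integral>x. \<psi> (cell x) \<partial>U) = (\<Sum>j\<in>int_grid M. \<psi> j) / real M ^ CARD('d)"
    by (simp add: sum_divide_distrib)
qed

lemma sum_grid: "(\<Sum>j\<in>int_grid M. \<psi> (e j)) = (\<Sum>a<N. \<psi> (a, True) + \<psi> (a, False))" for \<psi> :: "_ \<Rightarrow> real"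
proof -
  have "(\<Sum>j\<in>int_grid M. \<psi> (e j)) = (\<Sum>p\<in>{..<N} \<times> UNIV. \<psi> p)"
    by (rule sum.reindex_bij_betw[OF e])
  also have "\<dots> = (\<Sum>a<N. \<Sum>b\<in>UNIV. \<psi> (a, b))"
    by (simp add: sum.cartesian_product)
  finally show ?thesis by (simp add: UNIV_bool add.commute)
qed

text \<open>The opposite signs on the two cells of a pair cancel, so \<open>f z\<close> has integral
  1 for every \<open>z\<close> without normalization.\<close>

lemma integral_\<sigma>: "integrable U (\<lambda>x. \<sigma> z (cell x))" "(\<integral>x. \<sigma> z (cell x) \<partial>U) = 0"
proof -
  have "(\<Sum>j\<in>int_grid M. \<sigma> z j) = (\<Sum>j\<in>int_grid M. (\<lambda>p. if snd p then z (fst p) else - z (fst p)) (e j))"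
    by (intro sum.cong) (auto simp: \<sigma>_def)
  also have "\<dots> = 0" by (subst sum_grid) simp
  finally show "integrable U (\<lambda>x. \<sigma> z (cell x))" "(\<integral>x. \<sigma> z (cell x) \<partial>U) = 0"
    using grid_fun_integral[of "\<sigma> z"] by (auto simp: \<sigma>_def)
qed

text \<open>Both cells of a pair contribute \<open>z a * z' a\<close>, and there are
  \<open>2 * N\<close> cells of equal mass.\<close>

lemma integral_\<sigma>_mult: "integrable U (\<lambda>x. \<sigma> z (cell x) * \<sigma> z' (cell x))"
  "(\<integral>x. \<sigma> z (cell x) * \<sigma> z' (cell x) \<partial>U) = (\<Sum>a<N. z a * z' a) / real N"
proof -
  have "(\<Sum>j\<in>int_grid M. \<sigma> z j * \<sigma> z' j) = (\<Sum>j\<in>int_grid M. (\<lambda>p. z (fst p) * z' (fst p)) (e j))"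
    by (intro sum.cong) (auto simp: \<sigma>_def)
  also have "\<dots> = 2 * (\<Sum>a<N. z a * z' a)" by (subst sum_grid) (simp add: sum_distrib_left)
  finally show "integrable U (\<lambda>x. \<sigma> z (cell x) * \<sigma> z' (cell x))"
    "(\<integral>x. \<sigma> z (cell x) * \<sigma> z' (cell x) \<partial>U) = (\<Sum>a<N. z a * z' a) / real N"
    using grid_fun_integral[of "\<lambda>j. \<sigma> z j * \<sigma> z' j"] by (auto simp: \<sigma>_def card_grid)
qed

lemma \<sigma>_cell_measurable[measurable]: "(\<lambda>x. \<sigma> z (cell x)) \<in> borel_measurable borel"
  using borel_measurable_integrable[OF integral_\<sigma>(1)] by simp

lemma f_measurable[measurable]: "f z \<in> borel_measurable borel"
  unfolding f_def by measurable

lemma f_bounds: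
  assumes "z \<in> Z"
  shows "0 \<le> f z x" "f z x \<le> 2"
proof -
  have "\<bar>\<delta> * \<sigma> z (cell x)\<bar> \<le> 1 * 1"
    unfolding abs_mult using \<delta> \<sigma>_le_1[OF assms] by (intro mult_mono) auto
  then show "0 \<le> f z x" "f z x \<le> 2" unfolding f_def by linarith+
qed

lemma integral_f: "integrable U (f z)" "(\<integral>x. f z x \<partial>U) = 1"
  unfolding f_def using integral_\<sigma>[of z] by (simp_all add: U.prob_space)

lemma integral_f_mult: "integrable U (\<lambda>x. f z x * f z' x)"
  "(\<integral>x. f z x * f z' x \<partial>U) = 1 + \<delta>\<^sup>2 / real N * (\<Sum>a<N. z a * z' a)"
proof -
  have eq: "f z x * f z' x = 1 + \<delta> * \<sigma> z (cell x) + \<delta> * \<sigma> z' (cell x) + \<delta>\<^sup>2 * (\<sigma> z (cell x) * \<sigma> z' (cell x))" for x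
    by (simp add: f_def algebra_simps power2_eq_square)
  show "integrable U (\<lambda>x. f z x * f z' x)"
    "(\<integral>x. f z x * f z' x \<partial>U) = 1 + \<delta>\<^sup>2 / real N * (\<Sum>a<N. z a * z' a)"
    unfolding eq using integral_\<sigma>[of z] integral_\<sigma>[of z'] integral_\<sigma>_mult[of z z']
    by (simp_all add: U.prob_space)
qed

lemma perturbed_distribution:
  assumes z: "z \<in> Z"
  shows "perturbed z \<in> distributions_on unit_cube"
proof -
  have one: "(\<integral>\<^sup>+x. ennreal (f z x) \<partial>U) = 1"
    using integral_f[of z] f_bounds[OF z] by (subst nn_integral_eq_integral) auto
  have sp: "space U = UNIV" using sets_eq_imp_space_eq[OF sets_U] by simp
  interpret D: prob_space "perturbed z"
    by standard (simp add: perturbed_def emeasure_density sp one cong: nn_integral_cong)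
  have cube: "unit_cube \<in> sets (borel :: (real ^ 'd) measure)"
    by (simp add: unit_cube_eq_cbox)
  have "emeasure U unit_cube = 1"
    using uniform_on_unit_cube unfolding distributions_on_def by blast
  then have "measure U unit_cube = 1"
    unfolding measure_def by (simp only: enn2real_1)
  then have "AE x in U. x \<in> unit_cube"
    by (rule U.AE_prob_1)
  then have "AE x in perturbed z. x \<in> unit_cube"
    unfolding perturbed_def by (subst AE_density) auto
  then have "emeasure (perturbed z) unit_cube = 1"
    using cube by (intro D.emeasure_eq_1_AE) (auto simp: perturbed_def)
  then show ?thesis
    using D.prob_space_axioms by (simp add: distributions_on_def perturbed_def)
qed

section \<open>A Lipschitz test function from the distance to the cell walls\<close>

lemma margin_bounds: "0 \<le> margin x" "margin x \<le> 1"
proof -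
  have "0 \<le> Min (range (\<lambda>i. dist_to_int (real M * x $ i)))"
    using dist_to_int_bounds by (subst Min_ge_iff) auto
  moreover have "Min (range (\<lambda>i. dist_to_int (real M * x $ i))) \<le> 1"
    using dist_to_int_bounds by (subst Min_le_iff) auto
  ultimately show "0 \<le> margin x" "margin x \<le> 1"
    using M by (auto simp: margin_def divide_le_eq)
qed

lemma margin_le: "margin x \<le> dist_to_int (real M * x $ i) / real M"
  unfolding margin_def by (intro divide_right_mono Min_le) auto

text \<open>Take the coordinate that attains the minimum for \<open>y\<close>; both points have the
  same floor there, so the distance to the integers changes by at most the coordinate
  difference.\<close>

lemma margin_Lipschitz:
  assumes "cell x = cell y"
  shows "margin x \<le> margin y + norm (x - y)"
proof -
  have "Min (range (\<lambda>i. dist_to_int (real M * y $ i))) \<in> range (\<lambda>i. dist_to_int (real M * y $ i))"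
    by (intro Min_in) auto
  then obtain i where "Min (range (\<lambda>i. dist_to_int (real M * y $ i))) = dist_to_int (real M * y $ i)"
    by (elim imageE)
  then have i: "margin y = dist_to_int (real M * y $ i) / real M"
    by (simp add: margin_def)
  have "\<lfloor>real M * x $ i\<rfloor> = \<lfloor>real M * y $ i\<rfloor>"
    using assms by (simp add: cell_def vec_eq_iff)
  from dist_to_int_Lipschitz[OF this]
  have "dist_to_int (real M * x $ i) \<le> dist_to_int (real M * y $ i) + real M * \<bar>(x - y) $ i\<bar>"
    by (simp add: abs_mult flip: right_diff_distrib)
  also have "\<dots> \<le> dist_to_int (real M * y $ i) + real M * norm (x - y)"
    by (intro add_left_mono mult_left_mono component_le_norm_cart) auto
  finally have "dist_to_int (real M * x $ i) / real M \<le> margin y + norm (x - y)"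
    unfolding i using M by (simp add: field_simps)
  with margin_le[of x i] show ?thesis by linarith
qed

text \<open>Within a cell the sign is constant. Between different cells some coordinate passes an
  integer, and already \<open>margin x + margin y\<close> is at most \<open>norm (x - y)\<close>,
  whatever the signs are.\<close>

lemma test_function_Lipschitz:
  assumes z: "z \<in> Z"
  shows "\<bar>\<sigma> z (cell x) * margin x - \<sigma> z (cell y) * margin y\<bar> \<le> norm (x - y)"
proof (cases "cell x = cell y")
  case True
  have "\<bar>margin x - margin y\<bar> \<le> norm (x - y)"
    using margin_Lipschitz[OF True] margin_Lipschitz[OF True[symmetric]] by (simp add: norm_minus_commute abs_le_iff)
  then have "\<bar>\<sigma> z (cell y)\<bar> * \<bar>margin x - margin y\<bar> \<le> 1 * norm (x - y)"
    using \<sigma>_le_1[OF z] by (intro mult_mono) auto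
  then show ?thesis
    unfolding True by (simp add: abs_mult[symmetric] right_diff_distrib)
next
  case False
  then obtain i where "\<lfloor>real M * x $ i\<rfloor> \<noteq> \<lfloor>real M * y $ i\<rfloor>"
    by (auto simp: cell_def vec_eq_iff)
  then have "dist_to_int (real M * x $ i) + dist_to_int (real M * y $ i) \<le> real M * \<bar>(x - y) $ i\<bar>"
    using dist_to_int_add_le[of "real M * x $ i" "real M * y $ i"]
    by (simp add: abs_mult flip: right_diff_distrib)
  also have "\<dots> \<le> real M * norm (x - y)"
    by (intro mult_left_mono component_le_norm_cart) auto
  finally have "dist_to_int (real M * x $ i) / real M + dist_to_int (real M * y $ i) / real M \<le> norm (x - y)"
    using M by (simp add: field_simps)
  then have "margin x + margin y \<le> norm (x - y)"
    using margin_le[of x i] margin_le[of y i] by linarith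
  moreover have "\<bar>\<sigma> z (cell x) * margin x\<bar> \<le> 1 * margin x" "\<bar>\<sigma> z (cell y) * margin y\<bar> \<le> 1 * margin y"
    unfolding abs_mult using \<sigma>_le_1[OF z] margin_bounds by (intro mult_mono; simp)+
  ultimately show ?thesis by linarith
qed

text \<open>Shrinking a cell by one half about its centre keeps the fraction
  \<open>1 / 2 ^ CARD('d)\<close> of its volume and stays \<open>1 / (4 * M)\<close> away from the
  walls.\<close>

lemma inner_box:
  assumes j: "j \<in> int_grid M"
  defines "B \<equiv> cbox (\<chi> i. (real_of_int (j $ i) + 1 / 4) / real M) (\<chi> i. (real_of_int (j $ i) + 3 / 4) / real M)"
  shows "measure U B = (1 / (2 * real M)) ^ CARD('d)"
    and "x \<in> B \<Longrightarrow> cell x = j" and "x \<in> B \<Longrightarrow> 1 / (4 * real M) \<le> margin x"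
proof -
  have mem: "real_of_int (j $ i) + 1 / 4 \<le> real M * x $ i \<and> real M * x $ i \<le> real_of_int (j $ i) + 3 / 4"
    if "x \<in> B" for x i
    using that M by (simp add: B_def mem_box_cart field_simps)
  have floor: "\<lfloor>real M * x $ i\<rfloor> = j $ i" if "x \<in> B" for x i
    using mem[OF that, of i] by (simp add: floor_eq_iff)
  show cell: "cell x = j" if "x \<in> B" for x
    using floor[OF that] by (simp add: cell_def vec_eq_iff)
  show "1 / (4 * real M) \<le> margin x" if "x \<in> B" for x
  proof -
    have "1 / 4 \<le> dist_to_int (real M * x $ i)" for i
      using mem[OF that, of i] floor[OF that, of i] by (simp add: dist_to_int_def frac_def)
    then have "1 / 4 \<le> Min (range (\<lambda>i. dist_to_int (real M * x $ i)))"
      by (subst Min_ge_iff) auto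
    then have "1 / 4 / real M \<le> margin x"
      unfolding margin_def by (intro divide_right_mono) auto
    then show ?thesis by simp
  qed
  have "B \<subseteq> unit_cube"
  proof
    fix x assume x: "x \<in> B"
    have "0 \<le> x $ i \<and> x $ i \<le> 1" for i
    proof -
      have "0 \<le> j $ i" "j $ i < int M" using j by (auto simp: int_grid_def)
      then have "0 \<le> real_of_int (j $ i)" "real_of_int (j $ i) + 1 \<le> real M"
        by linarith+
      then have lower: "0 \<le> real M * x $ i" and upper: "real M * x $ i \<le> real M * 1"
        using mem[OF x, of i] by linarith+
      from upper have "x $ i \<le> 1"
        by (rule mult_left_le_imp_le) (use M in simp)
      with lower show ?thesis
        using M by (simp add: zero_le_mult_iff)
    qed
    then show "x \<in> unit_cube" by simp
  qed
  then have "measure U B = measure lborel B"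
    by (intro measure_uniform_on_unit_cube) (auto simp: B_def)
  also have "\<dots> = (1 / (2 * real M)) ^ CARD('d)"
    unfolding B_def using M by (subst measure_box_cart(1)) (auto simp: divide_right_mono field_simps power_divide)
  finally show "measure U B = (1 / (2 * real M)) ^ CARD('d)" .
qed

text \<open>The perturbation and the test function carry the same signs, so the mean of
  \<open>h\<close> grows by \<open>\<delta>\<close> times the integral of the margin over the grid
  cells. The inner boxes, of total mass \<open>1 / 2 ^ CARD('d)\<close>, suffice for a bound that is
  uniform in \<open>z\<close>.\<close>

lemma perturbed_far:
  assumes z: "z \<in> Z" and \<epsilon>: "\<epsilon> \<le> \<delta> / (4 * real M * 2 ^ CARD('d))"
  shows "far_from unit_cube \<epsilon> U (perturbed z)"
proof -
  define h where "h x = \<sigma> z (cell x) * margin x" for x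
  have lip: "\<bar>h x - h y\<bar> \<le> norm (x - y)" for x y
    unfolding h_def by (rule test_function_Lipschitz[OF z])
  have "continuous_on UNIV h"
    by (rule lipschitz_on_continuous_on[where L = 1], rule lipschitz_onI)
      (use lip in \<open>auto simp: dist_norm\<close>)
  then have h[measurable]: "h \<in> borel_measurable borel"
    by (rule borel_measurable_continuous_onI)
  have hbd: "\<bar>h x\<bar> \<le> 1" for x
    unfolding h_def abs_mult using \<sigma>_le_1[OF z] margin_bounds by (intro mult_le_one) auto
  have int_h: "integrable U h"
    by (rule U.integrable_bounded[OF _ hbd]) simp
  have int_\<sigma>h: "integrable U (\<lambda>x. \<sigma> z (cell x) * h x)"
  proof (rule U.integrable_bounded[where B = 1])
    show "\<bar>\<sigma> z (cell x) * h x\<bar> \<le> 1" for x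
      unfolding abs_mult using \<sigma>_le_1[OF z] hbd by (intro mult_le_one) auto
  qed simp
  define B where "B j = cbox (\<chi> i. (real_of_int (j $ i) + 1 / 4) / real M) (\<chi> i. (real_of_int (j $ i) + 3 / 4) / real M)"
    for j :: "int ^ 'd"
  note box = inner_box[folded B_def]
  have "1 / (4 * real M * 2 ^ CARD('d)) = (\<Sum>j\<in>int_grid M. 1 / (4 * real M) * measure U (B j))"
    using M box(1) by (simp add: card_int_grid power_divide power_mult_distrib)
  also have "\<dots> = (\<integral>x. (\<Sum>j\<in>int_grid M. 1 / (4 * real M) * indicator (B j) x) \<partial>U)"
    by (subst Bochner_Integration.integral_sum) (auto simp: B_def U.emeasure_eq_measure)
  also have "\<dots> \<le> (\<integral>x. \<sigma> z (cell x) * h x \<partial>U)"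
  proof (rule integral_mono[OF _ int_\<sigma>h])
    show "integrable U (\<lambda>x. \<Sum>j\<in>int_grid M. 1 / (4 * real M) * indicator (B j) x)"
      by (intro Bochner_Integration.integrable_sum) (auto simp: B_def U.emeasure_eq_measure)
    fix x
    \<comment> \<open>An inner box lies in its own cell, so only the summand of the cell of
      \<open>x\<close> can survive.\<close>
    have "(\<Sum>j\<in>int_grid M. 1 / (4 * real M) * indicator (B j) x) =
      (\<Sum>j\<in>int_grid M. if cell x = j then 1 / (4 * real M) * indicator (B j) x else 0)"
      using box(2) by (intro sum.cong refl) (auto simp: indicator_def)
    also have "\<dots> = (if cell x \<in> int_grid M then 1 / (4 * real M) * indicator (B (cell x)) x else 0)"
      by (simp add: finite_int_grid)
    also have "\<dots> \<le> (if cell x \<in> int_grid M then margin x else 0)"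
      using box(3) margin_bounds[of x] by (auto simp: indicator_def)
    also have "\<dots> = \<sigma> z (cell x) * h x"
    proof (cases "cell x \<in> int_grid M")
      case True
      have "\<sigma> z (cell x) * \<sigma> z (cell x) = 1"
        using \<sigma>_abs[OF z True] by (metis abs_mult_self_eq mult_1)
      then show ?thesis using True by (simp add: h_def mult.assoc[symmetric])
    qed (simp add: \<sigma>_def)
    finally show "(\<Sum>j\<in>int_grid M. 1 / (4 * real M) * indicator (B j) x) \<le> \<sigma> z (cell x) * h x" .
  qed
  finally have "\<delta> * (1 / (4 * real M * 2 ^ CARD('d))) \<le> \<delta> * (\<integral>x. \<sigma> z (cell x) * h x \<partial>U)"
    using \<delta> by (intro mult_left_mono) auto
  moreover have "(\<integral>x. h x \<partial>perturbed z) = (\<integral>x. h x + \<delta> * (\<sigma> z (cell x) * h x) \<partial>U)"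
    unfolding perturbed_def using f_bounds[OF z]
    by (subst integral_density) (auto simp: f_def algebra_simps)
  moreover have "\<dots> = (\<integral>x. h x \<partial>U) + \<delta> * (\<integral>x. \<sigma> z (cell x) * h x \<partial>U)"
    using int_h int_\<sigma>h by simp
  ultimately have "\<epsilon> \<le> (\<integral>x. h x \<partial>perturbed z) - (\<integral>x. h x \<partial>U)"
    using \<epsilon> by simp
  then have "ennreal \<epsilon> \<le> ennreal ((\<integral>x. h x \<partial>perturbed z) - (\<integral>x. h x \<partial>U))"
    by (rule ennreal_leI)
  also have "\<dots> \<le> wasserstein unit_cube U (perturbed z)"
    by (rule wasserstein_ge_Lipschitz[OF h hbd lip])
  finally show ?thesis by (simp add: far_from_def)
qed

section \<open>Likelihood ratios and the second moment argument\<close>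

definition likelihood :: "nat \<Rightarrow> (nat \<Rightarrow> real) \<Rightarrow> (nat \<Rightarrow> real ^ 'd) \<Rightarrow> real" where
  "likelihood n z x = (\<Prod>i<n. f z (x i))"

lemma likelihood_measurable[measurable]: "likelihood n z \<in> borel_measurable (\<Pi>\<^sub>M i\<in>{..<n}. U)"
  unfolding likelihood_def by measurable

lemma likelihood_bounds:
  assumes "z \<in> Z"
  shows "0 \<le> likelihood n z x" "likelihood n z x \<le> 2 ^ n"
proof -
  show "0 \<le> likelihood n z x"
    unfolding likelihood_def using f_bounds[OF assms] by (intro prod_nonneg) auto
  have "likelihood n z x \<le> (\<Prod>i<n. 2)"
    unfolding likelihood_def using f_bounds[OF assms] by (intro prod_mono) auto
  then show "likelihood n z x \<le> 2 ^ n" by simp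
qed

lemma PiM_perturbed:
  assumes z: "z \<in> Z"
  shows "(\<Pi>\<^sub>M i\<in>{..<n}. perturbed z) = density (\<Pi>\<^sub>M i\<in>{..<n}. U) (\<lambda>x. ennreal (likelihood n z x))"
proof -
  have "prob_space (density U (\<lambda>x. ennreal (f z x)))"
    using perturbed_distribution[OF z] by (simp add: distributions_on_def perturbed_def)
  then have "(\<Pi>\<^sub>M i\<in>{..<n}. perturbed z) = density (\<Pi>\<^sub>M i\<in>{..<n}. U) (\<lambda>x. \<Prod>i<n. ennreal (f z (x i)))"
    unfolding perturbed_def by (intro PiM_density prob_U) auto
  then show ?thesis
    using f_bounds[OF z] by (simp add: likelihood_def prod_ennreal)
qed

lemma integral_likelihood:
  shows "(\<integral>x. likelihood n z x \<partial>(\<Pi>\<^sub>M i\<in>{..<n}. U)) = 1"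
    and "(\<integral>x. likelihood n z x * likelihood n z' x \<partial>(\<Pi>\<^sub>M i\<in>{..<n}. U)) =
      (1 + \<delta>\<^sup>2 / real N * (\<Sum>a<N. z a * z' a)) ^ n"
proof -
  interpret P: product_prob_space "\<lambda>_. U" ..
  show "(\<integral>x. likelihood n z x \<partial>(\<Pi>\<^sub>M i\<in>{..<n}. U)) = 1"
    unfolding likelihood_def using integral_f[of z] by (subst P.product_integral_prod) auto
  show "(\<integral>x. likelihood n z x * likelihood n z' x \<partial>(\<Pi>\<^sub>M i\<in>{..<n}. U)) =
      (1 + \<delta>\<^sup>2 / real N * (\<Sum>a<N. z a * z' a)) ^ n"
    unfolding likelihood_def prod.distrib[symmetric]
    using integral_f_mult[of z z'] by (subst P.product_integral_prod) auto
qed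

text \<open>Le Cam's method for the uniform distribution against the mixture of all perturbations.
  The tester rejects the mixture with probability at least 2/3 and the uniform distribution with
  probability at most 1/3. This gap forces the second moment of the mixture likelihood
  \<open>G\<close> up to 10/9, hence keeps the exponent in \<open>sign_average_le\<close> away from
  0.\<close>

lemma tester_sample_bound:
  fixes A :: "(nat \<Rightarrow> real ^ 'd) \<Rightarrow> bool measure"
  assumes test: "uniformity_tester unit_cube \<epsilon> n A"
    and \<epsilon>: "\<epsilon> \<le> \<delta> / (4 * real M * 2 ^ CARD('d))"
  shows "real M ^ CARD('d) \<le> 10 * \<delta> ^ 4 * (real n)\<^sup>2"
proof -
  have A: "A \<in> (\<Pi>\<^sub>M i\<in>{..<n}. borel) \<rightarrow>\<^sub>M prob_algebra (count_space UNIV)"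
    and acc: "measure (verdict n A U) {True} \<ge> 2 / 3"
    and rej: "\<And>q. q \<in> distributions_on unit_cube \<Longrightarrow> far_from unit_cube \<epsilon> U q \<Longrightarrow>
      measure (verdict n A q) {False} \<ge> 2 / 3"
    using test by (auto simp: uniformity_tester_def randomized_algorithms_def)
  define P where "P = (\<Pi>\<^sub>M i\<in>{..<n}. U)"
  \<comment> \<open>A rejection probability in place of a rejection region covers randomized
    testers.\<close>
  define \<phi> where "\<phi> x = measure (A x) {False}" for x
  interpret P: prob_space P unfolding P_def by (intro prob_space_PiM prob_U)
  have sets_P: "sets (\<Pi>\<^sub>M i\<in>{..<n}. q) = sets (\<Pi>\<^sub>M i\<in>{..<n}. borel)" if "sets q = sets borel" for q :: "(real ^ 'd) measure"
    using that by (intro sets_PiM_cong refl)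
  have A_q: "A \<in> (\<Pi>\<^sub>M i\<in>{..<n}. q) \<rightarrow>\<^sub>M prob_algebra (count_space UNIV)" if "sets q = sets borel" for q :: "(real ^ 'd) measure"
    using A unfolding measurable_cong_sets[OF sets_P[OF that] refl] .
  have A_P: "A \<in> P \<rightarrow>\<^sub>M prob_algebra (count_space UNIV)"
    unfolding P_def by (rule A_q) simp
  have \<phi>_meas[measurable]: "\<phi> \<in> borel_measurable P"
    unfolding \<phi>_def
    by (rule measurable_compose[OF measurable_prob_algebraD[OF A_P] measurable_measure_subprob_algebra]) simp
  have \<phi>_bd: "0 \<le> \<phi> x" "\<phi> x \<le> 1" if "x \<in> space P" for x
  proof -
    have "prob_space (A x)"
      using measurable_space[OF A_P that] by (simp add: space_prob_algebra)
    then show "0 \<le> \<phi> x" "\<phi> x \<le> 1" unfolding \<phi>_def by (auto intro: prob_space.prob_le_1)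
  qed
  have verdict: "measure (verdict n A q) B = (\<integral>x. measure (A x) B \<partial>(\<Pi>\<^sub>M i\<in>{..<n}. q))"
    if "prob_space q" "sets q = sets borel" for q B
  proof -
    interpret Q: prob_space "\<Pi>\<^sub>M i\<in>{..<n}. q" using that by (intro prob_space_PiM)
    show ?thesis
      unfolding verdict_def
      by (rule Q.measure_bind[OF measurable_prob_algebraD[OF A_q[OF that(2)]]]) simp
  qed
  have int_\<phi>: "integrable P \<phi>"
    by (rule P.integrable_const_bound[where B = 1]) (use \<phi>_bd in auto)
  have null: "(\<integral>x. \<phi> x \<partial>P) \<le> 1 / 3"
  proof -
    have "(\<integral>x. measure (A x) {True} \<partial>P) = (\<integral>x. 1 - \<phi> x \<partial>P)"
    proof (rule Bochner_Integration.integral_cong[OF refl])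
      fix x assume x: "x \<in> space P"
      have Ax: "prob_space (A x)" "sets (A x) = UNIV"
        using measurable_space[OF A_P x] by (auto simp: space_prob_algebra)
      interpret Ax: prob_space "A x" by (rule Ax)
      have "space (A x) = UNIV" using sets_eq_imp_space_eq[of "A x" "count_space UNIV"] Ax(2) by simp
      moreover have "- {False} = {True}" by auto
      ultimately show "measure (A x) {True} = 1 - \<phi> x"
        using Ax.prob_compl[of "{False}"] Ax(2) by (simp add: \<phi>_def Compl_eq_Diff_UNIV[symmetric])
    qed
    then show ?thesis
      using acc verdict[OF prob_U sets_U, of "{True}"] int_\<phi> by (simp add: P_def[symmetric] P.prob_space)
  qed
  have lik_meas[measurable]: "likelihood n z \<in> borel_measurable P" for z
    unfolding P_def by (rule likelihood_measurable)
  have lik_abs: "\<bar>likelihood n z x\<bar> \<le> 2 ^ n" if "z \<in> Z" for z x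
    using likelihood_bounds[OF that, of n x] by simp
  have int_lik: "integrable P (likelihood n z)" if "z \<in> Z" for z
    by (rule P.integrable_bounded[OF lik_meas lik_abs[OF that]])
  have int_lik2: "integrable P (\<lambda>x. likelihood n z x * likelihood n z' x)" if "z \<in> Z" "z' \<in> Z" for z z'
  proof (rule P.integrable_bounded[where B = "2 ^ n * 2 ^ n"])
    show "\<bar>likelihood n z x * likelihood n z' x\<bar> \<le> 2 ^ n * 2 ^ n" for x
      unfolding abs_mult by (intro mult_mono lik_abs that) auto
  qed simp
  have int_\<phi>lik: "integrable P (\<lambda>x. likelihood n z x * \<phi> x)" if "z \<in> Z" for z
  proof (rule P.integrable_const_bound[where B = "2 ^ n"])
    show "AE x in P. norm (likelihood n z x * \<phi> x) \<le> 2 ^ n"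
    proof (rule AE_I2)
      fix x assume x: "x \<in> space P"
      have "\<bar>likelihood n z x\<bar> * \<bar>\<phi> x\<bar> \<le> 2 ^ n * 1"
        using lik_abs[OF that] \<phi>_bd[OF x] by (intro mult_mono) auto
      then show "norm (likelihood n z x * \<phi> x) \<le> 2 ^ n" by (simp add: abs_mult)
    qed
  qed simp
  have far: "2 / 3 \<le> (\<integral>x. likelihood n z x * \<phi> x \<partial>P)" if z: "z \<in> Z" for z
  proof -
    have q: "perturbed z \<in> distributions_on unit_cube" by (rule perturbed_distribution[OF z])
    then have "2 / 3 \<le> measure (verdict n A (perturbed z)) {False}"
      by (rule rej) (rule perturbed_far[OF z \<epsilon>])
    also have "\<dots> = (\<integral>x. \<phi> x \<partial>density P (\<lambda>x. ennreal (likelihood n z x)))"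
      using q unfolding \<phi>_def P_def PiM_perturbed[OF z, symmetric]
      by (intro verdict) (auto simp: distributions_on_def)
    also have "\<dots> = (\<integral>x. likelihood n z x * \<phi> x \<partial>P)"
      using likelihood_bounds[OF z] by (subst integral_density) auto
    finally show ?thesis .
  qed
  define W where "W = real (card Z)"
  have W: "0 < W" using card_Z by (simp add: W_def)
  define G where "G x = (\<Sum>z\<in>Z. likelihood n z x) / W" for x
  have int_G: "integrable P G" and mean_G: "(\<integral>x. G x \<partial>P) = 1"
    unfolding G_def using int_lik W integral_likelihood(1)[where n = n, folded P_def] by (simp_all add: W_def)
  have G2: "(G x)\<^sup>2 = (\<Sum>z\<in>Z. \<Sum>z'\<in>Z. likelihood n z x * likelihood n z' x) / W\<^sup>2" for x
    by (simp add: G_def power2_eq_square sum_product)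
  have int_G2: "integrable P (\<lambda>x. (G x)\<^sup>2)"
    unfolding G2 using int_lik2 by simp
  have "(\<integral>x. (G x)\<^sup>2 \<partial>P) = (\<Sum>z\<in>Z. \<Sum>z'\<in>Z. (1 + \<delta>\<^sup>2 / N * (\<Sum>a<N. z a * z' a)) ^ n) / W\<^sup>2"
    unfolding G2 using int_lik2 integral_likelihood(2)[where n = n, folded P_def] by simp
  also have "\<dots> \<le> W\<^sup>2 * exp ((real n)\<^sup>2 * \<delta> ^ 4 / (2 * real N)) / W\<^sup>2"
    unfolding W_def Z_def using sign_average_le[OF N_pos, of \<delta> n] \<delta> by (intro divide_right_mono) auto
  also have "\<dots> = exp ((real n)\<^sup>2 * \<delta> ^ 4 / (2 * real N))"
    using W by simp
  finally have second: "(\<integral>x. (G x)\<^sup>2 \<partial>P) \<le> exp ((real n)\<^sup>2 * \<delta> ^ 4 / (2 * real N))" .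
  have G\<phi>: "G x * \<phi> x = (\<Sum>z\<in>Z. likelihood n z x * \<phi> x) / W" for x
    by (simp add: G_def sum_distrib_right)
  have int_G\<phi>: "integrable P (\<lambda>x. G x * \<phi> x)"
    unfolding G\<phi> using int_\<phi>lik by simp
  have "2 / 3 = (\<Sum>z\<in>Z. 2 / 3) / W" using W by (simp add: W_def)
  also have "\<dots> \<le> (\<Sum>z\<in>Z. \<integral>x. likelihood n z x * \<phi> x \<partial>P) / W"
    using far W by (intro divide_right_mono sum_mono) auto
  also have "\<dots> = (\<integral>x. G x * \<phi> x \<partial>P)"
    unfolding G\<phi> using int_\<phi>lik by simp
  finally have "1 / 3 \<le> (\<integral>x. G x * \<phi> x \<partial>P) - (\<integral>x. \<phi> x \<partial>P)"
    using null by linarith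
  also have "\<dots> = (\<integral>x. G x * \<phi> x - \<phi> x \<partial>P)"
    using int_G\<phi> int_\<phi> by simp
  \<comment> \<open>The pointwise form of Cauchy-Schwarz: \<open>\<bar>G x - 1\<bar> \<le> 3 / 2 *
    ((G x - 1)\<^sup>2 + 1 / 9)\<close>, expanded. Balancing at 1/3, the size of the gap, yields the
    same 1/9 for the excess of the second moment over 1.\<close>
  also have "\<dots> \<le> (\<integral>x. 3 / 2 * (G x)\<^sup>2 - 3 * G x + 5 / 3 \<partial>P)"
  proof (rule integral_mono)
    fix x assume x: "x \<in> space P"
    have "(G x - 1) * \<phi> x \<le> \<bar>G x - 1\<bar> * 1"
      using \<phi>_bd[OF x] by (intro mult_mono) auto
    moreover have "0 \<le> (\<bar>G x - 1\<bar> - 1 / 3)\<^sup>2" by simp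
    then have "2 / 3 * \<bar>G x - 1\<bar> \<le> (G x - 1)\<^sup>2 + 1 / 9"
      by (simp add: power2_diff power_divide)
    ultimately show "G x * \<phi> x - \<phi> x \<le> 3 / 2 * (G x)\<^sup>2 - 3 * G x + 5 / 3"
      by (simp add: power2_eq_square algebra_simps)
  qed (use int_G int_G2 int_G\<phi> int_\<phi> in auto)
  also have "\<dots> = 3 / 2 * (\<integral>x. (G x)\<^sup>2 \<partial>P) - 4 / 3"
    using int_G int_G2 mean_G by (simp add: P.prob_space)
  finally have E: "10 / 9 \<le> exp ((real n)\<^sup>2 * \<delta> ^ 4 / (2 * real N))"
    using second by linarith
  define y where "y = (real n)\<^sup>2 * \<delta> ^ 4 / (2 * real N)"
  \<comment> \<open>From \<open>exp y \<ge> 10 / 9\<close> and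
    \<open>exp (- y) \<ge> 1 - y\<close>.\<close>
  have "1 / 10 \<le> y"
  proof (rule ccontr)
    assume "\<not> 1 / 10 \<le> y"
    then have "9 / 10 < exp (- y)"
      using exp_ge_add_one_self[of "- y"] by linarith
    then have "10 / 9 * (9 / 10) < exp y * exp (- y)"
      using E unfolding y_def[symmetric] by (intro mult_le_less_imp_less) auto
    then show False by (simp flip: exp_add)
  qed
  then show ?thesis
    unfolding y_def card_grid using N_pos by (simp add: field_simps)
qed

end

section \<open>Choice of grid size and perturbation strength\<close>

lemma tester_lower_bound:
  fixes A :: "(nat \<Rightarrow> real ^ 'd) \<Rightarrow> bool measure"
  assumes M: "0 < M" "even M" and \<delta>: "0 < \<delta>" "\<delta> \<le> 1"
    and test: "uniformity_tester unit_cube \<epsilon> n A"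
    and \<epsilon>: "\<epsilon> \<le> \<delta> / (4 * real M * 2 ^ CARD('d))"
  shows "real M ^ CARD('d) \<le> 10 * \<delta> ^ 4 * (real n)\<^sup>2"
proof -
  \<comment> \<open>An even \<open>M\<close> makes the number of cells even. Any pairing will do:
    neither the distance bound nor the second moment depends on which cells form a pair.\<close>
  have "even (M ^ CARD('d))" using M by simp
  then obtain N where N: "M ^ CARD('d) = 2 * N" by (elim evenE)
  have "card (int_grid M :: (int ^ 'd) set) = card ({..<N} \<times> (UNIV :: bool set))"
    by (simp add: card_int_grid card_cartesian_product N)
  then obtain e where "bij_betw e (int_grid M :: (int ^ 'd) set) ({..<N} \<times> (UNIV :: bool set))"
    using finite_same_card_bij[of "int_grid M :: (int ^ 'd) set" "{..<N} \<times> (UNIV :: bool set)"]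
    by (auto simp: finite_int_grid)
  then interpret signed_grid M N e \<delta>
    using M \<delta> by unfold_locales
  show ?thesis by (rule tester_sample_bound[OF test \<epsilon>])
qed

text \<open>For \<open>M = 2\<close> the constant \<open>2 ^ (CARD('d) + 3)\<close> equals
  \<open>4 * M * 2 ^ CARD('d)\<close>, so \<open>\<delta> = K * \<epsilon>\<close> meets the
  distance requirement with equality; the bound on \<open>\<epsilon>\<close> expresses
  \<open>\<delta> \<le> 1\<close>.\<close>

lemma tester_lower_bound_quadratic:
  fixes A :: "(nat \<Rightarrow> real ^ 'd) \<Rightarrow> bool measure"
  assumes \<epsilon>: "0 < \<epsilon>" "\<epsilon> \<le> 1 / 2 ^ (CARD('d) + 3)" and test: "uniformity_tester unit_cube \<epsilon> n A"
  shows "1 / (4 * (2 ^ (CARD('d) + 3))\<^sup>2) * \<epsilon> powr (- 2) \<le> real n"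
proof -
  define K where "K = (2::real) ^ (CARD('d) + 3)"
  have K: "0 < K" by (simp add: K_def)
  have \<delta>: "0 < K * \<epsilon>" "K * \<epsilon> \<le> 1"
    using \<epsilon> K by (auto simp: K_def[symmetric] field_simps)
  have "\<epsilon> \<le> K * \<epsilon> / (4 * real 2 * 2 ^ CARD('d))"
    by (simp add: K_def power_add)
  from tester_lower_bound[OF _ _ \<delta> test this]
  have "2 ^ CARD('d) \<le> 10 * (K * \<epsilon>) ^ 4 * (real n)\<^sup>2" by simp
  moreover have "(1::real) \<le> 2 ^ CARD('d)" by simp
  \<comment> \<open>The constant 10 is enlarged to a perfect square before a root is taken.\<close>
  moreover have "10 * (K * \<epsilon>) ^ 4 * (real n)\<^sup>2 \<le> 16 * (K * \<epsilon>) ^ 4 * (real n)\<^sup>2"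
    by (intro mult_right_mono) auto
  ultimately have "1 \<le> 16 * (K * \<epsilon>) ^ 4 * (real n)\<^sup>2"
    by linarith
  also have "\<dots> = (4 * (K * \<epsilon>)\<^sup>2 * real n)\<^sup>2"
    by (simp add: power_mult_distrib flip: power_mult)
  finally have "1\<^sup>2 \<le> (4 * (K * \<epsilon>)\<^sup>2 * real n)\<^sup>2" by simp
  then have "1 \<le> 4 * (K * \<epsilon>)\<^sup>2 * real n"
    by (rule power2_le_imp_le) simp
  then have "1 / (4 * (K * \<epsilon>)\<^sup>2) \<le> real n"
    using \<epsilon>(1) K by (subst pos_divide_le_eq) (simp_all add: mult.commute)
  moreover have "1 / (4 * K\<^sup>2) * \<epsilon> powr (- 2) = 1 / (4 * (K * \<epsilon>)\<^sup>2)"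
    using \<epsilon> by (simp add: powr_minus_divide powr_numeral power_mult_distrib)
  ultimately show ?thesis
    unfolding K_def[symmetric] by simp
qed

text \<open>Full strength \<open>\<delta> = 1\<close> admits the finest grid. Twice the floor of
  \<open>x = 1 / (K * \<epsilon>)\<close> is even and, as \<open>x \<ge> 2\<close>, lies between
  \<open>x\<close> and \<open>2 * x\<close>: the upper end is accounted for in \<open>K\<close>, the
  lower end enters the sample bound.\<close>

lemma tester_lower_bound_dimension:
  fixes A :: "(nat \<Rightarrow> real ^ 'd) \<Rightarrow> bool measure"
  assumes \<epsilon>: "0 < \<epsilon>" "\<epsilon> \<le> 1 / (2 * 2 ^ (CARD('d) + 3))" and test: "uniformity_tester unit_cube \<epsilon> n A"
  shows "1 / (4 * (2 ^ (CARD('d) + 3)) powr (real CARD('d) / 2)) * \<epsilon> powr (- (real CARD('d) / 2)) \<le> real n"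
proof -
  define K where "K = (2::real) ^ (CARD('d) + 3)"
  have K: "0 < K" by (simp add: K_def)
  define x where "x = 1 / (K * \<epsilon>)"
  have x: "2 \<le> x"
    using \<epsilon> K unfolding x_def K_def[symmetric] by (simp add: field_simps)
  define M where "M = 2 * nat \<lfloor>x\<rfloor>"
  have M: "x \<le> real M" "real M \<le> 2 * x" "0 < M" "even M"
    using x unfolding M_def by (simp_all) linarith+
  have "4 * real M * 2 ^ CARD('d) \<le> 4 * (2 * x) * 2 ^ CARD('d)"
    using M by (intro mult_right_mono mult_left_mono) auto
  also have "\<dots> = 1 / \<epsilon>"
    using \<epsilon> K by (simp add: x_def K_def power_add)
  finally have "\<epsilon> \<le> 1 / (4 * real M * 2 ^ CARD('d))"
    using \<epsilon> M by (simp add: field_simps)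
  from tester_lower_bound[OF M(3,4) _ _ test this]
  have "real M ^ CARD('d) \<le> 10 * (real n)\<^sup>2" by simp
  moreover have "x ^ CARD('d) \<le> real M ^ CARD('d)"
    using M x by (intro power_mono) auto
  moreover have "x ^ CARD('d) = (x powr (real CARD('d) / 2))\<^sup>2"
    using x by (simp add: powr_realpow[symmetric] powr_powr)
  ultimately have "(x powr (real CARD('d) / 2))\<^sup>2 \<le> 16 * (real n)\<^sup>2"
    using zero_le_power2[of "real n"] by linarith
  then have "(x powr (real CARD('d) / 2))\<^sup>2 \<le> (4 * real n)\<^sup>2"
    by (simp add: power_mult_distrib)
  then have "x powr (real CARD('d) / 2) \<le> 4 * real n"
    by (rule power2_le_imp_le) simp
  moreover have "x powr (real CARD('d) / 2) = 1 / K powr (real CARD('d) / 2) * \<epsilon> powr (- (real CARD('d) / 2))"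
    using \<epsilon> K by (simp add: x_def powr_divide powr_mult powr_minus_divide)
  ultimately show ?thesis
    unfolding K_def[symmetric] by simp
qed

theorem corollary20:
  fixes rate :: "real \<Rightarrow> real"
  defines "rate \<equiv> (\<lambda>\<epsilon>. \<epsilon> powr (- max (real CARD('d::finite) / 2) 2))"
  shows
    "(\<exists>(n :: real \<Rightarrow> nat) (A :: real \<Rightarrow> (nat \<Rightarrow> real ^ 'd) \<Rightarrow> bool measure).
        (\<lambda>\<epsilon>. real (n \<epsilon>)) \<in> soft_bigo rate \<and>
        (\<forall>\<epsilon>>0. uniformity_tester unit_cube \<epsilon> (n \<epsilon>) (A \<epsilon>))) \<and>
     (\<exists>c>0. \<forall>\<^sub>F \<epsilon> in at_right 0.
        \<forall>(n :: nat) (A :: (nat \<Rightarrow> real ^ 'd) \<Rightarrow> bool measure).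
          uniformity_tester unit_cube \<epsilon> n A \<longrightarrow> c * rate \<epsilon> \<le> real n) \<and>
     (\<exists>(n :: real \<Rightarrow> nat) (A :: real \<Rightarrow> (nat \<Rightarrow> real ^ 'd) \<Rightarrow> bool measure).
        (\<lambda>\<epsilon>. real (n \<epsilon>)) \<in> soft_bigo rate \<and>
        (\<forall>\<epsilon>>0. uniformity_tester unit_ball \<epsilon> (n \<epsilon>) (A \<epsilon>)))"
proof (intro conjI)
  show "\<exists>(n :: real \<Rightarrow> nat) (A :: real \<Rightarrow> (nat \<Rightarrow> real ^ 'd) \<Rightarrow> bool measure).
      (\<lambda>\<epsilon>. real (n \<epsilon>)) \<in> soft_bigo rate \<and> (\<forall>\<epsilon>>0. uniformity_tester unit_cube \<epsilon> (n \<epsilon>) (A \<epsilon>))"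
    unfolding rate_def by (rule soft_bigo_tester[OF _ uniform_on_unit_cube]) (force simp: abs_le_iff)
  show "\<exists>(n :: real \<Rightarrow> nat) (A :: real \<Rightarrow> (nat \<Rightarrow> real ^ 'd) \<Rightarrow> bool measure).
      (\<lambda>\<epsilon>. real (n \<epsilon>)) \<in> soft_bigo rate \<and> (\<forall>\<epsilon>>0. uniformity_tester unit_ball \<epsilon> (n \<epsilon>) (A \<epsilon>))"
    unfolding rate_def
  proof (rule soft_bigo_tester[OF _ uniform_on_unit_ball], rule subsetI)
    fix x :: "real ^ 'd" assume "x \<in> unit_ball"
    then have "\<bar>x $ i\<bar> \<le> 1" for i
      using component_le_norm_cart[of x i] by simp
    then show "x \<in> {x. \<forall>i. \<bar>x $ i\<bar> \<le> 1}" by simp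
  qed
  define K where "K = (2::real) ^ (CARD('d) + 3)"
  \<comment> \<open>The smaller constant serves both regimes; for \<open>\<epsilon>\<close> below
    \<open>1 / (2 * K)\<close> both lower bounds are available.\<close>
  define c where "c = min (1 / (4 * K\<^sup>2)) (1 / (4 * K powr (real CARD('d) / 2)))"
  have K: "0 < K" by (simp add: K_def)
  have c: "0 < c" using K by (simp add: c_def)
  have "\<forall>\<^sub>F \<epsilon> in at_right 0. \<epsilon> \<in> {0<..<1 / (2 * K)}"
    using K by (intro eventually_at_right_real) simp
  then have "\<forall>\<^sub>F \<epsilon> in at_right 0. \<forall>(n :: nat) (A :: (nat \<Rightarrow> real ^ 'd) \<Rightarrow> bool measure).
      uniformity_tester unit_cube \<epsilon> n A \<longrightarrow> c * rate \<epsilon> \<le> real n"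
  proof (eventually_elim, intro allI impI)
    fix \<epsilon> n and A :: "(nat \<Rightarrow> real ^ 'd) \<Rightarrow> bool measure"
    assume "\<epsilon> \<in> {0<..<1 / (2 * K)}" and test: "uniformity_tester unit_cube \<epsilon> n A"
    then have \<epsilon>: "0 < \<epsilon>" "\<epsilon> \<le> 1 / (2 * K)" by auto
    moreover have "1 / (2 * K) \<le> 1 / K" using K by (simp add: field_simps)
    ultimately have \<epsilon>': "\<epsilon> \<le> 1 / K" by linarith
    show "c * rate \<epsilon> \<le> real n"
    proof (cases "real CARD('d) / 2 \<le> 2")
      case True
      then have "c * rate \<epsilon> = c * \<epsilon> powr (- 2)" by (simp add: rate_def max_def)
      also have "\<dots> \<le> 1 / (4 * K\<^sup>2) * \<epsilon> powr (- 2)"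
        by (intro mult_right_mono) (auto simp: c_def)
      also have "\<dots> \<le> real n"
        unfolding K_def by (rule tester_lower_bound_quadratic[OF \<epsilon>(1) \<epsilon>'[unfolded K_def] test])
      finally show ?thesis .
    next
      case False
      then have "c * rate \<epsilon> = c * \<epsilon> powr (- (real CARD('d) / 2))" by (simp add: rate_def max_def)
      also have "\<dots> \<le> 1 / (4 * K powr (real CARD('d) / 2)) * \<epsilon> powr (- (real CARD('d) / 2))"
        by (intro mult_right_mono) (auto simp: c_def)
      also have "\<dots> \<le> real n"
        unfolding K_def by (rule tester_lower_bound_dimension[OF \<epsilon>(1) \<epsilon>(2)[unfolded K_def] test])
      finally show ?thesis .
    qed
  qed
  with c show "\<exists>c>0. \<forall>\<^sub>F \<epsilon> in at_right 0. \<forall>(n :: nat) (A :: (nat \<Rightarrow> real ^ 'd) \<Rightarrow> bool measure).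
      uniformity_tester unit_cube \<epsilon> n A \<longrightarrow> c * rate \<epsilon> \<le> real n"
    by blast
qed

end
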